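(* Let $X$ be a finite set, let $S$ be a finite set with $|S| = 2^l$, and let $F$ be a two-universal family of functions $f: X \to S$ with $|F| = 2^{\alpha}$. Let $P_{F_R}$ be a probability distribution on $F$ satisfying $H_{\min}(P_{F_R}) \ge \beta$, i.e. $P_{F_R}(f) \le 2^{-\beta}$ for every $f \in F$; a function $f_r$ is selected according to $P_{F_R}$ (through a random seed $R \in \{0,1\}^{\alpha}$). Let $\rho_{XE} = \sum_{x \in X} |x\rangle\langle x|_X \otimes \rho_E^{[x]}$ be a classical-quantum state. For each $f \in F$, let $\rho^{[f]}_{SE} = \sum_{s \in S} |s\rangle\langle s|_S \otimes \rho_E^{[f,s]}$ with $\rho_E^{[f,s]} = \sum_{x: f(x)=s} \rho_E^{[x]}$. Then for every $\varepsilon \ge 0$, $$\Delta := \sum_{f \in F} P_{F_R}(f)\, D_u(S|E)_{\rho^{[f]}} \le \frac{1}{2}\cdot 2^{\alpha-\beta}\cdot 2^{-\frac{1}{2}\left(H_{\min}^{\varepsilon}(X|E)_{\rho} - l\right)} + \varepsilon .$$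
   Context: A family $F$ of functions $X \to S$ is two-universal if for all $x \neq x'$ in $X$, $\Pr_{f}[f(x) = f(x')] \le 1/|S|$ when $f$ is chosen uniformly from $F$. For a distribution $P$, $H_{\min}(P) = -\log_2 \max_f P(f)$. For a cq-state $\rho_{SE}$, the distance from uniform is $D_u(S|E)_\rho = \min_{\sigma_E} \frac{1}{2}\left\| \rho_{SE} - \omega_S \otimes \sigma_E \right\|_1$, where $\omega_S = 2^{-l}\mathbb{1}_S$ is the maximally mixed state on $S$ and the minimum is over states $\sigma_E$. The conditional min-entropy is $H_{\min}(X|E)_\rho = \max_{\sigma_E} \sup\{\lambda \in \mathbb{R} : \rho_{XE} \le 2^{-\lambda}\mathbb{1}_X \otimes \sigma_E\}$, and the smooth min-entropy $H_{\min}^{\varepsilon}(X|E)_\rho$ is the maximum of $H_{\min}(X|E)_{\tilde\rho}$ over sub-normalized states $\tilde\rho_{XE}$ within purified distance $\varepsilon$ of $\rho_{XE}$. $E$ denotes the eavesdropper's quantum side information. *)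

theory Defs
  imports "Jordan_Normal_Form.Char_Poly" "HOL-Library.Extended_Real" "HOL-Library.Cardinality"
begin

definition mtrace :: "complex mat \<Rightarrow> complex" where
  "mtrace A = (\<Sum>i<dim_row A. A $$ (i,i))"

definition adj :: "complex mat \<Rightarrow> complex mat" where
  "adj A = mat (dim_col A) (dim_row A) (\<lambda>(i,j). cnj (A $$ (j,i)))"

definition psd :: "nat \<Rightarrow> complex mat \<Rightarrow> bool" where
  "psd n A \<longleftrightarrow> A \<in> carrier_mat n n \<and>
     (\<forall>v \<in> carrier_vec n. Im (\<Sum>i<n. cnj (v $ i) * (A *\<^sub>v v) $ i) = 0 \<and>
                            Re (\<Sum>i<n. cnj (v $ i) * (A *\<^sub>v v) $ i) \<ge> 0)"

definition mle :: "nat \<Rightarrow> complex mat \<Rightarrow> complex mat \<Rightarrow> bool" where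
  "mle n A B \<longleftrightarrow> A \<in> carrier_mat n n \<and> B \<in> carrier_mat n n \<and> psd n (B - A)"

definition is_state :: "nat \<Rightarrow> complex mat \<Rightarrow> bool" where
  "is_state n \<rho> \<longleftrightarrow> psd n \<rho> \<and> mtrace \<rho> = 1"

definition is_subnormalized :: "nat \<Rightarrow> complex mat \<Rightarrow> bool" where
  "is_subnormalized n \<rho> \<longleftrightarrow> psd n \<rho> \<and> Re (mtrace \<rho>) \<le> 1"

definition trace_norm :: "complex mat \<Rightarrow> real" where
  "trace_norm A = (\<Sum>ev \<in># proots (char_poly (adj A * A)). sqrt (Re ev))"

definition msqrt :: "nat \<Rightarrow> complex mat \<Rightarrow> complex mat" where
  "msqrt n A = (THE B. psd n B \<and> B * B = A)"

definition gen_fidelity :: "nat \<Rightarrow> complex mat \<Rightarrow> complex mat \<Rightarrow> real" where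
  "gen_fidelity n \<rho> \<sigma> = trace_norm (msqrt n \<rho> * msqrt n \<sigma>)
      + sqrt ((1 - Re (mtrace \<rho>)) * (1 - Re (mtrace \<sigma>)))"

definition purified_distance :: "nat \<Rightarrow> complex mat \<Rightarrow> complex mat \<Rightarrow> real" where
  "purified_distance n \<rho> \<sigma> = sqrt (1 - (gen_fidelity n \<rho> \<sigma>)\<^sup>2)"

definition kron :: "complex mat \<Rightarrow> complex mat \<Rightarrow> complex mat" where
  "kron A B = mat (dim_row A * dim_row B) (dim_col A * dim_col B)
     (\<lambda>(i,j). A $$ (i div dim_row B, j div dim_col B) * B $$ (i mod dim_row B, j mod dim_col B))"

definition msum :: "nat \<Rightarrow> 'i set \<Rightarrow> ('i \<Rightarrow> complex mat) \<Rightarrow> complex mat" where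
  "msum n I A = mat n n (\<lambda>p. \<Sum>k\<in>I. A k $$ p)"

definition basis_idx :: "'a::finite \<Rightarrow> nat" where
  "basis_idx = (SOME g. bij_betw g (UNIV :: 'a set) {0..<CARD('a)})"

definition proj_cls :: "'a::finite \<Rightarrow> complex mat" where
  "proj_cls x = mat CARD('a) CARD('a)
     (\<lambda>(i,j). if i = basis_idx x \<and> j = basis_idx x then 1 else 0)"

definition cq_state :: "nat \<Rightarrow> ('a::finite \<Rightarrow> complex mat) \<Rightarrow> complex mat" where
  "cq_state d \<rho>E = msum (CARD('a) * d) UNIV (\<lambda>x. kron (proj_cls x) (\<rho>E x))"

definition dist_unif :: "nat \<Rightarrow> nat \<Rightarrow> complex mat \<Rightarrow> real" where
  "dist_unif nS d \<rho> = (INF \<sigma> \<in> {\<sigma>. is_state d \<sigma>}.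
      trace_norm (\<rho> - kron (complex_of_real (1 / real nS) \<cdot>\<^sub>m 1\<^sub>m nS) \<sigma>) / 2)"

definition hmin :: "nat \<Rightarrow> nat \<Rightarrow> complex mat \<Rightarrow> ereal" where
  "hmin nX d \<rho> = (SUP \<sigma> \<in> {\<sigma>. is_state d \<sigma>}.
      Sup {ereal lam | lam. mle (nX * d) \<rho>
             (kron (complex_of_real (2 powr (- lam)) \<cdot>\<^sub>m 1\<^sub>m nX) \<sigma>)})"

definition hmin_smooth :: "nat \<Rightarrow> nat \<Rightarrow> real \<Rightarrow> complex mat \<Rightarrow> ereal" where
  "hmin_smooth nX d \<epsilon> \<rho> = (SUP \<rho>' \<in> {\<rho>'. is_subnormalized (nX * d) \<rho>' \<and>
                                       purified_distance (nX * d) \<rho> \<rho>' \<le> \<epsilon>}. hmin nX d \<rho>')"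

definition two_universal :: "('x::finite \<Rightarrow> 's::finite) set \<Rightarrow> bool" where
  "two_universal F \<longleftrightarrow> F \<noteq> {} \<and>
     (\<forall>x x'. x \<noteq> x' \<longrightarrow>
        real (card {f \<in> F. f x = f x'}) / real (card F) \<le> 1 / real CARD('s))"

definition exp2e :: "ereal \<Rightarrow> ereal" where
  "exp2e t = (case t of ereal r \<Rightarrow> ereal (2 powr r) | PInfty \<Rightarrow> \<infinity> | MInfty \<Rightarrow> 0)"

end

theory Submission
  imports Defs "HOL-Analysis.L2_Norm"
begin

text \<open>
  Fix a smoothing state \<open>\<rho>'\<close>, a state \<open>\<sigma>\<close> and \<open>c = 2 powr (- \<lambda>)\<close> with \<open>\<rho>' \<le> c (1 \<otimes> \<sigma>)\<close>. Only the diagonal blocks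
  \<open>\<rho>'_x\<close> of \<open>\<rho>'\<close> matter. Write \<open>\<rho>'_E = \<Sum> \<rho>'_x\<close> and \<open>t = tr \<rho>'\<close>, and compare the hashed state with
  \<open>\<omega> \<otimes> (\<rho>'_E + (1 - t) \<sigma>)\<close>. The trace norm of the difference is \<open>tr (U A)\<close> for the sign \<open>U\<close> of \<open>A\<close>, so
  only the diagonal blocks \<open>U_s\<close> enter, and \<open>tr (U A) / 2\<close> splits into two parts.

  Smoothing: pulling \<open>(1 + U_s) / 2\<close> back along \<open>f\<close> gives a test \<open>0 \<le> Q \<le> 1\<close> with \<open>tr (Q (\<rho> - \<rho>'))\<close> bounding
  this part; it is at most the purified distance, by Cauchy-Schwarz applied to \<open>Q\<close> and \<open>1 - Q\<close>.

  Hashing: in an eigenbasis of \<open>\<sigma>\<close>, Cauchy-Schwarz with weights \<open>(\<mu>_i \<mu>_j) powr (1/4)\<close> bounds the other part in terms of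
  \<open>tr (B s B s)\<close> with \<open>s = \<sigma> powr (-1/2)\<close>. Expanding \<open>B\<close> and averaging over the family, the terms with \<open>x \<noteq> y\<close>
  are nonnegative multiples of a collision probability minus \<open>1 / |S|\<close>, hence drop out, and
  \<open>tr (\<rho>'_x s \<rho>'_x s) \<le> c tr \<rho>'_x\<close>.

  The nonuniform seed only costs the factor \<open>2 powr (\<alpha> - \<beta>)\<close>, since \<open>P f \<le> 2 powr (\<alpha> - \<beta>) / |F|\<close>.
\<close>

section \<open>Spectral theorem for Hermitian matrices\<close>

lemma mult_mat_index_sum:
  assumes "A \<in> carrier_mat n m" "B \<in> carrier_mat m k" "i < n" "j < k"
  shows "(A * B) $$ (i,j) = (\<Sum>l<m. A $$ (i,l) * B $$ (l,j))"
  using assms by (simp add: scalar_prod_def atLeast0LessThan)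

lemma mult_mat_vec_index_sum:
  assumes "A \<in> carrier_mat n m" "v \<in> carrier_vec m" "i < n"
  shows "(A *\<^sub>v v) $ i = (\<Sum>l<m. A $$ (i,l) * v $ l)"
  using assms by (simp add: scalar_prod_def atLeast0LessThan)

lemma adj_carrier [intro]: "A \<in> carrier_mat n m \<Longrightarrow> adj A \<in> carrier_mat m n"
  by (simp add: adj_def)

lemma adj_index: "A \<in> carrier_mat n m \<Longrightarrow> i < m \<Longrightarrow> j < n \<Longrightarrow> adj A $$ (i,j) = cnj (A $$ (j,i))"
  by (simp add: adj_def)

lemma adj_mult:
  assumes A: "A \<in> carrier_mat n m" and B: "B \<in> carrier_mat m k"
  shows "adj (A * B) = adj B * adj A"
proof (rule eq_matI)
  fix i j assume "i < dim_row (adj B * adj A)" "j < dim_col (adj B * adj A)"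
  then have ij: "i < k" "j < n" using A B by (auto simp: adj_def)
  have "adj (A * B) $$ (i,j) = cnj (\<Sum>l<m. A $$ (j,l) * B $$ (l,i))"
    by (simp only: adj_index[OF mult_carrier_mat[OF A B] ij] mult_mat_index_sum[OF A B ij(2,1)])
  also have "\<dots> = (\<Sum>l<m. adj B $$ (i,l) * adj A $$ (l,j))"
    unfolding cnj_sum using ij by (intro sum.cong) (auto simp: adj_index[OF A] adj_index[OF B] mult.commute)
  finally show "adj (A * B) $$ (i,j) = (adj B * adj A) $$ (i,j)"
    by (simp only: mult_mat_index_sum[OF adj_carrier[OF B] adj_carrier[OF A] ij])
qed (use A B in \<open>auto simp: adj_def\<close>)

lemma hermitian_index:
  assumes "A \<in> carrier_mat n n" "adj A = A" "i < n" "j < n"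
  shows "A $$ (i,j) = cnj (A $$ (j,i))"
  using adj_index[OF assms(1), of i j] assms by simp

lemma cnj_mult_self: "cnj z * z = of_real ((cmod z)\<^sup>2)" "z * cnj z = of_real ((cmod z)\<^sup>2)"
  by (simp_all only: complex_norm_square mult.commute)

text \<open>The matrix is the Householder reflection exchanging the last basis vector with the normalised
  \<open>v\<close>, whose phase is chosen so that its last entry is real and nonpositive.\<close>

lemma householder_last_column:
  assumes v: "v \<in> carrier_vec (Suc n)" "v \<noteq> 0\<^sub>v (Suc n)"
  obtains H c where "H \<in> carrier_mat (Suc n) (Suc n)" "adj H = H" "H * H = 1\<^sub>m (Suc n)"
    "\<And>i. i < Suc n \<Longrightarrow> H $$ (i,n) = c * v $ i"
proof -
  define s where "s = (\<Sum>i<Suc n. (cmod (v $ i))\<^sup>2)"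
  obtain i where "i < Suc n" "v $ i \<noteq> 0"
    using v by (metis carrier_vecD eq_vecI index_zero_vec(1) index_zero_vec(2))
  then have s0: "s > 0"
    unfolding s_def by (intro sum_pos2[of _ i]) auto
  define om where "om = (if v $ n = 0 then 1 else - cnj (v $ n) / cmod (v $ n))"
  have om1: "cmod om = 1" by (auto simp: om_def norm_divide)
  define u where "u i = om / sqrt s * v $ i" for i
  define a where "a = - cmod (v $ n) / sqrt s"
  have un: "u n = of_real a"
    by (auto simp: u_def a_def om_def cnj_mult_self power2_eq_square)
  have a0: "a \<le> 0" using s0 by (simp add: a_def)
  have "(\<Sum>i<Suc n. (cmod (u i))\<^sup>2) = (\<Sum>i<Suc n. (cmod (v $ i))\<^sup>2 / s)"
    using s0 om1 by (intro sum.cong) (auto simp: u_def norm_mult norm_divide power_mult_distrib power_divide)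
  also have "\<dots> = 1" using s0 unfolding s_def[symmetric] sum_divide_distrib[symmetric] by simp
  finally have u1: "(\<Sum>i<Suc n. (cmod (u i))\<^sup>2) = 1" .
  define w where "w i = u i - (if i = n then 1 else 0)" for i
  have "(\<Sum>i<n. cnj (w i) * w i) = of_real (\<Sum>i<n. (cmod (u i))\<^sup>2)"
    unfolding of_real_sum by (intro sum.cong) (auto simp: w_def cnj_mult_self)
  also have "(\<Sum>i<n. (cmod (u i))\<^sup>2) = 1 - a\<^sup>2" using u1 un by simp
  finally have w2: "(\<Sum>i<Suc n. cnj (w i) * w i) = of_real (2 * (1 - a))"
    by (simp add: w_def un power2_eq_square algebra_simps)
  \<comment> \<open>By \<open>w2\<close> this is \<open>2 / |w|^2\<close>, the coefficient of the
    reflection along \<open>w\<close>. The phase was chosen so that \<open>a \<le> 0\<close>, hence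
    the denominator never vanishes and no separate case \<open>w = 0\<close> arises.\<close>
  define b :: complex where "b = 1 / of_real (1 - a)"
  have "1 - complex_of_real a \<noteq> 0" using a0 by (simp add: complex_eq_iff)
  then have b0: "b * of_real (2 * (1 - a)) = 2" by (simp add: b_def field_simps)
  have cb: "cnj b = b" by (simp add: b_def)
  define H where "H = mat (Suc n) (Suc n) (\<lambda>(i,j). (if i = j then 1 else 0) - b * w i * cnj (w j))"
  have H: "H \<in> carrier_mat (Suc n) (Suc n)" by (simp add: H_def)
  have Hij: "H $$ (i,j) = (if i = j then 1 else 0) - b * w i * cnj (w j)" if "i < Suc n" "j < Suc n" for i j
    using that by (simp add: H_def)
  have "adj H = H"
    by (rule eq_matI) (auto simp: adj_def H_def cb)
  moreover have "H * H = 1\<^sub>m (Suc n)"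
  proof (rule eq_matI)
    fix i j assume "i < dim_row (1\<^sub>m (Suc n) :: complex mat)" "j < dim_col (1\<^sub>m (Suc n) :: complex mat)"
    then have ij: "i < Suc n" "j < Suc n" by auto
    have "(H * H) $$ (i,j) = (\<Sum>l<Suc n. H $$ (i,l) * H $$ (l,j))"
      by (rule mult_mat_index_sum[OF H H ij])
    also have "\<dots> = (\<Sum>l<Suc n. (if l = i then if i = j then 1 else 0 else 0) - (if l = i then b * w i * cnj (w j) else 0)
        - (if l = j then b * w i * cnj (w j) else 0) + b * b * w i * cnj (w j) * (cnj (w l) * w l))"
      using ij by (intro sum.cong) (auto simp: Hij algebra_simps)
    also have "\<dots> = (if i = j then 1 else 0) - 2 * (b * w i * cnj (w j)) + b * b * w i * cnj (w j) * (\<Sum>l<Suc n. cnj (w l) * w l)"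
      unfolding sum.distrib sum_subtractf sum_distrib_left[symmetric]
      using ij by (simp add: sum.delta del: sum.lessThan_Suc)
    also have "b * b * w i * cnj (w j) * (\<Sum>l<Suc n. cnj (w l) * w l) = (b * of_real (2 * (1 - a))) * (b * w i * cnj (w j))"
      unfolding w2 by (simp add: algebra_simps)
    finally show "(H * H) $$ (i,j) = 1\<^sub>m (Suc n) $$ (i,j)" unfolding b0 using ij by simp
  qed (use H in auto)
  moreover have "H $$ (i,n) = (om / sqrt s) * v $ i" if "i < Suc n" for i
  proof -
    have "b * cnj (w n) = -1" using a0 by (simp add: b_def w_def un divide_simps)
    then have "H $$ (i,n) = (if i = n then 1 else 0) + w i"
      using that by (simp add: Hij mult.assoc mult.left_commute[of b])
    then show ?thesis by (auto simp: w_def u_def)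
  qed
  ultimately show thesis using that H by blast
qed

text \<open>The characteristic polynomial has degree \<open>Suc n\<close>, so it is not constant and
  the fundamental theorem of algebra supplies a root.\<close>

lemma exists_eigenvector:
  fixes A :: "complex mat"
  assumes A: "A \<in> carrier_mat (Suc n) (Suc n)"
  obtains v e where "v \<in> carrier_vec (Suc n)" "v \<noteq> 0\<^sub>v (Suc n)" "A *\<^sub>v v = e \<cdot>\<^sub>v v"
proof -
  have "degree (char_poly A) = Suc n" using degree_monic_char_poly[OF A] by simp
  then have "\<not> constant (poly (char_poly A))" by (simp add: constant_degree)
  then obtain e where "poly (char_poly A) e = 0" using fundamental_theorem_of_algebra by blast
  then have "eigenvalue A e" using eigenvalue_root_char_poly[OF A] by simp
  then show thesis using that A unfolding eigenvalue_def eigenvector_def by auto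
qed

text \<open>Deflation by induction on the dimension. Conjugating with a reflection \<open>H\<close>
  whose last column is proportional to an eigenvector clears the last column off the corner, and
  Hermiticity then clears the last row. The induction hypothesis diagonalises the remaining block
  \<open>B'\<close> by \<open>V\<close>, and \<open>H * W\<close> diagonalises \<open>A\<close>,
  where \<open>W\<close> is \<open>V\<close> bordered by a \<open>1\<close>.\<close>

theorem hermitian_spectral:
  assumes "A \<in> carrier_mat n n" "adj A = A"
  shows "\<exists>U \<mu>. U \<in> carrier_mat n n \<and> adj U * U = 1\<^sub>m n \<and>
    A = U * mat_diag n (\<lambda>k. complex_of_real (\<mu> k)) * adj U"
  using assms
proof (induction n arbitrary: A)
  case 0
  then show ?case by (intro exI[of _ "1\<^sub>m 0"] exI[of _ "\<lambda>_. 0"]) (auto simp: adj_def)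
next
  case (Suc n)
  let ?N = "Suc n"
  note A = Suc.prems(1)
  obtain v e where v: "v \<in> carrier_vec ?N" "v \<noteq> 0\<^sub>v ?N" and ev: "A *\<^sub>v v = e \<cdot>\<^sub>v v"
    using exists_eigenvector[OF A] by blast
  obtain H c where H: "H \<in> carrier_mat ?N ?N" "adj H = H" "H * H = 1\<^sub>m ?N"
    and Hn: "\<And>i. i < ?N \<Longrightarrow> H $$ (i,n) = c * v $ i"
    using householder_last_column[OF v] by blast
  define B where "B = H * (A * H)"
  have AH: "A * H \<in> carrier_mat ?N ?N" using A H by auto
  have B: "B \<in> carrier_mat ?N ?N" using A H by (auto simp: B_def)
  have "adj B = (adj H * adj A) * adj H"
    unfolding B_def by (simp add: adj_mult[OF H(1) AH] adj_mult[OF A H(1)])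
  also have "\<dots> = B" using A H Suc.prems(2) by (simp add: B_def assoc_mult_mat[of _ ?N ?N _ ?N _ ?N])
  finally have adjB: "adj B = B" .
  have AHn: "(A * H) $$ (i,n) = e * H $$ (i,n)" if "i < ?N" for i
  proof -
    have "(A * H) $$ (i,n) = (\<Sum>l<?N. A $$ (i,l) * H $$ (l,n))"
      by (rule mult_mat_index_sum[OF A H(1) that]) simp
    also have "\<dots> = c * (A *\<^sub>v v) $ i"
      unfolding mult_mat_vec_index_sum[OF A v(1) that] sum_distrib_left
      by (intro sum.cong) (auto simp: Hn)
    also have "\<dots> = e * H $$ (i,n)" using that v by (simp add: ev Hn)
    finally show ?thesis .
  qed
  have Bin: "B $$ (i,n) = (if i = n then e else 0)" if "i < ?N" for i
  proof -
    have "B $$ (i,n) = (\<Sum>l<?N. H $$ (i,l) * (A * H) $$ (l,n))"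
      unfolding B_def by (rule mult_mat_index_sum[OF H(1) AH that]) simp
    also have "\<dots> = (\<Sum>l<?N. e * (H $$ (i,l) * H $$ (l,n)))"
      by (intro sum.cong) (auto simp: AHn)
    also have "\<dots> = e * (H * H) $$ (i,n)"
      unfolding sum_distrib_left[symmetric] by (subst mult_mat_index_sum[OF H(1) H(1) that]) auto
    finally show ?thesis using that by (simp add: H(3))
  qed
  have Bni: "B $$ (n,i) = (if i = n then cnj e else 0)" if "i < ?N" for i
    unfolding hermitian_index[OF B adjB lessI that] Bin[OF that] by simp
  \<comment> \<open>The corner entry equals both \<open>e\<close> and its conjugate, so
    \<open>e\<close> is real; this justifies \<open>Re e\<close> as the last eigenvalue in
    \<open>\<nu>\<close>.\<close>
  have ee: "cnj e = e" using Bin[of n] Bni[of n] by (metis lessI)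
  define B' where "B' = mat n n (\<lambda>(i,j). B $$ (i,j))"
  have B': "B' \<in> carrier_mat n n" by (simp add: B'_def)
  have "adj B' = B'"
    by (rule eq_matI) (auto simp: B'_def adj_def intro!: hermitian_index[OF B adjB, symmetric])
  from Suc.IH[OF B' this] obtain V \<mu> where V: "V \<in> carrier_mat n n" "adj V * V = 1\<^sub>m n"
    and B'V: "B' = V * mat_diag n (\<lambda>k. complex_of_real (\<mu> k)) * adj V" by blast
  define W where "W = mat ?N ?N (\<lambda>(i,j). if i < n \<and> j < n then V $$ (i,j) else if i = j then 1 else 0)"
  define \<nu> where "\<nu> k = (if k < n then \<mu> k else Re e)" for k
  have W: "W \<in> carrier_mat ?N ?N" by (simp add: W_def)
  have Wij: "W $$ (i,j) = V $$ (i,j)" if "i < n" "j < n" for i j using that by (auto simp: W_def)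
  have Win: "W $$ (i,n) = 0" "W $$ (n,i) = 0" if "i < n" for i using that by (auto simp: W_def)
  have Wnn: "W $$ (n,n) = 1" by (simp add: W_def)
  have VV: "(\<Sum>l<n. cnj (V $$ (l,i)) * V $$ (l,j)) = (if i = j then 1 else 0)" if "i < n" "j < n" for i j
    using that V(2) mult_mat_index_sum[OF adj_carrier[OF V(1)] V(1) that] adj_index[OF V(1)] by simp
  have WW: "adj W * W = 1\<^sub>m ?N"
  proof (rule eq_matI)
    fix i j assume "i < dim_row (1\<^sub>m ?N :: complex mat)" "j < dim_col (1\<^sub>m ?N :: complex mat)"
    then have ij: "i < ?N" "j < ?N" by auto
    have "(adj W * W) $$ (i,j) = (\<Sum>l<?N. cnj (W $$ (l,i)) * W $$ (l,j))"
      unfolding mult_mat_index_sum[OF adj_carrier[OF W] W ij]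
      using ij by (intro sum.cong) (auto simp: adj_index[OF W])
    also have "\<dots> = (if i = j then 1 else 0)"
      using ij VV[of i j] by (cases "i = n"; cases "j = n") (auto simp: Wij Win Wnn less_Suc_eq)
    finally show "(adj W * W) $$ (i,j) = 1\<^sub>m ?N $$ (i,j)" using ij by simp
  qed (use W in \<open>auto simp: adj_def\<close>)
  define D where "D = mat_diag ?N (\<lambda>k. complex_of_real (\<nu> k))"
  have D: "D \<in> carrier_mat ?N ?N" by (simp add: D_def)
  have BW: "B = W * D * adj W"
  proof (rule eq_matI)
    fix i j assume "i < dim_row (W * D * adj W)" "j < dim_col (W * D * adj W)"
    then have ij: "i < ?N" "j < ?N" using W by (auto simp: adj_def)
    have WD: "(W * D) $$ (i,l) = W $$ (i,l) * \<nu> l" if "l < ?N" for l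
      using ij that W by (simp add: D_def mat_diag_mult_right[OF W])
    have "(W * D * adj W) $$ (i,j) = (\<Sum>l<?N. (W * D) $$ (i,l) * adj W $$ (l,j))"
      by (rule mult_mat_index_sum[OF mult_carrier_mat[OF W D] adj_carrier[OF W] ij])
    also have "\<dots> = (\<Sum>l<?N. W $$ (i,l) * \<nu> l * cnj (W $$ (j,l)))"
      using ij by (intro sum.cong) (auto simp: WD adj_index[OF W])
    also have "\<dots> = B $$ (i,j)"
    proof (cases "i = n \<or> j = n")
      case True
      then show ?thesis using ij ee Bin[OF ij(1)] Bni[OF ij(2)]
        by (auto simp: Wij Win Wnn less_Suc_eq \<nu>_def complex_eq_iff)
    next
      case False
      then have ij': "i < n" "j < n" using ij by auto
      have VD: "V * mat_diag n (\<lambda>k. complex_of_real (\<mu> k)) \<in> carrier_mat n n"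
        using V by auto
      have "B $$ (i,j) = B' $$ (i,j)" using ij' by (simp add: B'_def)
      also have "\<dots> = (\<Sum>l<n. V $$ (i,l) * \<mu> l * cnj (V $$ (j,l)))"
        unfolding B'V mult_mat_index_sum[OF VD adj_carrier[OF V(1)] ij']
        using ij' V by (intro sum.cong) (auto simp: mat_diag_mult_right[OF V(1)] adj_index[OF V(1)])
      finally show ?thesis using ij' by (simp add: Wij Win \<nu>_def)
    qed
    finally show "B $$ (i,j) = (W * D * adj W) $$ (i,j)" by simp
  qed (use B W in \<open>auto simp: adj_def\<close>)
  have "adj (H * W) * (H * W) = adj W * ((H * H) * W)"
    using H(1,2) W adj_carrier[OF W] by (simp add: adj_mult[OF H(1) W] assoc_mult_mat[of _ ?N ?N _ ?N _ ?N])
  also have "\<dots> = 1\<^sub>m ?N" using W by (simp add: H(3) WW)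
  finally have 1: "adj (H * W) * (H * W) = 1\<^sub>m ?N" .
  have HB: "H * (B * H) = A"
  proof -
    have "H * (B * H) = (H * H) * (A * (H * H))"
      unfolding B_def using H(1) A by (simp add: assoc_mult_mat[of _ ?N ?N _ ?N _ ?N])
    then show ?thesis using A by (simp add: H(3))
  qed
  have "H * W * D * adj (H * W) = H * (B * H)"
    unfolding BW using H(1,2) W D adj_carrier[OF W]
    by (simp add: adj_mult[OF H(1) W] assoc_mult_mat[of _ ?N ?N _ ?N _ ?N])
  then have "A = H * W * D * adj (H * W)" by (simp add: HB)
  then show ?case using 1 H(1) W unfolding D_def by (intro exI[of _ "H * W"] exI[of _ \<nu>]) auto
qed

section \<open>Orthonormal bases and spectral sums\<close>

definition onb :: "nat \<Rightarrow> (nat \<Rightarrow> nat \<Rightarrow> complex) \<Rightarrow> bool" where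
  "onb n u \<longleftrightarrow> (\<forall>k<n. \<forall>l<n. (\<Sum>i<n. cnj (u k i) * u l i) = (if k = l then 1 else 0))"

text \<open>This is the sum of \<open>a k |u_k><u_k|\<close>. Once a basis is fixed, functional
  calculus is a change of the coefficients \<open>a\<close>; signs and square roots are obtained
  this way.\<close>

definition sp :: "nat \<Rightarrow> (nat \<Rightarrow> complex) \<Rightarrow> (nat \<Rightarrow> nat \<Rightarrow> complex) \<Rightarrow> nat \<Rightarrow> nat \<Rightarrow> complex" where
  "sp n a u i j = (\<Sum>k<n. a k * (u k i * cnj (u k j)))"

lemma onbD: "onb n u \<Longrightarrow> k < n \<Longrightarrow> l < n \<Longrightarrow> (\<Sum>i<n. cnj (u k i) * u l i) = (if k = l then 1 else 0)"
  by (simp add: onb_def)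

definition onb_mat :: "nat \<Rightarrow> (nat \<Rightarrow> nat \<Rightarrow> complex) \<Rightarrow> complex mat" where
  "onb_mat n u = mat n n (\<lambda>(i,k). u k i)"

lemma onb_mat_carrier: "onb_mat n u \<in> carrier_mat n n"
  by (simp add: onb_mat_def)

text \<open>The second identity is completeness of \<open>n\<close> orthonormal vectors: a left
  inverse of a square matrix is also a right inverse.\<close>

lemma onb_mat_unitary:
  assumes "onb n u"
  shows "adj (onb_mat n u) * onb_mat n u = 1\<^sub>m n" "onb_mat n u * adj (onb_mat n u) = 1\<^sub>m n"
proof -
  let ?U = "onb_mat n u"
  note U = onb_mat_carrier[of n u]
  show 1: "adj ?U * ?U = 1\<^sub>m n"
  proof (rule eq_matI)
    fix i j assume "i < dim_row (1\<^sub>m n :: complex mat)" "j < dim_col (1\<^sub>m n :: complex mat)"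
    then have ij: "i < n" "j < n" by auto
    have "(adj ?U * ?U) $$ (i,j) = (\<Sum>l<n. cnj (u i l) * u j l)"
      unfolding mult_mat_index_sum[OF adj_carrier[OF U] U ij]
      using ij by (intro sum.cong) (auto simp: adj_index[OF U], auto simp: onb_mat_def)
    then show "(adj ?U * ?U) $$ (i,j) = 1\<^sub>m n $$ (i,j)" using ij onbD[OF assms ij] by simp
  qed (use U in \<open>auto simp: adj_def\<close>)
  show "?U * adj ?U = 1\<^sub>m n"
    using mat_mult_left_right_inverse[OF adj_carrier[OF U] U 1] .
qed

lemma onb_complete:
  assumes "onb n u" and ij: "i < n" "j < n"
  shows "(\<Sum>k<n. u k i * cnj (u k j)) = (if i = j then 1 else 0)"
proof -
  let ?U = "onb_mat n u"
  note U = onb_mat_carrier[of n u]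
  have "(\<Sum>k<n. u k i * cnj (u k j)) = (?U * adj ?U) $$ (i,j)"
    unfolding mult_mat_index_sum[OF U adj_carrier[OF U] ij]
    using ij by (intro sum.cong) (auto simp: adj_index[OF U], auto simp: onb_mat_def)
  then show ?thesis using ij by (simp add: onb_mat_unitary[OF assms(1)])
qed

lemma sp_apply:
  assumes "onb n u" "l < n"
  shows "(\<Sum>j<n. sp n a u i j * u l j) = a l * u l i"
proof -
  have "(\<Sum>j<n. sp n a u i j * u l j) = (\<Sum>k<n. a k * u k i * (\<Sum>j<n. cnj (u k j) * u l j))"
    unfolding sp_def sum_distrib_left sum_distrib_right
    by (subst sum.swap) (simp add: mult_ac)
  also have "\<dots> = (\<Sum>k<n. if k = l then a l * u l i else 0)"
    using assms by (intro sum.cong) (auto simp: onbD)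
  finally show ?thesis using assms(2) by simp
qed

lemma sp_mult:
  assumes "onb n u"
  shows "(\<Sum>j<n. sp n a u i j * sp n b u j m) = sp n (\<lambda>k. a k * b k) u i m"
proof -
  have "(\<Sum>j<n. sp n a u i j * sp n b u j m) = (\<Sum>l<n. b l * cnj (u l m) * (\<Sum>j<n. sp n a u i j * u l j))"
    unfolding sp_def[of n b] sum_distrib_left
    by (subst sum.swap) (simp add: mult_ac)
  also have "\<dots> = sp n (\<lambda>k. a k * b k) u i m"
    unfolding sp_def[of n "\<lambda>k. a k * b k"] by (intro sum.cong) (auto simp: sp_apply[OF assms])
  finally show ?thesis .
qed

lemma sp_trace:
  assumes "onb n u"
  shows "(\<Sum>i<n. sp n a u i i) = (\<Sum>k<n. a k)"
proof -
  have "(\<Sum>i<n. sp n a u i i) = (\<Sum>k<n. a k * (\<Sum>i<n. cnj (u k i) * u k i))"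
    unfolding sp_def sum_distrib_left by (subst sum.swap) (simp add: mult_ac)
  also have "\<dots> = (\<Sum>k<n. a k)" using assms by (intro sum.cong) (auto simp: onbD)
  finally show ?thesis .
qed

lemma sp_one:
  assumes "onb n u" "i < n" "j < n"
  shows "sp n (\<lambda>k. 1) u i j = (if i = j then 1 else 0)"
  using onb_complete[OF assms] by (simp add: sp_def)

lemma sp_add: "sp n (\<lambda>k. a k + b k) u i j = sp n a u i j + sp n b u i j"
  by (simp add: sp_def distrib_right sum.distrib)

lemma sp_diff: "sp n (\<lambda>k. a k - b k) u i j = sp n a u i j - sp n b u i j"
  by (simp add: sp_def left_diff_distrib sum_subtractf)

lemma sp_cnj: "cnj (sp n (\<lambda>k. complex_of_real (a k)) u i j) = sp n (\<lambda>k. complex_of_real (a k)) u j i"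
  by (simp add: sp_def mult_ac)

text \<open>The columns of the diagonalising unitary are the basis vectors. From here on a matrix is
  mostly an entry function on \<open>nat\<close>, of which only the values at indices below
  \<open>n\<close> are constrained.\<close>

lemma hermitian_eigenbasis:
  assumes herm: "\<And>i j. i < n \<Longrightarrow> j < n \<Longrightarrow> A i j = cnj (A j i)"
  shows "\<exists>u \<mu>. onb n u \<and> (\<forall>i<n. \<forall>j<n. A i j = sp n (\<lambda>k. complex_of_real (\<mu> k)) u i j)"
proof -
  let ?A = "mat n n (\<lambda>(i,j). A i j)"
  have "?A \<in> carrier_mat n n" by simp
  moreover have "adj ?A = ?A"
    by (rule eq_matI) (auto simp: adj_def intro!: herm[symmetric])
  ultimately obtain U \<mu> where U: "U \<in> carrier_mat n n" "adj U * U = 1\<^sub>m n"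
    and A: "?A = U * mat_diag n (\<lambda>k. complex_of_real (\<mu> k)) * adj U"
    using hermitian_spectral by blast
  define u where "u k i = U $$ (i,k)" for k i
  have "(\<Sum>i<n. cnj (u k i) * u l i) = (adj U * U) $$ (k,l)" if "k < n" "l < n" for k l
    unfolding mult_mat_index_sum[OF adj_carrier[OF U(1)] U(1) that]
    using that by (intro sum.cong) (auto simp: adj_index[OF U(1)] u_def)
  then have "onb n u" by (simp add: onb_def U(2))
  moreover have "A i j = sp n (\<lambda>k. complex_of_real (\<mu> k)) u i j" if ij: "i < n" "j < n" for i j
  proof -
    have D: "U * mat_diag n (\<lambda>k. complex_of_real (\<mu> k)) \<in> carrier_mat n n"
      using U(1) by (intro mult_carrier_mat) auto
    have "A i j = ?A $$ (i,j)" using ij by simp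
    also have "\<dots> = (\<Sum>l<n. (U * mat_diag n (\<lambda>k. complex_of_real (\<mu> k))) $$ (i,l) * adj U $$ (l,j))"
      unfolding A by (rule mult_mat_index_sum[OF D adj_carrier[OF U(1)] ij])
    also have "\<dots> = sp n (\<lambda>k. complex_of_real (\<mu> k)) u i j"
      unfolding sp_def using ij U(1)
      by (intro sum.cong) (auto simp: mat_diag_mult_right[OF U(1)] adj_index[OF U(1)] u_def)
    finally show ?thesis .
  qed
  ultimately show ?thesis by blast
qed

text \<open>\<open>trace_norm\<close> is defined through roots of a characteristic polynomial,
  counted with multiplicity. Similarity to a diagonal matrix turns that polynomial into a product of
  linear factors, one for each basis vector.\<close>

lemma proots_char_poly_sp:
  assumes u: "onb n u" and M: "M \<in> carrier_mat n n"
    and eq: "\<And>i j. i < n \<Longrightarrow> j < n \<Longrightarrow> M $$ (i,j) = sp n a u i j"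
  shows "proots (char_poly M) = image_mset a (mset_set {..<n})"
proof -
  let ?U = "onb_mat n u" let ?D = "mat_diag n a"
  note U = onb_mat_carrier[of n u]
  have D: "?D \<in> carrier_mat n n" by simp
  have UD: "?U * ?D \<in> carrier_mat n n" using U D by (rule mult_carrier_mat)
  have "M = ?U * ?D * adj ?U"
  proof (rule eq_matI)
    fix i j assume "i < dim_row (?U * ?D * adj ?U)" "j < dim_col (?U * ?D * adj ?U)"
    then have ij: "i < n" "j < n" using U by (auto simp: adj_def)
    have "(?U * ?D * adj ?U) $$ (i,j) = (\<Sum>l<n. (?U * ?D) $$ (i,l) * adj ?U $$ (l,j))"
      by (rule mult_mat_index_sum[OF UD adj_carrier[OF U] ij])
    also have "\<dots> = sp n a u i j"
      unfolding sp_def using ij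
      by (intro sum.cong) (auto simp: mat_diag_mult_right[OF U] adj_index[OF U], auto simp: onb_mat_def)
    finally show "M $$ (i,j) = (?U * ?D * adj ?U) $$ (i,j)" using eq[OF ij] by simp
  qed (use M U in \<open>auto simp: adj_def\<close>)
  moreover have "{M, ?D, ?U, adj ?U} \<subseteq> carrier_mat n n"
    using M D U adj_carrier[OF U] by blast
  ultimately have "similar_mat M ?D"
    using similar_matI[OF _ onb_mat_unitary(2)[OF u] onb_mat_unitary(1)[OF u]] by blast
  then have "char_poly M = char_poly ?D" by (rule char_poly_similar)
  also have "\<dots> = (\<Prod>x\<leftarrow>diag_mat ?D. [:- x, 1:])"
    by (rule char_poly_upper_triangular[OF D]) (auto simp: mat_diag_def upper_triangular_def)
  also have "diag_mat ?D = map a [0..<n]"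
    by (auto simp: diag_mat_def mat_diag_def)
  finally have c: "char_poly M = (\<Prod>k\<leftarrow>[0..<n]. [:- a k, 1:])" by (simp add: comp_def)
  also have "\<dots> = (\<Prod>k\<in>{..<n}. [:- a k, 1:])"
    using prod.distinct_set_conv_list[OF distinct_upt, of "\<lambda>k. [:- a k, 1:]" 0 n, symmetric]
    unfolding set_upt atLeast0LessThan .
  finally have "proots (char_poly M) = (\<Sum>k<n. {#a k#})"
    by (simp add: proots_prod)
  also have "\<dots> = image_mset a (mset_set {..<n})"
    by (induction n) (auto simp: lessThan_Suc)
  finally show ?thesis .
qed

section \<open>Positive semidefinite matrices\<close>

definition qf :: "nat \<Rightarrow> (nat \<Rightarrow> nat \<Rightarrow> complex) \<Rightarrow> (nat \<Rightarrow> complex) \<Rightarrow> complex" where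
  "qf n A v = (\<Sum>i<n. \<Sum>j<n. cnj (v i) * A i j * v j)"

text \<open>The counterpart of \<open>psd\<close> for entry functions. Quantifying over all
  functions \<open>v\<close> is harmless, as \<open>qf\<close> reads only their first
  \<open>n\<close> values.\<close>

definition psdf :: "nat \<Rightarrow> (nat \<Rightarrow> nat \<Rightarrow> complex) \<Rightarrow> bool" where
  "psdf n A \<longleftrightarrow> (\<forall>v. Im (qf n A v) = 0 \<and> 0 \<le> Re (qf n A v))"

lemma psdfD: "psdf n A \<Longrightarrow> Im (qf n A v) = 0" "psdf n A \<Longrightarrow> 0 \<le> Re (qf n A v)"
  by (auto simp: psdf_def)

lemma psdf_cong:
  assumes "\<And>i j. i < n \<Longrightarrow> j < n \<Longrightarrow> A i j = B i j"
  shows "psdf n A \<longleftrightarrow> psdf n B"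
proof -
  have "qf n A v = qf n B v" for v
    unfolding qf_def using assms by (intro sum.cong) auto
  then show ?thesis by (simp add: psdf_def)
qed

lemma psd_carrier: "psd n A \<Longrightarrow> A \<in> carrier_mat n n"
  by (simp add: psd_def)

lemma psd_iff_psdf: "psd n A \<longleftrightarrow> A \<in> carrier_mat n n \<and> psdf n (\<lambda>i j. A $$ (i,j))"
proof (cases "A \<in> carrier_mat n n")
  case A: True
  let ?f = "\<lambda>v. \<Sum>i<n. cnj (v $ i) * (A *\<^sub>v v) $ i"
  let ?q = "qf n (\<lambda>i j. A $$ (i,j))"
  have eq: "?f v = ?q (\<lambda>i. v $ i)" if "v \<in> carrier_vec n" for v
    unfolding qf_def
  proof (rule sum.cong[OF refl])
    fix i assume "i \<in> {..<n}"
    then have "(A *\<^sub>v v) $ i = (\<Sum>j<n. A $$ (i,j) * v $ j)"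
      using mult_mat_vec_index_sum[OF A that] by blast
    then show "cnj (v $ i) * (A *\<^sub>v v) $ i = (\<Sum>j<n. cnj (v $ i) * A $$ (i,j) * v $ j)"
      by (simp only: sum_distrib_left mult.assoc)
  qed
  have eq': "?q w = ?f (vec n w)" for w
  proof -
    have "?q w = ?q (\<lambda>i. vec n w $ i)"
      unfolding qf_def by (intro sum.cong refl) simp
    then show ?thesis using eq[OF vec_carrier] by (rule trans[OF _ sym])
  qed
  have "psd n A \<longleftrightarrow> (\<forall>v\<in>carrier_vec n. Im (?f v) = 0 \<and> 0 \<le> Re (?f v))"
    unfolding psd_def using A by blast
  also have "\<dots> \<longleftrightarrow> (\<forall>w. Im (?q w) = 0 \<and> 0 \<le> Re (?q w))"
  proof (intro iffI allI ballI)
    fix w assume "\<forall>v\<in>carrier_vec n. Im (?f v) = 0 \<and> 0 \<le> Re (?f v)"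
    then show "Im (?q w) = 0 \<and> 0 \<le> Re (?q w)"
      unfolding eq'[of w] using vec_carrier by (rule bspec)
  next
    fix v :: "complex vec" assume *: "\<forall>w. Im (?q w) = 0 \<and> 0 \<le> Re (?q w)" and v: "v \<in> carrier_vec n"
    show "Im (?f v) = 0 \<and> 0 \<le> Re (?f v)"
      unfolding eq[OF v] using * by (rule spec)
  qed
  finally show ?thesis using A by (simp only: psdf_def simp_thms)
qed (auto simp: psd_def)

text \<open>With \<open>A = adj R * R\<close> the form at \<open>v\<close> is the squared norm of
  \<open>R v\<close>. The row index set \<open>I\<close> is arbitrary, so a block of a larger matrix
  can keep all rows of the larger factor.\<close>

lemma psdf_gramI:
  assumes "\<And>i j. i < n \<Longrightarrow> j < n \<Longrightarrow> A i j = (\<Sum>m\<in>I. cnj (R m i) * R m j)"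
  shows "psdf n A"
proof -
  have "qf n A v = of_real (\<Sum>m\<in>I. (cmod (\<Sum>j<n. R m j * v j))\<^sup>2)" for v
  proof -
    have "qf n A v = (\<Sum>i<n. \<Sum>j<n. \<Sum>m\<in>I. cnj (R m i * v i) * (R m j * v j))"
      unfolding qf_def
    proof (intro sum.cong refl)
      fix i j assume "i \<in> {..<n}" "j \<in> {..<n}"
      then have "A i j = (\<Sum>m\<in>I. cnj (R m i) * R m j)" using assms by simp
      then show "cnj (v i) * A i j * v j = (\<Sum>m\<in>I. cnj (R m i * v i) * (R m j * v j))"
        by (simp only: sum_distrib_left sum_distrib_right complex_cnj_mult) (simp only: mult_ac)
    qed
    also have "\<dots> = (\<Sum>i<n. \<Sum>m\<in>I. \<Sum>j<n. cnj (R m i * v i) * (R m j * v j))"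
      by (intro sum.cong refl) (rule sum.swap)
    also have "\<dots> = (\<Sum>m\<in>I. \<Sum>i<n. \<Sum>j<n. cnj (R m i * v i) * (R m j * v j))"
      by (rule sum.swap)
    also have "\<dots> = (\<Sum>m\<in>I. cnj (\<Sum>j<n. R m j * v j) * (\<Sum>j<n. R m j * v j))"
      by (simp only: sum_product cnj_sum)
    finally show ?thesis unfolding cnj_mult_self(1) of_real_sum .
  qed
  then show ?thesis unfolding psdf_def by (simp add: sum_nonneg del: of_real_sum of_real_power)
qed

lemma psdf_sp:
  assumes "\<And>k. k < n \<Longrightarrow> 0 \<le> a k"
  shows "psdf n (sp n (\<lambda>k. complex_of_real (a k)) u)"
proof (rule psdf_gramI[where I = "{..<n}" and R = "\<lambda>k i. of_real (sqrt (a k)) * cnj (u k i)"])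
  fix i j assume "i < n" "j < n"
  have "complex_of_real (a k) = of_real (sqrt (a k)) * of_real (sqrt (a k))" if "k < n" for k
    using assms[OF that] by (simp flip: of_real_mult)
  then show "sp n (\<lambda>k. complex_of_real (a k)) u i j =
    (\<Sum>m<n. cnj (complex_of_real (sqrt (a m)) * cnj (u m i)) * (complex_of_real (sqrt (a m)) * cnj (u m j)))"
    unfolding sp_def by (intro sum.cong refl) (simp only: lessThan_iff complex_cnj_mult complex_cnj_cnj complex_cnj_complex_of_real mult_ac)
qed

lemma qf_two_point:
  assumes ij: "i < n" "j < n" "i \<noteq> j"
  shows "qf n A (\<lambda>k. if k = i then a else if k = j then b else 0) =
    cnj a * A i i * a + cnj a * A i j * b + cnj b * A j i * a + cnj b * A j j * b"
proof -
  let ?v = "\<lambda>k. if k = i then a else if k = j then b else 0"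
  have S: "(\<Sum>k<n. g k) = g i + g j" if "\<And>k. k \<noteq> i \<Longrightarrow> k \<noteq> j \<Longrightarrow> g k = 0" for g :: "nat \<Rightarrow> complex"
  proof -
    have "(\<Sum>k<n. g k) = (\<Sum>k\<in>{i,j}. g k)"
      using ij that by (intro sum.mono_neutral_right) auto
    then show ?thesis using ij by simp
  qed
  have "qf n A ?v = (\<Sum>k<n. cnj (?v k) * A k i * a + cnj (?v k) * A k j * b)"
    unfolding qf_def
    by (intro sum.cong refl, rule trans[OF S]) (use ij in simp_all)
  also have "\<dots> = (cnj a * A i i * a + cnj a * A i j * b) + (cnj b * A j i * a + cnj b * A j j * b)"
    by (rule trans[OF S]) (use ij in simp_all)
  finally show ?thesis by (simp only: add.assoc)
qed

lemma qf_one_point: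
  assumes "i < n"
  shows "qf n A (\<lambda>k. if k = i then 1 else 0) = A i i"
proof -
  have "qf n A (\<lambda>k. if k = i then 1 else 0) = (\<Sum>k<n. if k = i then A i i else 0)"
    unfolding qf_def
  proof (intro sum.cong refl)
    fix k assume "k \<in> {..<n}"
    have "(\<Sum>j<n. cnj (if k = i then 1 else 0) * A k j * (if j = i then 1 else 0)) =
      (\<Sum>j<n. if j = i then (if k = i then A i i else 0) else 0)"
      by (intro sum.cong) auto
    then show "(\<Sum>j<n. cnj (if k = i then 1 else 0) * A k j * (if j = i then 1 else 0)) = (if k = i then A i i else 0)"
      using assms by simp
  qed
  then show ?thesis using assms by simp
qed

lemma psdf_diag: 
  assumes "psdf n A" "i < n"
  shows "Im (A i i) = 0" "0 \<le> Re (A i i)"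
  using psdfD[OF assms(1), of "\<lambda>k. if k = i then 1 else 0"] qf_one_point[OF assms(2), of A] by auto

text \<open>Polarisation: the form is real at \<open>e_i + e_j\<close> and at
  \<open>e_i + \<i> e_j\<close>, which relates first the imaginary and then the real parts of the
  two entries.\<close>

lemma psdf_hermitian:
  assumes A: "psdf n A" and ij: "i < n" "j < n"
  shows "A i j = cnj (A j i)"
proof (cases "i = j")
  case True
  then show ?thesis using psdf_diag(1)[OF A ij(1)] by (simp add: complex_eq_iff)
next
  case False
  have "Im (A i j + A j i) = 0"
    using psdfD(1)[OF A, of "\<lambda>k. if k = i then 1 else if k = j then 1 else 0"]
      psdf_diag(1)[OF A ij(1)] psdf_diag(1)[OF A ij(2)] unfolding qf_two_point[OF ij False] by simp
  moreover have "Re (A i j - A j i) = 0"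
    using psdfD(1)[OF A, of "\<lambda>k. if k = i then 1 else if k = j then \<i> else 0"]
      psdf_diag(1)[OF A ij(1)] psdf_diag(1)[OF A ij(2)] unfolding qf_two_point[OF ij False] by simp
  ultimately show ?thesis by (simp add: complex_eq_iff)
qed

lemma qf_sp:
  assumes "onb n u" "k < n"
  shows "qf n (sp n a u) (u k) = a k"
proof -
  have "qf n (sp n a u) (u k) = (\<Sum>i<n. cnj (u k i) * (\<Sum>j<n. sp n a u i j * u k j))"
    unfolding qf_def by (simp add: sum_distrib_left mult.assoc)
  also have "\<dots> = a k * (\<Sum>i<n. cnj (u k i) * u k i)"
    unfolding sp_apply[OF assms] by (simp add: sum_distrib_left mult_ac)
  finally show ?thesis using assms by (simp add: onbD)
qed

lemma qf_cong: 
  assumes "\<And>i j. i < n \<Longrightarrow> j < n \<Longrightarrow> A i j = B i j"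
  shows "qf n A v = qf n B v"
  unfolding qf_def using assms by (intro sum.cong) auto

text \<open>Each eigenvalue is the value of the form at its unit eigenvector, hence
  nonnegative.\<close>

lemma psdf_eigenbasis:
  assumes "psdf n A"
  shows "\<exists>u \<mu>. onb n u \<and> (\<forall>k<n. 0 \<le> \<mu> k) \<and>
    (\<forall>i<n. \<forall>j<n. A i j = sp n (\<lambda>k. complex_of_real (\<mu> k)) u i j)"
proof -
  obtain u \<mu> where u: "onb n u"
    and A: "\<And>i j. i < n \<Longrightarrow> j < n \<Longrightarrow> A i j = sp n (\<lambda>k. complex_of_real (\<mu> k)) u i j"
    using hermitian_eigenbasis[of n A, OF psdf_hermitian[OF assms]] by blast
  have "0 \<le> \<mu> k" if "k < n" for k
  proof -
    have "qf n A (u k) = qf n (sp n (\<lambda>k. complex_of_real (\<mu> k)) u) (u k)"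
      by (rule qf_cong) (rule A)
    also have "\<dots> = of_real (\<mu> k)" by (rule qf_sp[OF u that])
    finally have "qf n A (u k) = of_real (\<mu> k)" .
    then show ?thesis using psdfD(2)[OF assms, of "u k"] by simp
  qed
  then show ?thesis using u A by blast
qed

text \<open>The rows of the factor are the conjugated eigenvectors scaled by the roots of the
  eigenvalues. This is the converse of \<open>psdf_gramI\<close>; congruences, traces of products
  and blocks are all treated through it.\<close>

lemma psdf_gram:
  assumes "psdf n A"
  shows "\<exists>R. \<forall>i<n. \<forall>j<n. A i j = (\<Sum>m<n. cnj (R m i) * R m j)"
proof -
  obtain u \<mu> where u: "onb n u" and m: "\<And>k. k < n \<Longrightarrow> 0 \<le> \<mu> k"
    and A: "\<And>i j. i < n \<Longrightarrow> j < n \<Longrightarrow> A i j = sp n (\<lambda>k. complex_of_real (\<mu> k)) u i j"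
    using psdf_eigenbasis[OF assms] by blast
  have "complex_of_real (\<mu> k) = of_real (sqrt (\<mu> k)) * of_real (sqrt (\<mu> k))" if "k < n" for k
    using m[OF that] by (simp flip: of_real_mult)
  then have "A i j = (\<Sum>k<n. cnj (of_real (sqrt (\<mu> k)) * cnj (u k i)) * (of_real (sqrt (\<mu> k)) * cnj (u k j)))"
    if "i < n" "j < n" for i j
    unfolding A[OF that] sp_def
    by (intro sum.cong refl) (simp only: lessThan_iff complex_cnj_mult complex_cnj_cnj complex_cnj_complex_of_real mult_ac)
  then show ?thesis by (intro exI[of _ "\<lambda>k i. of_real (sqrt (\<mu> k)) * cnj (u k i)"]) blast
qed

text \<open>Congruence with the real diagonal matrix of \<open>a\<close>, which rescales the columns
  of the Gram factor.\<close>

lemma psdf_scale: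
  assumes "psdf n A"
  shows "psdf n (\<lambda>i j. complex_of_real (a i * a j) * A i j)"
proof -
  obtain R where R: "\<And>i j. i < n \<Longrightarrow> j < n \<Longrightarrow> A i j = (\<Sum>m<n. cnj (R m i) * R m j)"
    using psdf_gram[OF assms] by blast
  show ?thesis
    by (rule psdf_gramI[where I = "{..<n}" and R = "\<lambda>m i. complex_of_real (a i) * R m i"])
      (simp add: R sum_distrib_left mult_ac)
qed

lemma psdf_scale_const:
  assumes "psdf n A" "0 \<le> c"
  shows "psdf n (\<lambda>i j. complex_of_real c * A i j)"
  using psdf_scale[OF assms(1), of "\<lambda>i. sqrt c"] assms(2) by simp

lemma psdf_add: 
  assumes "psdf n A" "psdf n B"
  shows "psdf n (\<lambda>i j. A i j + B i j)"
proof -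
  have "qf n (\<lambda>i j. A i j + B i j) v = qf n A v + qf n B v" for v
    unfolding qf_def by (simp add: algebra_simps sum.distrib)
  then show ?thesis using assms by (simp add: psdf_def)
qed

lemma psdf_sum: "finite I \<Longrightarrow> (\<And>x. x \<in> I \<Longrightarrow> psdf n (A x)) \<Longrightarrow> psdf n (\<lambda>i j. \<Sum>x\<in>I. A x i j)"
proof (induction I rule: finite_induct)
  case empty
  then show ?case by (simp add: psdf_def qf_def)
next
  case (insert x I)
  then show ?case by (simp add: psdf_add)
qed

text \<open>If \<open>A = adj R * R\<close>, the trace of \<open>A B\<close> is that of
  \<open>R B adj R\<close>, a sum of values of the form of \<open>B\<close> at the conjugated rows
  of \<open>R\<close>.\<close>

lemma psdf_trace_mult_nonneg:
  assumes "psdf n A" "psdf n B"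
  shows "0 \<le> Re (\<Sum>j<n. \<Sum>k<n. A j k * B k j)"
proof -
  obtain R where R: "\<And>i j. i < n \<Longrightarrow> j < n \<Longrightarrow> A i j = (\<Sum>m<n. cnj (R m i) * R m j)"
    using psdf_gram[OF assms(1)] by blast
  have "(\<Sum>j<n. \<Sum>k<n. A j k * B k j) = (\<Sum>k<n. \<Sum>j<n. A j k * B k j)" by (rule sum.swap)
  also have "\<dots> = (\<Sum>k<n. \<Sum>j<n. \<Sum>m<n. R m k * B k j * cnj (R m j))"
    by (intro sum.cong) (auto simp: R sum_distrib_left sum_distrib_right mult_ac)
  also have "\<dots> = (\<Sum>k<n. \<Sum>m<n. \<Sum>j<n. R m k * B k j * cnj (R m j))"
    by (rule sum.cong[OF refl], rule sum.swap)
  also have "\<dots> = (\<Sum>m<n. \<Sum>k<n. \<Sum>j<n. R m k * B k j * cnj (R m j))"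
    by (rule sum.swap)
  also have "\<dots> = (\<Sum>m<n. qf n B (\<lambda>i. cnj (R m i)))"
    by (simp add: qf_def)
  finally show ?thesis using psdfD(2)[OF assms(2)] by (simp add: sum_nonneg)
qed

text \<open>The diagonal entry is the squared norm of column \<open>j\<close> of the Gram factor, so
  that column is zero. This serves the case of a singular reference state
  \<open>\<sigma>\<close>.\<close>

lemma psdf_zero_diag:
  assumes "psdf n A" "j < n" "k < n" "A j j = 0"
  shows "A j k = 0" "A k j = 0"
proof -
  obtain R where R: "\<And>i j. i < n \<Longrightarrow> j < n \<Longrightarrow> A i j = (\<Sum>m<n. cnj (R m i) * R m j)"
    using psdf_gram[OF assms(1)] by blast
  have "complex_of_real (\<Sum>m<n. (cmod (R m j))\<^sup>2) = 0"
    using R[OF assms(2,2)] assms(4) by (simp only: cnj_mult_self of_real_sum)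
  then have "(\<Sum>m<n. (cmod (R m j))\<^sup>2) = 0" by (simp only: of_real_eq_0_iff)
  then have "\<forall>m<n. R m j = 0" by (subst (asm) sum_nonneg_eq_0_iff) auto
  then show "A j k = 0" "A k j = 0" using R assms by auto
qed

section \<open>The real trace pairing \<open>Re tr (A B)\<close>\<close>

abbreviation idf :: "nat \<Rightarrow> nat \<Rightarrow> complex" where
  "idf i j \<equiv> if i = j then 1 else 0"

definition trp :: "nat \<Rightarrow> (nat \<Rightarrow> nat \<Rightarrow> complex) \<Rightarrow> (nat \<Rightarrow> nat \<Rightarrow> complex) \<Rightarrow> real" where
  "trp n A B = Re (\<Sum>i<n. \<Sum>j<n. A i j * B j i)"

lemma trp_nonneg: "psdf n A \<Longrightarrow> psdf n B \<Longrightarrow> 0 \<le> trp n A B"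
  unfolding trp_def by (rule psdf_trace_mult_nonneg)

lemma trp_cong:
  assumes "\<And>i j. i < n \<Longrightarrow> j < n \<Longrightarrow> A i j = A' i j" "\<And>i j. i < n \<Longrightarrow> j < n \<Longrightarrow> B i j = B' i j"
  shows "trp n A B = trp n A' B'"
  unfolding trp_def using assms by (intro arg_cong[where f = Re] sum.cong refl) simp

lemma trp_commute: "trp n A B = trp n B A"
  unfolding trp_def by (subst sum.swap) (simp only: mult.commute)

lemma trp_add_right: "trp n A (\<lambda>i j. B i j + C i j) = trp n A B + trp n A C"
  by (simp add: trp_def distrib_left sum.distrib)

lemma trp_diff_right: "trp n A (\<lambda>i j. B i j - C i j) = trp n A B - trp n A C"
  by (simp add: trp_def right_diff_distrib sum_subtractf)

lemma trp_scale_right: "trp n A (\<lambda>i j. complex_of_real c * B i j) = c * trp n A B"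
proof -
  have "(\<Sum>i<n. \<Sum>j<n. A i j * (complex_of_real c * B j i)) = of_real c * (\<Sum>i<n. \<Sum>j<n. A i j * B j i)"
    by (simp only: sum_distrib_left mult.left_commute)
  then show ?thesis unfolding trp_def by (simp only: Re_complex_of_real Im_complex_of_real times_complex.sel mult_zero_left diff_zero)
qed

lemma trp_sum_right: "finite I \<Longrightarrow> trp n A (\<lambda>i j. \<Sum>x\<in>I. B x i j) = (\<Sum>x\<in>I. trp n A (B x))"
proof (induction I rule: finite_induct)
  case empty
  then show ?case by (simp add: trp_def)
next
  case (insert x I)
  then show ?case by (simp add: trp_add_right)
qed

lemma trp_add_left: "trp n (\<lambda>i j. B i j + C i j) A = trp n B A + trp n C A"
  by (simp only: trp_commute[of n _ A] trp_add_right)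

lemma trp_diff_left: "trp n (\<lambda>i j. B i j - C i j) A = trp n B A - trp n C A"
  by (simp only: trp_commute[of n _ A] trp_diff_right)

lemma trp_scale_left: "trp n (\<lambda>i j. complex_of_real c * B i j) A = c * trp n B A"
  by (simp only: trp_commute[of n _ A] trp_scale_right)

lemma trp_idf: "trp n idf A = Re (\<Sum>i<n. A i i)"
  unfolding trp_def by (simp add: if_distrib[of "\<lambda>x. x * _"] cong: if_cong)

section \<open>Trace norm and purified distance\<close>

lemma adj_mult_self_index:
  assumes "A \<in> carrier_mat n n" "i < n" "j < n"
  shows "(adj A * A) $$ (i,j) = (\<Sum>m<n. cnj (A $$ (m,i)) * A $$ (m,j))"
  unfolding mult_mat_index_sum[OF adj_carrier[OF assms(1)] assms]
  using assms by (intro sum.cong) (auto simp: adj_index[OF assms(1)])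

lemma trace_norm_sp:
  assumes A: "A \<in> carrier_mat n n" and u: "onb n u"
    and eq: "\<And>i j. i < n \<Longrightarrow> j < n \<Longrightarrow> (adj A * A) $$ (i,j) = sp n (\<lambda>k. complex_of_real (\<mu> k)) u i j"
  shows "trace_norm A = (\<Sum>k<n. sqrt (\<mu> k))"
proof -
  have "proots (char_poly (adj A * A)) = image_mset (\<lambda>k. complex_of_real (\<mu> k)) (mset_set {..<n})"
    by (rule proots_char_poly_sp[OF u mult_carrier_mat[OF adj_carrier[OF A] A] eq])
  then show ?thesis
    by (simp add: trace_norm_def image_mset.compositionality comp_def sum_unfold_sum_mset)
qed

text \<open>The basis \<open>v\<close> diagonalises \<open>adj A * A\<close>, so it consists of
  right singular vectors: the images \<open>A v_k\<close> are mutually orthogonal and have lengths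
  \<open>s k\<close>.\<close>

lemma trace_norm_singular_values:
  assumes A: "A \<in> carrier_mat n n"
  shows "\<exists>v s. onb n v \<and> (\<forall>k<n. 0 \<le> s k) \<and> trace_norm A = (\<Sum>k<n. s k) \<and>
    (\<forall>k<n. \<forall>l<n. (\<Sum>i<n. cnj (\<Sum>j<n. A $$ (i,j) * v k j) * (\<Sum>j<n. A $$ (i,j) * v l j)) =
      (if k = l then complex_of_real ((s k)\<^sup>2) else 0))"
proof -
  let ?M = "\<lambda>i j. \<Sum>m<n. cnj (A $$ (m,i)) * A $$ (m,j)"
  have "psdf n ?M" by (rule psdf_gramI) (rule refl)
  then obtain v \<mu> where v: "onb n v" and \<mu>: "\<And>k. k < n \<Longrightarrow> 0 \<le> \<mu> k"
    and M: "\<And>i j. i < n \<Longrightarrow> j < n \<Longrightarrow> ?M i j = sp n (\<lambda>k. complex_of_real (\<mu> k)) v i j"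
    using psdf_eigenbasis[of n ?M] by blast
  have tn: "trace_norm A = (\<Sum>k<n. sqrt (\<mu> k))"
    by (rule trace_norm_sp[OF A v]) (simp only: adj_mult_self_index[OF A] M)
  have "(\<Sum>i<n. cnj (\<Sum>j<n. A $$ (i,j) * v k j) * (\<Sum>j<n. A $$ (i,j) * v l j)) =
      (if k = l then complex_of_real ((sqrt (\<mu> k))\<^sup>2) else 0)" if kl: "k < n" "l < n" for k l
  proof -
    have "(\<Sum>i<n. cnj (\<Sum>j<n. A $$ (i,j) * v k j) * (\<Sum>j<n. A $$ (i,j) * v l j)) =
        (\<Sum>i<n. \<Sum>a<n. \<Sum>b<n. cnj (v k a) * (cnj (A $$ (i,a)) * A $$ (i,b)) * v l b)"
      unfolding sum_product cnj_sum by (intro sum.cong refl) simp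
    also have "\<dots> = (\<Sum>a<n. \<Sum>i<n. \<Sum>b<n. cnj (v k a) * (cnj (A $$ (i,a)) * A $$ (i,b)) * v l b)"
      by (rule sum.swap)
    also have "\<dots> = (\<Sum>a<n. \<Sum>b<n. \<Sum>i<n. cnj (v k a) * (cnj (A $$ (i,a)) * A $$ (i,b)) * v l b)"
      by (rule sum.cong[OF refl], rule sum.swap)
    also have "\<dots> = (\<Sum>a<n. \<Sum>b<n. cnj (v k a) * ?M a b * v l b)"
      by (simp only: sum_distrib_left sum_distrib_right)
    also have "\<dots> = (\<Sum>a<n. \<Sum>b<n. cnj (v k a) * sp n (\<lambda>k. complex_of_real (\<mu> k)) v a b * v l b)"
      by (intro sum.cong refl) (simp add: M)
    also have "\<dots> = (\<Sum>a<n. cnj (v k a) * (\<Sum>b<n. sp n (\<lambda>k. complex_of_real (\<mu> k)) v a b * v l b))"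
      by (simp only: sum_distrib_left mult.assoc)
    also have "\<dots> = \<mu> l * (\<Sum>a<n. cnj (v k a) * v l a)"
      unfolding sp_apply[OF v kl(2)] by (simp only: sum_distrib_left mult_ac)
    also have "\<dots> = (if k = l then complex_of_real ((sqrt (\<mu> k))\<^sup>2) else 0)"
      unfolding onbD[OF v kl] real_sqrt_pow2[OF \<mu>[OF kl(1)]] by simp
    finally show ?thesis .
  qed
  then show ?thesis using v \<mu> tn by (intro exI[of _ v] exI[of _ "\<lambda>k. sqrt (\<mu> k)"]) simp
qed

lemma trace_norm_nonneg: "A \<in> carrier_mat n n \<Longrightarrow> 0 \<le> trace_norm A"
  using trace_norm_singular_values[of A n] by (metis lessThan_iff sum_nonneg)

text \<open>For Hermitian \<open>A\<close> the eigenvalues of \<open>adj A * A\<close> are the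
  squares of those of \<open>A\<close>, and \<open>S\<close> is \<open>sgn \<mu>\<close> in the same
  basis. This replaces the trace norm by a pairing with a fixed matrix, which can be split block by
  block.\<close>

lemma trace_norm_sign:
  assumes A: "A \<in> carrier_mat n n"
    and herm: "\<And>i j. i < n \<Longrightarrow> j < n \<Longrightarrow> A $$ (i,j) = cnj (A $$ (j,i))"
  shows "\<exists>S. psdf n (\<lambda>i j. idf i j + S i j) \<and> psdf n (\<lambda>i j. idf i j - S i j) \<and>
    trace_norm A = trp n S (\<lambda>i j. A $$ (i,j))"
proof -
  obtain u \<mu> where u: "onb n u"
    and Aij: "\<And>i j. i < n \<Longrightarrow> j < n \<Longrightarrow> A $$ (i,j) = sp n (\<lambda>k. complex_of_real (\<mu> k)) u i j"
    using hermitian_eigenbasis[of n "\<lambda>i j. A $$ (i,j)", OF herm] by blast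
  have "(adj A * A) $$ (i,j) = sp n (\<lambda>k. complex_of_real ((\<mu> k)\<^sup>2)) u i j" if ij: "i < n" "j < n" for i j
  proof -
    have "(adj A * A) $$ (i,j) = (\<Sum>m<n. cnj (A $$ (m,i)) * A $$ (m,j))"
      by (rule adj_mult_self_index[OF A ij])
    also have "\<dots> = (\<Sum>m<n. sp n (\<lambda>k. complex_of_real (\<mu> k)) u i m * sp n (\<lambda>k. complex_of_real (\<mu> k)) u m j)"
      using ij by (intro sum.cong refl) (simp add: Aij sp_cnj)
    finally show ?thesis unfolding sp_mult[OF u] by (simp add: power2_eq_square)
  qed
  then have tn: "trace_norm A = (\<Sum>k<n. \<bar>\<mu> k\<bar>)"
    using trace_norm_sp[OF A u, of "\<lambda>k. (\<mu> k)\<^sup>2"] by simp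
  define S where "S = sp n (\<lambda>k. complex_of_real (sgn (\<mu> k))) u"
  have "psdf n (sp n (\<lambda>k. complex_of_real (1 + sgn (\<mu> k))) u)" "psdf n (sp n (\<lambda>k. complex_of_real (1 - sgn (\<mu> k))) u)"
    by (rule psdf_sp, simp add: sgn_if)+
  moreover have "sp n (\<lambda>k. complex_of_real (1 + sgn (\<mu> k))) u i j = idf i j + S i j"
    "sp n (\<lambda>k. complex_of_real (1 - sgn (\<mu> k))) u i j = idf i j - S i j" if "i < n" "j < n" for i j
    unfolding of_real_add of_real_diff sp_add sp_diff S_def of_real_1 using sp_one[OF u that] by simp_all
  ultimately have "psdf n (\<lambda>i j. idf i j + S i j)" "psdf n (\<lambda>i j. idf i j - S i j)"
    using psdf_cong[of n "sp n (\<lambda>k. complex_of_real (1 + sgn (\<mu> k))) u" "\<lambda>i j. idf i j + S i j"]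
      psdf_cong[of n "sp n (\<lambda>k. complex_of_real (1 - sgn (\<mu> k))) u" "\<lambda>i j. idf i j - S i j"] by blast+
  moreover have "trp n S (\<lambda>i j. A $$ (i,j)) = (\<Sum>k<n. \<bar>\<mu> k\<bar>)"
  proof -
    have "(\<Sum>i<n. \<Sum>j<n. S i j * A $$ (j,i)) = (\<Sum>i<n. \<Sum>j<n. S i j * sp n (\<lambda>k. complex_of_real (\<mu> k)) u j i)"
      by (intro sum.cong refl) (simp add: Aij)
    also have "\<dots> = (\<Sum>k<n. complex_of_real (sgn (\<mu> k)) * complex_of_real (\<mu> k))"
      unfolding S_def sp_mult[OF u] sp_trace[OF u] ..
    also have "\<dots> = of_real (\<Sum>k<n. \<bar>\<mu> k\<bar>)"
      unfolding of_real_sum of_real_mult[symmetric] by (simp only: sgn_mult_self_eq abs_sgn mult.commute)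
    finally show ?thesis by (simp only: trp_def Re_complex_of_real)
  qed
  ultimately show ?thesis using tn by auto
qed

section \<open>Square roots of positive semidefinite matrices\<close>

lemma psd_sqrt_exists:
  assumes "psd n A"
  shows "\<exists>B. psd n B \<and> B * B = A"
proof -
  have A: "A \<in> carrier_mat n n" "psdf n (\<lambda>i j. A $$ (i,j))" using assms by (auto simp: psd_iff_psdf)
  obtain u \<mu> where u: "onb n u" and \<mu>: "\<And>k. k < n \<Longrightarrow> 0 \<le> \<mu> k"
    and Aij: "\<And>i j. i < n \<Longrightarrow> j < n \<Longrightarrow> A $$ (i,j) = sp n (\<lambda>k. complex_of_real (\<mu> k)) u i j"
    using psdf_eigenbasis[OF A(2)] by blast
  define b where "b = sp n (\<lambda>k. complex_of_real (sqrt (\<mu> k))) u"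
  define B where "B = mat n n (\<lambda>(i,j). b i j)"
  have B: "B \<in> carrier_mat n n" by (simp add: B_def)
  have Bij: "B $$ (i,j) = b i j" if "i < n" "j < n" for i j using that by (simp add: B_def)
  have "psdf n b" unfolding b_def using \<mu> by (intro psdf_sp) simp
  then have "psd n B" using B psdf_cong[of n "\<lambda>i j. B $$ (i,j)" b] Bij by (simp add: psd_iff_psdf)
  moreover have "B * B = A"
  proof (rule eq_matI)
    fix i j assume "i < dim_row A" "j < dim_col A"
    then have ij: "i < n" "j < n" using A by auto
    have "(B * B) $$ (i,j) = (\<Sum>l<n. b i l * b l j)"
      unfolding mult_mat_index_sum[OF B B ij] using ij by (intro sum.cong refl) (simp add: Bij)
    also have "\<dots> = sp n (\<lambda>k. complex_of_real (sqrt (\<mu> k)) * complex_of_real (sqrt (\<mu> k))) u i j"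
      unfolding b_def by (rule sp_mult[OF u])
    also have "\<dots> = A $$ (i,j)"
      unfolding Aij[OF ij] sp_def using \<mu>
      by (intro sum.cong refl) (simp flip: of_real_mult)
    finally show "(B * B) $$ (i,j) = A $$ (i,j)" .
  qed (use A B in auto)
  ultimately show ?thesis by blast
qed

text \<open>With \<open>D = B - C\<close> the assumption reads \<open>B D + D C = 0\<close>. At a
  unit eigenvector \<open>w\<close> of \<open>D\<close> with eigenvalue
  \<open>\<mu> \<noteq> 0\<close> this gives \<open><w, B w> + <w, C w> = 0\<close>. Both terms are
  nonnegative, so both vanish, and with them their difference \<open><w, D w> = \<mu>\<close>.
  Uniqueness is what gives the description \<open>THE\<close> in \<open>msqrt\<close> a
  meaning.\<close>

lemma psd_sqrt_unique:
  assumes "psd n B" "psd n C" "B * B = C * C"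
  shows "B = C"
proof -
  let ?b = "\<lambda>i j. B $$ (i,j)" let ?c = "\<lambda>i j. C $$ (i,j)"
  have B: "B \<in> carrier_mat n n" "psdf n ?b" and C: "C \<in> carrier_mat n n" "psdf n ?c"
    using assms by (auto simp: psd_iff_psdf)
  define D where "D i j = ?b i j - ?c i j" for i j
  have herm: "D i j = cnj (D j i)" if "i < n" "j < n" for i j
    unfolding D_def complex_cnj_diff using psdf_hermitian[OF B(2) that] psdf_hermitian[OF C(2) that] by argo
  obtain u \<mu> where u: "onb n u"
    and Dij: "\<And>i j. i < n \<Longrightarrow> j < n \<Longrightarrow> D i j = sp n (\<lambda>k. complex_of_real (\<mu> k)) u i j"
    using hermitian_eigenbasis[of n D, OF herm] by blast
  have "\<mu> k = 0" if k: "k < n" for k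
  proof (rule ccontr)
    assume nz: "\<mu> k \<noteq> 0"
    define w where "w = u k"
    have Dw: "(\<Sum>j<n. D i j * w j) = \<mu> k * w i" if "i < n" for i
    proof -
      have "(\<Sum>j<n. D i j * w j) = (\<Sum>j<n. sp n (\<lambda>k. complex_of_real (\<mu> k)) u i j * u k j)"
        using that by (intro sum.cong refl) (simp add: Dij w_def)
      then show ?thesis using sp_apply[OF u k] by (simp add: w_def)
    qed
    have wD: "(\<Sum>i<n. cnj (w i) * D i j) = \<mu> k * cnj (w j)" if "j < n" for j
    proof -
      have "(\<Sum>i<n. cnj (w i) * D i j) = cnj (\<Sum>i<n. D j i * w i)"
        unfolding cnj_sum complex_cnj_mult using herm[OF that]
        by (intro sum.cong refl) (simp add: mult.commute herm[OF _ that])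
      then show ?thesis unfolding Dw[OF that] by simp
    qed
    have BBCC: "(\<Sum>m<n. ?b i m * D m j) + (\<Sum>m<n. D i m * ?c m j) = 0" if ij: "i < n" "j < n" for i j
    proof -
      have "(\<Sum>m<n. ?b i m * D m j) + (\<Sum>m<n. D i m * ?c m j) = (\<Sum>m<n. ?b i m * ?b m j) - (\<Sum>m<n. ?c i m * ?c m j)"
        unfolding D_def sum.distrib[symmetric] sum_subtractf[symmetric] by (intro sum.cong refl) (simp add: algebra_simps)
      also have "\<dots> = (B * B) $$ (i,j) - (C * C) $$ (i,j)"
        unfolding mult_mat_index_sum[OF B(1) B(1) ij] mult_mat_index_sum[OF C(1) C(1) ij] ..
      finally show ?thesis using assms(3) by simp
    qed
    have "(\<Sum>i<n. \<Sum>j<n. cnj (w i) * (\<Sum>m<n. ?b i m * D m j) * w j) = \<mu> k * qf n ?b w"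
    proof -
      have "(\<Sum>i<n. \<Sum>j<n. cnj (w i) * (\<Sum>m<n. ?b i m * D m j) * w j) =
        (\<Sum>i<n. \<Sum>j<n. \<Sum>m<n. cnj (w i) * ?b i m * (D m j * w j))"
        by (simp only: sum_distrib_left sum_distrib_right mult.assoc)
      also have "\<dots> = (\<Sum>i<n. \<Sum>m<n. \<Sum>j<n. cnj (w i) * ?b i m * (D m j * w j))"
        by (rule sum.cong[OF refl], rule sum.swap)
      also have "\<dots> = (\<Sum>i<n. \<Sum>m<n. cnj (w i) * ?b i m * (\<mu> k * w m))"
        by (intro sum.cong refl) (simp only: sum_distrib_left[symmetric] Dw lessThan_iff)
      finally show ?thesis unfolding qf_def by (simp only: sum_distrib_left mult_ac)
    qed
    moreover have "(\<Sum>i<n. \<Sum>j<n. cnj (w i) * (\<Sum>m<n. D i m * ?c m j) * w j) = \<mu> k * qf n ?c w"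
    proof -
      have "(\<Sum>i<n. \<Sum>j<n. cnj (w i) * (\<Sum>m<n. D i m * ?c m j) * w j) =
        (\<Sum>i<n. \<Sum>j<n. \<Sum>m<n. cnj (w i) * D i m * (?c m j * w j))"
        by (simp only: sum_distrib_left sum_distrib_right mult.assoc)
      also have "\<dots> = (\<Sum>i<n. \<Sum>m<n. \<Sum>j<n. cnj (w i) * D i m * (?c m j * w j))"
        by (rule sum.cong[OF refl], rule sum.swap)
      also have "\<dots> = (\<Sum>m<n. \<Sum>i<n. \<Sum>j<n. cnj (w i) * D i m * (?c m j * w j))"
        by (rule sum.swap)
      also have "\<dots> = (\<Sum>m<n. (\<Sum>i<n. cnj (w i) * D i m) * (\<Sum>j<n. ?c m j * w j))"
        by (simp only: sum_product)
      also have "\<dots> = (\<Sum>m<n. (\<mu> k * cnj (w m)) * (\<Sum>j<n. ?c m j * w j))"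
        by (intro sum.cong refl) (simp only: wD lessThan_iff)
      finally show ?thesis unfolding qf_def by (simp only: sum_distrib_left mult_ac)
    qed
    moreover have "(\<Sum>i<n. \<Sum>j<n. cnj (w i) * (\<Sum>m<n. ?b i m * D m j) * w j) +
        (\<Sum>i<n. \<Sum>j<n. cnj (w i) * (\<Sum>m<n. D i m * ?c m j) * w j) = 0"
      unfolding sum.distrib[symmetric, where A = "{..<n}" and g = "\<lambda>i. \<Sum>j<n. cnj (w i) * (\<Sum>m<n. ?b i m * D m j) * w j"]
        sum.distrib[symmetric, where g = "\<lambda>j. cnj (w i) * (\<Sum>m<n. ?b i m * D m j) * w j" for i]
        distrib_right[symmetric] distrib_left[symmetric]
      by (intro sum.neutral ballI) (simp only: BBCC lessThan_iff mult_zero_left mult_zero_right)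
    ultimately have "of_real (\<mu> k) * (qf n ?b w + qf n ?c w) = 0" by (simp add: distrib_left)
    then have "qf n ?b w + qf n ?c w = 0" using nz by simp
    then have "Re (qf n ?b w) + Re (qf n ?c w) = 0" by (metis plus_complex.sel(1) zero_complex.sel(1))
    then have "Re (qf n ?b w) = 0" "Re (qf n ?c w) = 0"
      using psdfD(2)[OF B(2), of w] psdfD(2)[OF C(2), of w] by linarith+
    moreover have "qf n ?b w - qf n ?c w = qf n D w"
      unfolding qf_def sum_subtractf[symmetric] D_def by (intro sum.cong refl) (simp only: algebra_simps)
    moreover have "qf n D w = \<mu> k"
    proof -
      have "qf n D w = qf n (sp n (\<lambda>k. complex_of_real (\<mu> k)) u) w"
        by (rule qf_cong) (rule Dij)
      then show ?thesis unfolding w_def qf_sp[OF u k] .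
    qed
    ultimately have "\<mu> k = 0" by (metis Re_complex_of_real diff_self minus_complex.sel(1))
    then show False using nz by simp
  qed
  then have "D i j = 0" if "i < n" "j < n" for i j
    unfolding Dij[OF that] sp_def by (intro sum.neutral) simp
  then show "B = C" using B(1) C(1) by (intro eq_matI) (auto simp: D_def)
qed

lemma msqrt:
  assumes "psd n A"
  shows "psd n (msqrt n A)" "msqrt n A * msqrt n A = A"
proof -
  obtain B where B: "psd n B" "B * B = A" using psd_sqrt_exists[OF assms] by blast
  then have "psd n (msqrt n A) \<and> msqrt n A * msqrt n A = A"
    unfolding msqrt_def by (rule_tac theI[of _ B]) (auto intro: psd_sqrt_unique)
  then show "psd n (msqrt n A)" "msqrt n A * msqrt n A = A" by auto
qed

text \<open>The squared norm of \<open>g\<close> minus its expansion \<open>e\<close> is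
  nonnegative. Vectors with \<open>\<not> Q k\<close> are zero; such gaps occur among left singular
  vectors, at singular value zero.\<close>

lemma bessel_inequality:
  fixes n :: nat
  assumes orth: "\<And>k l. k < n \<Longrightarrow> l < n \<Longrightarrow> (\<Sum>i<n. cnj (u k i) * u l i) = (if k = l \<and> Q k then 1 else 0)"
  shows "(\<Sum>k<n. (cmod (\<Sum>i<n. g i * u k i))\<^sup>2) \<le> (\<Sum>i<n. (cmod (g i))\<^sup>2)"
proof -
  define c where "c k = (\<Sum>i<n. g i * u k i)" for k
  define e where "e i = (\<Sum>k<n. c k * cnj (u k i))" for i
  have ce: "cnj (e i) = (\<Sum>l<n. cnj (c l) * u l i)" for i
    unfolding e_def cnj_sum complex_cnj_mult complex_cnj_cnj ..
  have ue: "(\<Sum>i<n. u l i * e i) = (if Q l then c l else 0)" if "l < n" for l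
  proof -
    have "(\<Sum>i<n. u l i * e i) = (\<Sum>i<n. \<Sum>k<n. c k * (cnj (u k i) * u l i))"
      unfolding e_def by (simp only: sum_distrib_left mult_ac)
    also have "\<dots> = (\<Sum>k<n. \<Sum>i<n. c k * (cnj (u k i) * u l i))"
      by (rule sum.swap)
    also have "\<dots> = (\<Sum>k<n. c k * (\<Sum>i<n. cnj (u k i) * u l i))"
      by (simp only: sum_distrib_left)
    also have "\<dots> = (\<Sum>k<n. if k = l then (if Q l then c l else 0) else 0)"
      using that by (intro sum.cong refl) (auto simp: orth)
    also have "\<dots> = (if Q l then c l else 0)"
      using that by (subst sum.delta) auto
    finally show ?thesis .
  qed
  have E1: "(\<Sum>i<n. g i * cnj (e i)) = of_real (\<Sum>l<n. (cmod (c l))\<^sup>2)"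
  proof -
    have "(\<Sum>i<n. g i * cnj (e i)) = (\<Sum>i<n. \<Sum>l<n. cnj (c l) * (g i * u l i))"
      unfolding ce by (simp only: sum_distrib_left mult_ac)
    also have "\<dots> = (\<Sum>l<n. \<Sum>i<n. cnj (c l) * (g i * u l i))"
      by (rule sum.swap)
    also have "\<dots> = (\<Sum>l<n. cnj (c l) * c l)"
      unfolding c_def by (simp only: sum_distrib_left)
    finally show ?thesis unfolding cnj_mult_self of_real_sum .
  qed
  have "(\<Sum>i<n. e i * cnj (g i)) = cnj (\<Sum>i<n. g i * cnj (e i))"
    unfolding cnj_sum by (intro sum.cong refl) simp
  then have E2: "(\<Sum>i<n. e i * cnj (g i)) = of_real (\<Sum>l<n. (cmod (c l))\<^sup>2)"
    unfolding E1 by (simp only: complex_cnj_complex_of_real)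
  have E3: "(\<Sum>i<n. e i * cnj (e i)) = of_real (\<Sum>l<n. if Q l then (cmod (c l))\<^sup>2 else 0)"
  proof -
    have "(\<Sum>i<n. e i * cnj (e i)) = (\<Sum>i<n. \<Sum>l<n. cnj (c l) * (u l i * e i))"
      unfolding ce by (simp only: sum_distrib_left mult_ac)
    also have "\<dots> = (\<Sum>l<n. \<Sum>i<n. cnj (c l) * (u l i * e i))"
      by (rule sum.swap)
    also have "\<dots> = (\<Sum>l<n. cnj (c l) * (\<Sum>i<n. u l i * e i))"
      by (simp only: sum_distrib_left)
    also have "\<dots> = (\<Sum>l<n. of_real (if Q l then (cmod (c l))\<^sup>2 else 0))"
      by (rule sum.cong[OF refl]) (simp add: ue cnj_mult_self)
    finally show ?thesis unfolding of_real_sum .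
  qed
  define h where "h i = g i - e i" for i
  have "complex_of_real (\<Sum>i<n. (cmod (h i))\<^sup>2) = (\<Sum>i<n. h i * cnj (h i))"
    by (simp only: of_real_sum cnj_mult_self)
  also have "\<dots> = (\<Sum>i<n. g i * cnj (g i)) - (\<Sum>i<n. g i * cnj (e i)) - (\<Sum>i<n. e i * cnj (g i)) + (\<Sum>i<n. e i * cnj (e i))"
    unfolding sum_subtractf[symmetric] sum.distrib[symmetric]
    by (intro sum.cong refl) (simp add: h_def algebra_simps)
  finally have "complex_of_real (\<Sum>i<n. (cmod (h i))\<^sup>2) = of_real ((\<Sum>i<n. (cmod (g i))\<^sup>2) - (\<Sum>l<n. (cmod (c l))\<^sup>2)
      - (\<Sum>l<n. (cmod (c l))\<^sup>2) + (\<Sum>l<n. if Q l then (cmod (c l))\<^sup>2 else 0))"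
    unfolding E1 E2 E3 of_real_add of_real_diff by (simp only: cnj_mult_self of_real_sum)
  then have "(\<Sum>i<n. (cmod (h i))\<^sup>2) = (\<Sum>i<n. (cmod (g i))\<^sup>2) - (\<Sum>l<n. (cmod (c l))\<^sup>2)
      - (\<Sum>l<n. (cmod (c l))\<^sup>2) + (\<Sum>l<n. if Q l then (cmod (c l))\<^sup>2 else 0)"
    by (simp only: of_real_eq_iff)
  moreover have "0 \<le> (\<Sum>i<n. (cmod (h i))\<^sup>2)" by (simp add: sum_nonneg)
  moreover have "(\<Sum>l<n. if Q l then (cmod (c l))\<^sup>2 else 0) \<le> (\<Sum>l<n. (cmod (c l))\<^sup>2)"
    by (intro sum_mono) auto
  ultimately show ?thesis unfolding c_def by linarith
qed

lemma cauchy_schwarz_sum: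
  fixes x y :: "'i \<Rightarrow> complex"
  shows "cmod (\<Sum>k\<in>K. x k * y k) \<le> sqrt (\<Sum>k\<in>K. (cmod (x k))\<^sup>2) * sqrt (\<Sum>k\<in>K. (cmod (y k))\<^sup>2)"
proof -
  have "cmod (\<Sum>k\<in>K. x k * y k) \<le> (\<Sum>k\<in>K. \<bar>cmod (x k)\<bar> * \<bar>cmod (y k)\<bar>)"
    by (rule order_trans[OF norm_sum]) (simp add: norm_mult)
  also have "\<dots> \<le> L2_set (\<lambda>k. cmod (x k)) K * L2_set (\<lambda>k. cmod (y k)) K"
    by (rule L2_set_mult_ineq)
  finally show ?thesis by (simp add: L2_set_def)
qed

text \<open>The left side is the squared Frobenius norm of \<open>R r\<close> applied to the vectors
  \<open>u k\<close>. Bessel's inequality for each row of \<open>R r\<close> removes the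
  \<open>u k\<close>, and what is left is \<open>tr (r P r) = tr (P \<rho>)\<close>.\<close>

lemma gram_frobenius_le:
  assumes orth: "\<And>k l. k < n \<Longrightarrow> l < n \<Longrightarrow> (\<Sum>i<n. cnj (u k i) * u l i) = (if k = l \<and> Q k then 1 else 0)"
    and P: "\<And>i j. i < n \<Longrightarrow> j < n \<Longrightarrow> P i j = (\<Sum>m<n. cnj (R m i) * R m j)"
    and r: "\<And>i j. i < n \<Longrightarrow> j < n \<Longrightarrow> r i j = cnj (r j i)"
    and rho: "\<And>i j. i < n \<Longrightarrow> j < n \<Longrightarrow> \<rho> i j = (\<Sum>m<n. r i m * r m j)"
  shows "(\<Sum>k<n. \<Sum>m<n. (cmod (\<Sum>i<n. R m i * (\<Sum>j<n. r i j * u k j)))\<^sup>2) \<le> trp n P \<rho>"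
proof -
  define G where "G m j = (\<Sum>i<n. R m i * r i j)" for m j
  have G: "(\<Sum>i<n. R m i * (\<Sum>j<n. r i j * u k j)) = (\<Sum>j<n. G m j * u k j)" for m k
    unfolding G_def sum_distrib_left sum_distrib_right by (subst sum.swap) (simp only: mult.assoc)
  have "(\<Sum>k<n. \<Sum>m<n. (cmod (\<Sum>i<n. R m i * (\<Sum>j<n. r i j * u k j)))\<^sup>2) = (\<Sum>m<n. \<Sum>k<n. (cmod (\<Sum>j<n. G m j * u k j))\<^sup>2)"
    unfolding G by (rule sum.swap)
  also have "\<dots> \<le> (\<Sum>m<n. \<Sum>j<n. (cmod (G m j))\<^sup>2)"
    by (rule sum_mono, rule bessel_inequality[where Q = Q], rule orth)
  also have "\<dots> = trp n P \<rho>"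
  proof -
    have "complex_of_real (\<Sum>m<n. \<Sum>j<n. (cmod (G m j))\<^sup>2) = (\<Sum>m<n. \<Sum>j<n. cnj (G m j) * G m j)"
      by (simp only: of_real_sum cnj_mult_self)
    also have "\<dots> = (\<Sum>m<n. \<Sum>j<n. \<Sum>a<n. \<Sum>b<n. cnj (R m a) * R m b * (r b j * cnj (r a j)))"
      unfolding G_def cnj_sum sum_product complex_cnj_mult by (intro sum.cong refl) (simp only: mult_ac)
    also have "\<dots> = (\<Sum>m<n. \<Sum>j<n. \<Sum>a<n. \<Sum>b<n. cnj (R m a) * R m b * (r b j * r j a))"
    proof (intro sum.cong refl)
      fix m j a b assume "j \<in> {..<n}" "a \<in> {..<n}"
      then have "r j a = cnj (r a j)" by (intro r) auto
      then show "cnj (R m a) * R m b * (r b j * cnj (r a j)) = cnj (R m a) * R m b * (r b j * r j a)"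
        by (simp only:)
    qed
    also have "\<dots> = (\<Sum>m<n. \<Sum>a<n. \<Sum>j<n. \<Sum>b<n. cnj (R m a) * R m b * (r b j * r j a))"
      by (rule sum.cong[OF refl], rule sum.swap)
    also have "\<dots> = (\<Sum>m<n. \<Sum>a<n. \<Sum>b<n. \<Sum>j<n. cnj (R m a) * R m b * (r b j * r j a))"
      by (rule sum.cong[OF refl], rule sum.cong[OF refl], rule sum.swap)
    also have "\<dots> = (\<Sum>m<n. \<Sum>a<n. \<Sum>b<n. cnj (R m a) * R m b * \<rho> b a)"
      by (intro sum.cong refl) (simp only: sum_distrib_left[symmetric] rho lessThan_iff)
    also have "\<dots> = (\<Sum>a<n. \<Sum>m<n. \<Sum>b<n. cnj (R m a) * R m b * \<rho> b a)"
      by (rule sum.swap)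
    also have "\<dots> = (\<Sum>a<n. \<Sum>b<n. \<Sum>m<n. cnj (R m a) * R m b * \<rho> b a)"
      by (rule sum.cong[OF refl], rule sum.swap)
    also have "\<dots> = (\<Sum>a<n. \<Sum>b<n. P a b * \<rho> b a)"
      by (intro sum.cong refl) (simp only: sum_distrib_right[symmetric] P lessThan_iff)
    finally have "Re (complex_of_real (\<Sum>m<n. \<Sum>j<n. (cmod (G m j))\<^sup>2)) = trp n P \<rho>"
      unfolding trp_def by (rule arg_cong)
    then show ?thesis unfolding Re_complex_of_real .
  qed
  finally show ?thesis .
qed

text \<open>With \<open>P = adj R * R\<close> the sum is that of the inner products of
  \<open>R r u_k\<close> and \<open>R r' v_k\<close>. Cauchy-Schwarz over all pairs of a vector
  \<open>k\<close> and a row \<open>m\<close> separates them into two Frobenius norms.\<close>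

lemma psdf_overlap_le:
  assumes P: "psdf n P"
    and u: "\<And>k l. k < n \<Longrightarrow> l < n \<Longrightarrow> (\<Sum>i<n. cnj (u k i) * u l i) = (if k = l \<and> Q k then 1 else 0)"
    and v: "\<And>k l. k < n \<Longrightarrow> l < n \<Longrightarrow> (\<Sum>i<n. cnj (v k i) * v l i) = (if k = l \<and> Q' k then 1 else 0)"
    and r: "\<And>i j. i < n \<Longrightarrow> j < n \<Longrightarrow> r i j = cnj (r j i)"
    and r': "\<And>i j. i < n \<Longrightarrow> j < n \<Longrightarrow> r' i j = cnj (r' j i)"
    and rho: "\<And>i j. i < n \<Longrightarrow> j < n \<Longrightarrow> \<rho> i j = (\<Sum>m<n. r i m * r m j)"
    and rho': "\<And>i j. i < n \<Longrightarrow> j < n \<Longrightarrow> \<rho>' i j = (\<Sum>m<n. r' i m * r' m j)"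
  shows "cmod (\<Sum>k<n. \<Sum>i<n. \<Sum>j<n. cnj (\<Sum>a<n. r i a * u k a) * P i j * (\<Sum>b<n. r' j b * v k b))
    \<le> sqrt (trp n P \<rho>) * sqrt (trp n P \<rho>')"
proof -
  obtain R where R: "\<And>i j. i < n \<Longrightarrow> j < n \<Longrightarrow> P i j = (\<Sum>m<n. cnj (R m i) * R m j)"
    using psdf_gram[OF P] by blast
  define a where "a k i = (\<Sum>j<n. r i j * u k j)" for k i
  define b where "b k i = (\<Sum>j<n. r' i j * v k j)" for k i
  define X where "X k m = (\<Sum>i<n. R m i * a k i)" for k m
  define Y where "Y k m = (\<Sum>i<n. R m i * b k i)" for k m
  have "(\<Sum>i<n. \<Sum>j<n. cnj (a k i) * P i j * b k j) = (\<Sum>m<n. cnj (X k m) * Y k m)" for k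
  proof -
    have "(\<Sum>i<n. \<Sum>j<n. cnj (a k i) * P i j * b k j) = (\<Sum>i<n. \<Sum>j<n. \<Sum>m<n. cnj (R m i * a k i) * (R m j * b k j))"
      by (intro sum.cong refl)
        (simp only: R lessThan_iff sum_distrib_left sum_distrib_right complex_cnj_mult mult_ac)
    also have "\<dots> = (\<Sum>i<n. \<Sum>m<n. \<Sum>j<n. cnj (R m i * a k i) * (R m j * b k j))"
      by (rule sum.cong[OF refl], rule sum.swap)
    also have "\<dots> = (\<Sum>m<n. \<Sum>i<n. \<Sum>j<n. cnj (R m i * a k i) * (R m j * b k j))"
      by (rule sum.swap)
    finally show ?thesis unfolding X_def Y_def cnj_sum sum_product .
  qed
  then have "(\<Sum>k<n. \<Sum>i<n. \<Sum>j<n. cnj (a k i) * P i j * b k j) = (\<Sum>(k,m)\<in>{..<n}\<times>{..<n}. cnj (X k m) * Y k m)"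
    by (simp add: sum.cartesian_product)
  also have "cmod \<dots> \<le> sqrt (\<Sum>(k,m)\<in>{..<n}\<times>{..<n}. (cmod (X k m))\<^sup>2) * sqrt (\<Sum>(k,m)\<in>{..<n}\<times>{..<n}. (cmod (Y k m))\<^sup>2)"
    using cauchy_schwarz_sum[of "\<lambda>(k,m). cnj (X k m)" "\<lambda>(k,m). Y k m" "{..<n}\<times>{..<n}"]
    by (simp add: case_prod_unfold)
  also have "\<dots> = sqrt (\<Sum>k<n. \<Sum>m<n. (cmod (X k m))\<^sup>2) * sqrt (\<Sum>k<n. \<Sum>m<n. (cmod (Y k m))\<^sup>2)"
    by (simp add: sum.cartesian_product)
  also have "\<dots> \<le> sqrt (trp n P \<rho>) * sqrt (trp n P \<rho>')"
  proof (intro mult_mono real_sqrt_le_mono)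
    show "(\<Sum>k<n. \<Sum>m<n. (cmod (X k m))\<^sup>2) \<le> trp n P \<rho>"
      unfolding X_def a_def by (rule gram_frobenius_le[OF u R r rho])
    show "(\<Sum>k<n. \<Sum>m<n. (cmod (Y k m))\<^sup>2) \<le> trp n P \<rho>'"
      unfolding Y_def b_def by (rule gram_frobenius_le[OF v R r' rho'])

    have "0 \<le> (\<Sum>k<n. \<Sum>m<n. (cmod (X k m))\<^sup>2)" by (simp add: sum_nonneg)
    then show "0 \<le> sqrt (trp n P \<rho>)"
      using \<open>(\<Sum>k<n. \<Sum>m<n. (cmod (X k m))\<^sup>2) \<le> trp n P \<rho>\<close>
      by (intro real_sqrt_ge_zero) (rule order_trans)
  qed (simp add: sum_nonneg)
  finally show ?thesis unfolding a_def b_def .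
qed

text \<open>The classical case of two outcomes. Squaring the overlap of \<open>(p, 1 - p)\<close>
  and \<open>(q, 1 - q)\<close> and using \<open>2 x y \<le> x^2 + y^2\<close> gives exactly
  \<open>1 - (p - q)^2\<close>.\<close>

lemma diff_le_sqrt_one_minus_overlap:
  fixes p q F :: real
  assumes "0 \<le> p" "p \<le> 1" "0 \<le> q" "q \<le> 1" "0 \<le> F"
    and F: "F \<le> sqrt p * sqrt q + sqrt (1 - p) * sqrt (1 - q)"
  shows "p - q \<le> sqrt (1 - F\<^sup>2)"
proof -
  define x where "x = sqrt p * sqrt (1 - p)"
  define y where "y = sqrt q * sqrt (1 - q)"
  have "F\<^sup>2 \<le> (sqrt p * sqrt q + sqrt (1 - p) * sqrt (1 - q))\<^sup>2"
    using F assms by (intro power_mono) auto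
  also have "\<dots> = p * q + (1 - p) * (1 - q) + 2 * (x * y)"
    using assms by (simp add: power2_sum power_mult_distrib x_def y_def)
  also have "2 * (x * y) \<le> x\<^sup>2 + y\<^sup>2"
    using sum_squares_bound[of x y] by simp
  also have "x\<^sup>2 + y\<^sup>2 = p * (1 - p) + q * (1 - q)"
    using assms by (simp add: power_mult_distrib x_def y_def)
  finally have "(p - q)\<^sup>2 \<le> 1 - F\<^sup>2"
    by (simp add: power2_eq_square algebra_simps)
  then show ?thesis by (rule real_le_rsqrt)
qed

text \<open>The trace norm in the fidelity is a sum of overlaps of \<open>sqrt \<rho> u_k\<close>
  and \<open>sqrt \<rho>' v_k\<close> over singular vectors. Splitting the identity inside them as
  \<open>P + (1 - P)\<close> bounds this sum by the classical overlap of the outcome weights, which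
  reduces the claim to two outcomes.\<close>

lemma purified_distance_ge:
  assumes rho: "psd n \<rho>" "mtrace \<rho> = 1"
    and rho': "is_subnormalized n \<rho>'"
    and P: "psdf n P" "psdf n (\<lambda>i j. idf i j - P i j)"
  shows "trp n P (\<lambda>i j. \<rho> $$ (i,j)) - trp n P (\<lambda>i j. \<rho>' $$ (i,j)) \<le> purified_distance n \<rho> \<rho>'"
proof -
  have psd': "psd n \<rho>'" and tr': "Re (mtrace \<rho>') \<le> 1" using rho' by (auto simp: is_subnormalized_def)
  let ?Q = "\<lambda>i j. idf i j - P i j"
  let ?r = "\<lambda>i j. msqrt n \<rho> $$ (i,j)" let ?r' = "\<lambda>i j. msqrt n \<rho>' $$ (i,j)"
  let ?\<rho> = "\<lambda>i j. \<rho> $$ (i,j)" let ?\<rho>' = "\<lambda>i j. \<rho>' $$ (i,j)"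
  note S = msqrt[OF rho(1)] and S' = msqrt[OF psd']
  note C = psd_carrier[OF S(1)] and C' = psd_carrier[OF S'(1)]
  have psdf: "psdf n ?r" "psdf n ?r'" "psdf n ?\<rho>" "psdf n ?\<rho>'"
    using S S' rho psd' by (auto simp: psd_iff_psdf)
  note h = psdf_hermitian[OF psdf(1)] and h' = psdf_hermitian[OF psdf(2)]
  have sq: "?\<rho> i j = (\<Sum>m<n. ?r i m * ?r m j)" if "i < n" "j < n" for i j
    using mult_mat_index_sum[OF C C that] unfolding S(2) .
  have sq': "?\<rho>' i j = (\<Sum>m<n. ?r' i m * ?r' m j)" if "i < n" "j < n" for i j
    using mult_mat_index_sum[OF C' C' that] unfolding S'(2) .
  let ?A = "msqrt n \<rho> * msqrt n \<rho>'"
  have A: "?A \<in> carrier_mat n n" using C C' by (rule mult_carrier_mat)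
  have Aij: "?A $$ (i,j) = (\<Sum>m<n. ?r i m * ?r' m j)" if "i < n" "j < n" for i j
    by (rule mult_mat_index_sum[OF C C' that])
  obtain v s where v: "onb n v" and s: "\<And>k. k < n \<Longrightarrow> 0 \<le> s k" and F: "trace_norm ?A = (\<Sum>k<n. s k)"
    and Av: "\<And>k l. k < n \<Longrightarrow> l < n \<Longrightarrow> (\<Sum>i<n. cnj (\<Sum>j<n. ?A $$ (i,j) * v k j) * (\<Sum>j<n. ?A $$ (i,j) * v l j)) =
      (if k = l then complex_of_real ((s k)\<^sup>2) else 0)"
    using trace_norm_singular_values[OF A] by blast
  define w where "w k i = (\<Sum>j<n. ?A $$ (i,j) * v k j)" for k i
  \<comment> \<open>Left singular vectors. Division by zero yields zero, so \<open>u k\<close>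
    vanishes when \<open>s k = 0\<close>; the predicate \<open>Q\<close> of
    \<open>psdf_overlap_le\<close> is there for this case.\<close>
  define u where "u k i = w k i / of_real (s k)" for k i
  have u: "(\<Sum>i<n. cnj (u k i) * u l i) = (if k = l \<and> s k \<noteq> 0 then 1 else 0)" if "k < n" "l < n" for k l
  proof -
    have "(\<Sum>i<n. cnj (u k i) * u l i) = (\<Sum>i<n. cnj (w k i) * w l i) / (of_real (s k) * of_real (s l))"
      unfolding sum_divide_distrib by (intro sum.cong refl) (simp add: u_def)
    then show ?thesis unfolding w_def Av[OF that] by (auto simp: power2_eq_square)
  qed
  have v': "(\<Sum>i<n. cnj (v k i) * v l i) = (if k = l \<and> True then 1 else 0)" if "k < n" "l < n" for k l
    using onbD[OF v that] by simp
  let ?a = "\<lambda>k i. \<Sum>j<n. ?r i j * u k j" let ?b = "\<lambda>k i. \<Sum>j<n. ?r' i j * v k j"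
  \<comment> \<open>The singular value is the inner product of \<open>u k\<close> and
    \<open>w k\<close>, with the first root moved to the left argument. Writing it with
    \<open>idf\<close> gives the shape that is split into \<open>P\<close> and its complement
    below.\<close>
  have sk: "complex_of_real (s k) = (\<Sum>i<n. \<Sum>j<n. cnj (?a k i) * idf i j * ?b k j)" if k: "k < n" for k
  proof -
    have "(\<Sum>i<n. cnj (u k i) * w k i) = (\<Sum>i<n. cnj (w k i) * w k i) / of_real (s k)"
      unfolding sum_divide_distrib by (intro sum.cong refl) (simp add: u_def)
    also have "\<dots> = of_real (s k)" unfolding w_def Av[OF k k] by (simp add: power2_eq_square)
    finally have "complex_of_real (s k) = (\<Sum>i<n. cnj (u k i) * w k i)" by simp
    also have "\<dots> = (\<Sum>i<n. \<Sum>m<n. cnj (u k i) * (?r i m * ?b k m))"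
    proof (rule sum.cong[OF refl])
      fix i assume "i \<in> {..<n}"
      then have "w k i = (\<Sum>j<n. \<Sum>m<n. ?r i m * (?r' m j * v k j))"
        unfolding w_def by (intro sum.cong refl) (simp only: Aij lessThan_iff sum_distrib_right mult.assoc)
      also have "\<dots> = (\<Sum>m<n. ?r i m * ?b k m)"
        by (subst sum.swap) (simp only: sum_distrib_left)
      finally show "cnj (u k i) * w k i = (\<Sum>m<n. cnj (u k i) * (?r i m * ?b k m))"
        by (simp only: sum_distrib_left)
    qed
    also have "\<dots> = (\<Sum>m<n. \<Sum>i<n. cnj (?r m i * u k i) * ?b k m)"
      by (subst sum.swap, intro sum.cong refl) (simp only: lessThan_iff complex_cnj_mult h[symmetric] mult_ac)
    also have "\<dots> = (\<Sum>m<n. cnj (?a k m) * ?b k m)"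
      by (simp only: sum_distrib_right cnj_sum)
    also have "\<dots> = (\<Sum>i<n. \<Sum>j<n. cnj (?a k i) * idf i j * ?b k j)"
      by (intro sum.cong refl) (simp add: if_distrib[of "\<lambda>x. _ * x * _"] if_distrib[of "\<lambda>x. x * _"] cong: if_cong)
    finally show ?thesis .
  qed
  let ?T = "\<lambda>P. \<Sum>k<n. \<Sum>i<n. \<Sum>j<n. cnj (?a k i) * P i j * ?b k j"
  have "complex_of_real (trace_norm ?A) = ?T idf"
    unfolding F of_real_sum by (intro sum.cong refl) (simp only: sk lessThan_iff)
  also have "\<dots> = ?T P + ?T ?Q"
    unfolding sum.distrib[symmetric] by (intro sum.cong refl) (simp only: algebra_simps diff_add_cancel)
  finally have "cmod (complex_of_real (trace_norm ?A)) \<le> cmod (?T P) + cmod (?T ?Q)"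
    by (simp only: norm_triangle_ineq)
  also have "\<dots> \<le> sqrt (trp n P ?\<rho>) * sqrt (trp n P ?\<rho>') + sqrt (trp n ?Q ?\<rho>) * sqrt (trp n ?Q ?\<rho>')"
    by (intro add_mono psdf_overlap_le[OF P(1) u v' h h' sq sq'] psdf_overlap_le[OF P(2) u v' h h' sq sq'])
  finally have F1: "trace_norm ?A \<le> sqrt (trp n P ?\<rho>) * sqrt (trp n P ?\<rho>') + sqrt (trp n ?Q ?\<rho>) * sqrt (trp n ?Q ?\<rho>')"
    using trace_norm_nonneg[OF A] by simp
  have Q: "trp n ?Q (\<lambda>i j. M $$ (i,j)) = Re (mtrace M) - trp n P (\<lambda>i j. M $$ (i,j))" if "M \<in> carrier_mat n n" for M
    using that by (simp add: trp_diff_left trp_idf mtrace_def)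
  define p where "p = trp n P ?\<rho>" define q where "q = trp n P ?\<rho>'" define t where "t = Re (mtrace \<rho>')"
  have nn: "0 \<le> p" "0 \<le> q" "0 \<le> trp n ?Q ?\<rho>" "0 \<le> trp n ?Q ?\<rho>'"
    unfolding p_def q_def using trp_nonneg P psdf by blast+
  have Q1: "trp n ?Q ?\<rho> = 1 - p" "trp n ?Q ?\<rho>' = t - q"
    using Q[OF psd_carrier[OF rho(1)]] Q[OF psd_carrier[OF psd']] rho(2) by (simp_all add: p_def q_def t_def)
  have "trace_norm ?A \<le> sqrt p * sqrt q + sqrt (1 - p) * sqrt (t - q)"
    using F1 unfolding Q1 p_def[symmetric] q_def[symmetric] .
  \<comment> \<open>The second state may have trace \<open>t < 1\<close>; raising
    \<open>t - q\<close> to \<open>1 - q\<close> completes its outcome weights to a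
    distribution.\<close>
  also have "\<dots> \<le> sqrt p * sqrt q + sqrt (1 - p) * sqrt (1 - q)"
    using nn Q1 tr' t_def by (intro add_left_mono mult_left_mono) auto
  finally have "p - q \<le> sqrt (1 - (trace_norm ?A)\<^sup>2)"
    using nn Q1 tr' t_def trace_norm_nonneg[OF A] by (intro diff_le_sqrt_one_minus_overlap) auto
  \<comment> \<open>As \<open>\<rho>\<close> has trace one, the correction term of
    \<open>gen_fidelity\<close> is zero.\<close>
  then show ?thesis unfolding purified_distance_def gen_fidelity_def p_def q_def using rho(2) by simp
qed

section \<open>Hashing\<close>

lemma cmod_weighted_sum_power2:
  fixes z :: "'i \<Rightarrow> complex"
  shows "(cmod (\<Sum>x\<in>I. complex_of_real (w x) * z x))\<^sup>2 = (\<Sum>x\<in>I. \<Sum>y\<in>I. w x * w y * Re (z x * cnj (z y)))"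
proof -
  let ?s = "\<Sum>x\<in>I. complex_of_real (w x) * z x"
  have "complex_of_real ((cmod ?s)\<^sup>2) = (\<Sum>x\<in>I. \<Sum>y\<in>I. complex_of_real (w x * w y) * (z x * cnj (z y)))"
    unfolding cnj_mult_self(2)[symmetric] cnj_sum sum_product by (intro sum.cong refl) simp
  then have "Re (complex_of_real ((cmod ?s)\<^sup>2)) = Re (\<Sum>x\<in>I. \<Sum>y\<in>I. complex_of_real (w x * w y) * (z x * cnj (z y)))"
    by (rule arg_cong)
  then have "(cmod ?s)\<^sup>2 = Re (\<Sum>x\<in>I. \<Sum>y\<in>I. complex_of_real (w x * w y) * (z x * cnj (z y)))"
    unfolding Re_complex_of_real .
  also have "\<dots> = (\<Sum>x\<in>I. \<Sum>y\<in>I. w x * w y * Re (z x * cnj (z y)))"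
    unfolding Re_sum by (intro sum.cong refl) simp
  finally show ?thesis .
qed

text \<open>For a Hermitian matrix the squared Frobenius norm is the trace of its square. Expanding
  it into pairs \<open>x\<close>, \<open>y\<close> prepares the average over the hash
  family.\<close>

lemma sum_frobenius_weighted:
  assumes "\<And>x i j. x \<in> I \<Longrightarrow> i < n \<Longrightarrow> j < n \<Longrightarrow> A x i j = cnj (A x j i)"
  shows "(\<Sum>i<n. \<Sum>j<n. (cmod (\<Sum>x\<in>I. complex_of_real (w x) * A x j i))\<^sup>2) = (\<Sum>x\<in>I. \<Sum>y\<in>I. w x * w y * trp n (A x) (A y))"
proof -
  have "(\<Sum>i<n. \<Sum>j<n. (cmod (\<Sum>x\<in>I. complex_of_real (w x) * A x j i))\<^sup>2) =
    (\<Sum>i<n. \<Sum>j<n. \<Sum>x\<in>I. \<Sum>y\<in>I. w x * w y * Re (A x j i * A y i j))"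
    unfolding cmod_weighted_sum_power2
  proof (intro sum.cong refl)
    fix i j x y assume "i \<in> {..<n}" "j \<in> {..<n}" "x \<in> I" "y \<in> I"
    then have "cnj (A y j i) = A y i j" using assms[of y i j] by simp
    then show "w x * w y * Re (A x j i * cnj (A y j i)) = w x * w y * Re (A x j i * A y i j)"
      by (simp only:)
  qed
  also have "\<dots> = (\<Sum>i<n. \<Sum>x\<in>I. \<Sum>j<n. \<Sum>y\<in>I. w x * w y * Re (A x j i * A y i j))"
    by (rule sum.cong[OF refl], rule sum.swap)
  also have "\<dots> = (\<Sum>x\<in>I. \<Sum>i<n. \<Sum>j<n. \<Sum>y\<in>I. w x * w y * Re (A x j i * A y i j))"
    by (rule sum.swap)
  also have "\<dots> = (\<Sum>x\<in>I. \<Sum>i<n. \<Sum>y\<in>I. \<Sum>j<n. w x * w y * Re (A x j i * A y i j))"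
    by (rule sum.cong[OF refl], rule sum.cong[OF refl], rule sum.swap)
  also have "\<dots> = (\<Sum>x\<in>I. \<Sum>y\<in>I. \<Sum>i<n. \<Sum>j<n. w x * w y * Re (A x j i * A y i j))"
    by (rule sum.cong[OF refl], rule sum.swap)
  also have "\<dots> = (\<Sum>x\<in>I. \<Sum>y\<in>I. w x * w y * trp n (A x) (A y))"
  proof (intro sum.cong refl)
    fix x y
    have "(\<Sum>i<n. \<Sum>j<n. w x * w y * Re (A x j i * A y i j)) = w x * w y * trp n (A y) (A x)"
      unfolding trp_def Re_sum sum_distrib_left by (intro sum.cong refl) (simp only: mult.commute)
    then show "(\<Sum>i<n. \<Sum>j<n. w x * w y * Re (A x j i * A y i j)) = w x * w y * trp n (A x) (A y)"
      by (simp only: trp_commute[of n "A x" "A y"])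
  qed
  finally show ?thesis .
qed

text \<open>The bounds \<open>-1 \<le> U \<le> 1\<close> give \<open>tr (s (1 - U) s (1 + U)) \<ge> 0\<close> for \<open>s = diag (a\<^sup>2)\<close>; the cross terms cancel.\<close>

lemma sum_weighted_contraction_le:
  assumes U: "psdf n (\<lambda>i j. idf i j + U i j)" "psdf n (\<lambda>i j. idf i j - U i j)"
  shows "(\<Sum>i<n. \<Sum>j<n. (a i * a j * cmod (U i j))\<^sup>2) \<le> (\<Sum>i<n. (a i) ^ 4)"
proof -
  have herm: "U i j = cnj (U j i)" if "i < n" "j < n" for i j
  proof -
    have "idf i j + U i j = idf i j + cnj (U j i)"
      using psdf_hermitian[OF U(1) that] by (simp only: complex_cnj_add) auto
    then show ?thesis by (simp only: add_left_cancel)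
  qed
  have "0 \<le> trp n (\<lambda>i j. complex_of_real (a i * a j) * (idf i j - U i j)) (\<lambda>i j. complex_of_real (a i * a j) * (idf i j + U i j))"
    by (intro trp_nonneg psdf_scale U)
  also have "\<dots> = (\<Sum>i<n. \<Sum>j<n. (if i = j then (a i) ^ 4 else 0) - (a i * a j * cmod (U i j))\<^sup>2)"
    unfolding trp_def Re_sum
  proof (intro sum.cong refl)
    fix i j assume "i \<in> {..<n}" "j \<in> {..<n}"
    then have "U j i = cnj (U i j)" by (intro herm) auto
    then have "U i j * U j i = of_real ((cmod (U i j))\<^sup>2)" by (simp only: cnj_mult_self)
    moreover have "complex_of_real (a i * a j) * (idf i j - U i j) * (complex_of_real (a j * a i) * (idf j i + U j i)) =
       complex_of_real ((a i * a j)\<^sup>2) * ((if i = j then 1 else 0) - U i j * U j i)"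
      by (auto simp: power2_eq_square algebra_simps)
    ultimately have "complex_of_real (a i * a j) * (idf i j - U i j) * (complex_of_real (a j * a i) * (idf j i + U j i)) =
       complex_of_real ((a i * a j)\<^sup>2 * ((if i = j then 1 else 0) - (cmod (U i j))\<^sup>2))"
      by auto
    then show "Re (complex_of_real (a i * a j) * (idf i j - U i j) * (complex_of_real (a j * a i) * (idf j i + U j i))) =
      (if i = j then (a i) ^ 4 else 0) - (a i * a j * cmod (U i j))\<^sup>2"
      by (simp only: Re_complex_of_real) (auto simp: power_mult_distrib algebra_simps power2_eq_square power4_eq_xxxx)
  qed
  also have "\<dots> = (\<Sum>i<n. (a i) ^ 4) - (\<Sum>i<n. \<Sum>j<n. (a i * a j * cmod (U i j))\<^sup>2)"
    by (simp add: sum_subtractf)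
  finally show ?thesis by simp
qed

lemma two_universal_collisions:
  fixes F :: "('x::finite \<Rightarrow> 's::finite) set"
  assumes "two_universal F" "x \<noteq> y"
  shows "real (card {f \<in> F. f x = f y}) \<le> real (card F) / real CARD('s)"
proof -
  have "card F > 0" using assms by (simp add: two_universal_def card_gt_0_iff)
  moreover have "real (card {f \<in> F. f x = f y}) / real (card F) \<le> 1 / real CARD('s)"
    using assms by (simp add: two_universal_def)
  ultimately show ?thesis by (simp add: field_simps)
qed

text \<open>Summing over \<open>s\<close> first leaves the indicator of \<open>f x = f y\<close>
  minus \<open>1/|S|\<close>; summing over \<open>f\<close> turns it into the collision count minus
  \<open>|F|/|S|\<close>. Two-universality makes this nonpositive for \<open>x \<noteq> y\<close>,
  where \<open>G \<ge> 0\<close> lets the term be dropped, and on the diagonal it is at most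
  \<open>|F|\<close>.\<close>

lemma two_universal_weighted_sum:
  fixes F :: "('x::finite \<Rightarrow> 's::finite) set" and G :: "'x \<Rightarrow> 'x \<Rightarrow> real"
  defines "w \<equiv> \<lambda>f s x. (if f x = s then 1 else 0) - 1 / real CARD('s)"
  assumes F: "two_universal F" and G: "\<And>x y. 0 \<le> G x y"
  shows "(\<Sum>f\<in>F. \<Sum>s\<in>UNIV. \<Sum>x\<in>UNIV. \<Sum>y\<in>UNIV. w f s x * w f s y * G x y) \<le> real (card F) * (\<Sum>x\<in>UNIV. G x x)"
proof -
  let ?N = "real CARD('s)"
  have ww: "(\<Sum>s\<in>UNIV. w f s x * w f s y) = (if f x = f y then 1 else 0) - 1 / ?N" for f :: "'x \<Rightarrow> 's" and x y
  proof -
    have "(\<Sum>s\<in>UNIV. w f s x * w f s y) = (\<Sum>s\<in>UNIV. (if f x = s then (if f x = f y then 1 else 0) else 0)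
        - (if f x = s then 1 / ?N else 0) - (if f y = s then 1 / ?N else 0) + 1 / ?N * (1 / ?N))"
      by (intro sum.cong refl) (auto simp: w_def algebra_simps)
    also have "\<dots> = (if f x = f y then 1 else 0) - 1 / ?N - 1 / ?N + ?N * (1 / ?N * (1 / ?N))"
      by (simp only: sum.distrib sum_subtractf sum.delta' finite iso_tuple_UNIV_I if_True sum_constant)
    finally show ?thesis by simp
  qed
  have coll: "(\<Sum>f\<in>F. (if f x = f y then 1 else 0) - 1 / ?N) = real (card {f \<in> F. f x = f y}) - real (card F) / ?N" for x y
    by (simp add: sum_subtractf sum.If_cases Int_def)
  have "(\<Sum>f\<in>F. \<Sum>s\<in>UNIV. \<Sum>x\<in>UNIV. \<Sum>y\<in>UNIV. w f s x * w f s y * G x y) =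
      (\<Sum>f\<in>F. \<Sum>x\<in>UNIV. \<Sum>y\<in>UNIV. ((if f x = f y then 1 else 0) - 1 / ?N) * G x y)"
  proof (rule sum.cong[OF refl])
    fix f :: "'x \<Rightarrow> 's"
    have "(\<Sum>s\<in>UNIV. \<Sum>x\<in>UNIV. \<Sum>y\<in>UNIV. w f s x * w f s y * G x y) = (\<Sum>x\<in>UNIV. \<Sum>s\<in>UNIV. \<Sum>y\<in>UNIV. w f s x * w f s y * G x y)"
      by (rule sum.swap)
    also have "\<dots> = (\<Sum>x\<in>UNIV. \<Sum>y\<in>UNIV. \<Sum>s\<in>UNIV. w f s x * w f s y * G x y)"
      by (rule sum.cong[OF refl], rule sum.swap)
    finally show "(\<Sum>s\<in>UNIV. \<Sum>x\<in>UNIV. \<Sum>y\<in>UNIV. w f s x * w f s y * G x y) =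
        (\<Sum>x\<in>UNIV. \<Sum>y\<in>UNIV. ((if f x = f y then 1 else 0) - 1 / ?N) * G x y)"
      by (simp only: sum_distrib_right[symmetric] ww)
  qed
  also have "\<dots> = (\<Sum>x\<in>UNIV. \<Sum>f\<in>F. \<Sum>y\<in>UNIV. ((if f x = f y then 1 else 0) - 1 / ?N) * G x y)"
    by (rule sum.swap)
  also have "\<dots> = (\<Sum>x\<in>UNIV. \<Sum>y\<in>UNIV. \<Sum>f\<in>F. ((if f x = f y then 1 else 0) - 1 / ?N) * G x y)"
    by (rule sum.cong[OF refl], rule sum.swap)
  also have "\<dots> = (\<Sum>x\<in>UNIV. \<Sum>y\<in>UNIV. (real (card {f \<in> F. f x = f y}) - real (card F) / ?N) * G x y)"
    by (simp only: sum_distrib_right[symmetric] coll)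
  also have "\<dots> \<le> (\<Sum>x\<in>UNIV. \<Sum>y\<in>UNIV. if x = y then real (card F) * G x x else 0)"
  proof (intro sum_mono)
    fix x y
    show "(real (card {f \<in> F. f x = f y}) - real (card F) / ?N) * G x y \<le> (if x = y then real (card F) * G x x else 0)"
    proof (cases "x = y")
      case True
      have "real (card F) - real (card F) / ?N \<le> real (card F)" by simp
      then show ?thesis using True G by (simp add: mult_right_mono)
    next
      case False
      then show ?thesis using two_universal_collisions[OF F False] G[of x y] by (simp add: mult_nonpos_nonneg)
    qed
  qed
  also have "\<dots> = real (card F) * (\<Sum>x\<in>UNIV. G x x)"
    by (simp add: sum_distrib_left)
  finally show ?thesis .
qed

text \<open>The case of a diagonal reference state \<open>diag \<mu>\<close>. For each
  \<open>f\<close> and \<open>s\<close>, inserting the weights \<open>a i * a j\<close> and their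
  inverses lets Cauchy-Schwarz separate \<open>U f s\<close> from the rescaled operators
  \<open>T x\<close>. The factor with \<open>U\<close> is at most one, so only the other is averaged
  over the family.\<close>

lemma hashing_bound_diag:
  fixes F :: "('x::finite \<Rightarrow> 's::finite) set" and \<rho> :: "'x \<Rightarrow> nat \<Rightarrow> nat \<Rightarrow> complex"
    and U :: "('x \<Rightarrow> 's) \<Rightarrow> 's \<Rightarrow> nat \<Rightarrow> nat \<Rightarrow> complex"
  assumes F: "two_universal F"
    and rho: "\<And>x. psdf n (\<rho> x)" "\<And>x. psdf n (\<lambda>i j. (if i = j then complex_of_real (c * \<mu> i) else 0) - \<rho> x i j)"
    and \<mu>: "\<And>i. i < n \<Longrightarrow> 0 \<le> \<mu> i" "(\<Sum>i<n. \<mu> i) = 1" and c: "0 \<le> c"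
    and tr: "(\<Sum>x\<in>UNIV. trp n idf (\<rho> x)) \<le> 1"
    and U: "\<And>f s. psdf n (\<lambda>i j. idf i j + U f s i j)" "\<And>f s. psdf n (\<lambda>i j. idf i j - U f s i j)"
  shows "(\<Sum>f\<in>F. \<Sum>s\<in>UNIV. trp n (U f s) (\<lambda>i j. \<Sum>x\<in>UNIV. complex_of_real ((if f x = s then 1 else 0) - 1 / real CARD('s)) * \<rho> x i j))
    \<le> real (card F) * sqrt (real CARD('s) * c)"
proof -
  define w where "w f s x = (if f x = s then 1 else 0) - 1 / real CARD('s)" for f :: "'x \<Rightarrow> 's" and s x
  \<comment> \<open>A fourth root, so that the bound by the sum of \<open>(a i) ^ 4\<close> in
    \<open>sum_weighted_contraction_le\<close> is the trace of the reference state, which is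
    one.\<close>
  define a where "a i = sqrt (sqrt (\<mu> i))" for i
  \<comment> \<open>This is \<open>\<sigma> powr (-1/4) \<rho>_x \<sigma> powr (-1/4)\<close>. As
    \<open>inverse 0 = 0\<close>, it vanishes outside the support of \<open>\<sigma>\<close>;
    \<open>aT\<close> shows that nothing is lost, because the order relation confines
    \<open>\<rho> x\<close> to that support.\<close>
  define T where "T x i j = complex_of_real (inverse (a i) * inverse (a j)) * \<rho> x i j" for x i j
  have a4: "(a i) ^ 4 = \<mu> i" if "i < n" for i
    using \<mu>(1)[OF that] by (simp add: a_def power4_eq_xxxx mult.assoc)
  have a4s: "(\<Sum>i<n. (a i) ^ 4) = 1" using \<mu>(2) a4 by simp
  have T: "psdf n (T x)" for x unfolding T_def by (rule psdf_scale[OF rho(1)])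
  have diag0: "\<rho> x i i = 0" if i: "i < n" and "\<mu> i = 0" for x i
  proof -
    have "Re (\<rho> x i i) \<le> 0" using psdf_diag(2)[OF rho(2) i] that by simp
    then show ?thesis using psdf_diag[OF rho(1) i, of x] by (simp add: complex_eq_iff)
  qed
  have a0: "a i = 0 \<longleftrightarrow> \<mu> i = 0" if "i < n" for i using \<mu>(1)[OF that] by (simp add: a_def)
  have aT: "complex_of_real (a i * a j) * T x i j = \<rho> x i j" if "i < n" "j < n" for x i j
  proof (cases "a i = 0 \<or> a j = 0")
    case True
    then have "\<rho> x i j = 0"
      using psdf_zero_diag[OF rho(1) that diag0[OF that(1)]] psdf_zero_diag[OF rho(1) that(2,1) diag0[OF that(2)]] a0 that by blast
    then show ?thesis by (simp add: T_def)
  qed (simp add: T_def field_simps)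
  \<comment> \<open>Rescaling \<open>c \<sigma> - \<rho>_x\<close> keeps it positive semidefinite.
    Pairing the result with \<open>T x\<close> gives
    \<open>tr (T T) \<le> c tr (T \<sigma> powr (1/2))\<close>, and the right side is
    \<open>c tr \<rho>_x\<close>.\<close>
  have Gc: "trp n (T x) (T x) \<le> c * trp n idf (\<rho> x)" for x
  proof -
    let ?D = "\<lambda>i j. complex_of_real (inverse (a i) * inverse (a j)) * ((if i = j then complex_of_real (c * \<mu> i) else 0) - \<rho> x i j)"
    have "0 \<le> trp n (T x) ?D" by (intro trp_nonneg T psdf_scale rho)
    also have "?D = (\<lambda>i j. (if i = j then complex_of_real (c * \<mu> i * (inverse (a i))\<^sup>2) else 0) - T x i j)"
      by (intro ext) (auto simp: T_def power2_eq_square algebra_simps)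
    also have "trp n (T x) \<dots> = trp n (T x) (\<lambda>i j. if i = j then complex_of_real (c * \<mu> i * (inverse (a i))\<^sup>2) else 0) - trp n (T x) (T x)"
      by (rule trp_diff_right)
    also have "trp n (T x) (\<lambda>i j. if i = j then complex_of_real (c * \<mu> i * (inverse (a i))\<^sup>2) else 0) = c * trp n idf (\<rho> x)"
    proof -
      have "(\<Sum>i<n. \<Sum>j<n. T x i j * (if j = i then complex_of_real (c * \<mu> j * (inverse (a j))\<^sup>2) else 0)) =
          (\<Sum>i<n. \<Sum>j<n. if j = i then T x i i * complex_of_real (c * \<mu> i * (inverse (a i))\<^sup>2) else 0)"
        by (intro sum.cong refl) simp
      also have "\<dots> = (\<Sum>i<n. T x i i * complex_of_real (c * \<mu> i * (inverse (a i))\<^sup>2))"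
        by (rule sum.cong[OF refl]) (simp only: sum.delta finite_lessThan if_True)
      also have "\<dots> = (\<Sum>i<n. of_real c * \<rho> x i i)"
      proof (rule sum.cong[OF refl])
        fix i assume "i \<in> {..<n}"
        then have i: "i < n" by simp
        show "T x i i * complex_of_real (c * \<mu> i * (inverse (a i))\<^sup>2) = of_real c * \<rho> x i i"
        proof (cases "\<mu> i = 0")
          case True
          then show ?thesis using diag0[OF i] by simp
        next
          case False
          then have "inverse (a i) * inverse (a i) * (c * \<mu> i * (inverse (a i))\<^sup>2) = c"
            using a4[OF i] a0[OF i] by (simp add: field_simps power2_eq_square power4_eq_xxxx)
          then have "complex_of_real (inverse (a i) * inverse (a i)) * complex_of_real (c * \<mu> i * (inverse (a i))\<^sup>2) = of_real c"
            by (simp only: of_real_mult[symmetric])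
          then show ?thesis unfolding T_def by (metis mult.assoc mult.commute)
        qed
      qed
      finally show ?thesis unfolding trp_def trp_idf[unfolded trp_def]
        by (simp only: sum_distrib_left[symmetric]) simp
    qed
    finally show ?thesis by simp
  qed
  define b where "b f s = (\<Sum>i<n. \<Sum>j<n. (cmod (\<Sum>x\<in>UNIV. complex_of_real (w f s x) * T x j i))\<^sup>2)" for f s
  have b0: "0 \<le> b f s" for f s unfolding b_def by (simp add: sum_nonneg)
  have "trp n (U f s) (\<lambda>i j. \<Sum>x\<in>UNIV. complex_of_real (w f s x) * \<rho> x i j) \<le> sqrt (b f s)" for f s
  proof -
    let ?TB = "\<lambda>i j. \<Sum>x\<in>UNIV. complex_of_real (w f s x) * T x i j"
    have "trp n (U f s) (\<lambda>i j. \<Sum>x\<in>UNIV. complex_of_real (w f s x) * \<rho> x i j) =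
        Re (\<Sum>i<n. \<Sum>j<n. (complex_of_real (a i * a j) * U f s i j) * ?TB j i)"
      unfolding trp_def
    proof (intro arg_cong[where f = Re] sum.cong refl)
      fix i j assume "i \<in> {..<n}" "j \<in> {..<n}"
      then have ij: "i < n" "j < n" by auto
      have "(\<Sum>x\<in>UNIV. complex_of_real (w f s x) * \<rho> x j i) = (\<Sum>x\<in>UNIV. complex_of_real (a i * a j) * (complex_of_real (w f s x) * T x j i))"
        unfolding aT[OF ij(2,1), symmetric] by (intro sum.cong refl) (simp add: mult_ac)
      then show "U f s i j * (\<Sum>x\<in>UNIV. complex_of_real (w f s x) * \<rho> x j i) = complex_of_real (a i * a j) * U f s i j * ?TB j i"
        unfolding sum_distrib_left[symmetric] by (simp only: mult_ac)
    qed
    also have "\<dots> \<le> cmod (\<Sum>(i,j)\<in>{..<n}\<times>{..<n}. (complex_of_real (a i * a j) * U f s i j) * ?TB j i)"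
      unfolding sum.cartesian_product by (rule complex_Re_le_cmod)
    also have "\<dots> \<le> sqrt (\<Sum>(i,j)\<in>{..<n}\<times>{..<n}. (cmod (complex_of_real (a i * a j) * U f s i j))\<^sup>2) * sqrt (\<Sum>(i,j)\<in>{..<n}\<times>{..<n}. (cmod (?TB j i))\<^sup>2)"
      using cauchy_schwarz_sum[of "\<lambda>(i,j). complex_of_real (a i * a j) * U f s i j" "\<lambda>(i,j). ?TB j i" "{..<n}\<times>{..<n}"]
      by (simp only: case_prod_unfold)
    also have "\<dots> = sqrt (\<Sum>i<n. \<Sum>j<n. (a i * a j * cmod (U f s i j))\<^sup>2) * sqrt (b f s)"
      unfolding b_def sum.cartesian_product by (simp add: norm_mult power_mult_distrib abs_mult)
    also have "\<dots> \<le> 1 * sqrt (b f s)"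
      using sum_weighted_contraction_le[OF U, of a f s] a4s b0[of f s]
      by (intro mult_right_mono) auto
    finally show ?thesis by simp
  qed
  then have "(\<Sum>f\<in>F. \<Sum>s\<in>UNIV. trp n (U f s) (\<lambda>i j. \<Sum>x\<in>UNIV. complex_of_real (w f s x) * \<rho> x i j)) \<le> (\<Sum>f\<in>F. \<Sum>s\<in>UNIV. sqrt (b f s))"
    by (intro sum_mono)
  \<comment> \<open>A second Cauchy-Schwarz, over all pairs of \<open>f\<close> and
    \<open>s\<close>, moves the sum under the root. The number \<open>|F| |S|\<close> of pairs is
    the source of the factor \<open>|S|\<close> under the root in the bound.\<close>
  also have "\<dots> = (\<Sum>p\<in>F\<times>UNIV. \<bar>1\<bar> * \<bar>sqrt (case_prod b p)\<bar>)"
    using b0 by (simp add: sum.cartesian_product case_prod_unfold)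
  also have "\<dots> \<le> L2_set (\<lambda>p. 1) (F\<times>(UNIV :: 's set)) * L2_set (\<lambda>p. sqrt (case_prod b p)) (F\<times>UNIV)"
    by (rule L2_set_mult_ineq)
  also have "\<dots> = sqrt (real (card F) * real CARD('s)) * sqrt (\<Sum>f\<in>F. \<Sum>s\<in>UNIV. b f s)"
    unfolding L2_set_def using b0 by (simp add: sum.cartesian_product case_prod_unfold card_cartesian_product)
  also have "\<dots> \<le> sqrt (real (card F) * real CARD('s)) * sqrt (real (card F) * c)"
  proof (intro mult_left_mono real_sqrt_le_mono)
    have "(\<Sum>f\<in>F. \<Sum>s\<in>UNIV. b f s) = (\<Sum>f\<in>F. \<Sum>s\<in>UNIV. \<Sum>x\<in>UNIV. \<Sum>y\<in>UNIV. w f s x * w f s y * trp n (T x) (T y))"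
      unfolding b_def by (intro sum.cong refl sum_frobenius_weighted psdf_hermitian[OF T])
    also have "\<dots> \<le> real (card F) * (\<Sum>x\<in>UNIV. trp n (T x) (T x))"
      unfolding w_def by (rule two_universal_weighted_sum[OF F]) (intro trp_nonneg T)
    also have "\<dots> \<le> real (card F) * (\<Sum>x\<in>UNIV. c * trp n idf (\<rho> x))"
      by (intro mult_left_mono sum_mono Gc) simp
    also have "\<dots> \<le> real (card F) * c"
      unfolding sum_distrib_left[symmetric] using tr c by (intro mult_left_mono) (auto intro: mult_left_le)
    finally show "(\<Sum>f\<in>F. \<Sum>s\<in>UNIV. b f s) \<le> real (card F) * c" .
  qed simp
  also have "\<dots> = real (card F) * sqrt (real CARD('s) * c)"
    by (simp add: real_sqrt_mult mult_ac)
  finally show ?thesis unfolding w_def .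
qed

section \<open>Change of basis \<open>adj U * A * U\<close> to an eigenbasis of the reference
  state\<close>

definition rot :: "nat \<Rightarrow> (nat \<Rightarrow> nat \<Rightarrow> complex) \<Rightarrow> (nat \<Rightarrow> nat \<Rightarrow> complex) \<Rightarrow> nat \<Rightarrow> nat \<Rightarrow> complex" where
  "rot n u A k l = (\<Sum>i<n. \<Sum>j<n. cnj (u k i) * A i j * u l j)"

lemma psdf_rot:
  assumes "psdf n A"
  shows "psdf n (rot n u A)"
proof -
  obtain R where R: "\<And>i j. i < n \<Longrightarrow> j < n \<Longrightarrow> A i j = (\<Sum>m<n. cnj (R m i) * R m j)"
    using psdf_gram[OF assms] by blast
  show ?thesis
  proof (rule psdf_gramI[where I = "{..<n}" and R = "\<lambda>m k. \<Sum>i<n. R m i * u k i"])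
    fix k l
    have "rot n u A k l = (\<Sum>i<n. \<Sum>j<n. \<Sum>m<n. cnj (R m i * u k i) * (R m j * u l j))"
      unfolding rot_def by (intro sum.cong refl)
        (simp only: R lessThan_iff sum_distrib_left sum_distrib_right complex_cnj_mult mult_ac)
    also have "\<dots> = (\<Sum>i<n. \<Sum>m<n. \<Sum>j<n. cnj (R m i * u k i) * (R m j * u l j))"
      by (rule sum.cong[OF refl], rule sum.swap)
    also have "\<dots> = (\<Sum>m<n. \<Sum>i<n. \<Sum>j<n. cnj (R m i * u k i) * (R m j * u l j))"
      by (rule sum.swap)
    finally show "rot n u A k l = (\<Sum>m<n. cnj (\<Sum>i<n. R m i * u k i) * (\<Sum>i<n. R m i * u l i))"
      unfolding cnj_sum sum_product .
  qed
qed

text \<open>The completeness relation of \<open>u\<close>, inserted between \<open>f\<close> and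
  \<open>g\<close>. Applied twice, it shows that \<open>rot\<close> preserves traces of
  products.\<close>

lemma onb_parseval:
  assumes "onb n u"
  shows "(\<Sum>l<n. (\<Sum>j<n. f j * u l j) * (\<Sum>i<n. cnj (u l i) * g i)) = (\<Sum>j<n. f j * g j)"
proof -
  have "(\<Sum>l<n. (\<Sum>j<n. f j * u l j) * (\<Sum>i<n. cnj (u l i) * g i)) = (\<Sum>l<n. \<Sum>j<n. \<Sum>i<n. f j * g i * (u l j * cnj (u l i)))"
    unfolding sum_product by (intro sum.cong refl) (simp only: mult_ac)
  also have "\<dots> = (\<Sum>j<n. \<Sum>l<n. \<Sum>i<n. f j * g i * (u l j * cnj (u l i)))"
    by (rule sum.swap)
  also have "\<dots> = (\<Sum>j<n. \<Sum>i<n. \<Sum>l<n. f j * g i * (u l j * cnj (u l i)))"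
    by (rule sum.cong[OF refl], rule sum.swap)
  also have "\<dots> = (\<Sum>j<n. \<Sum>i<n. if i = j then f j * g j else 0)"
  proof (intro sum.cong refl)
    fix j i assume "j \<in> {..<n}" "i \<in> {..<n}"
    then have "(\<Sum>l<n. u l j * cnj (u l i)) = (if j = i then 1 else 0)"
      by (intro onb_complete[OF assms]) auto
    then show "(\<Sum>l<n. f j * g i * (u l j * cnj (u l i))) = (if i = j then f j * g j else 0)"
      unfolding sum_distrib_left[symmetric] by auto
  qed
  also have "\<dots> = (\<Sum>j<n. f j * g j)"
    by (rule sum.cong[OF refl]) (simp add: sum.delta)
  finally show ?thesis .
qed

lemma trp_rot:
  assumes u: "onb n u"
  shows "trp n (rot n u A) (rot n u B) = trp n A B"
proof -
  have "(\<Sum>k<n. \<Sum>l<n. rot n u A k l * rot n u B l k) = (\<Sum>k<n. \<Sum>j<n. (\<Sum>i<n. cnj (u k i) * A i j) * (\<Sum>b<n. B j b * u k b))"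
  proof (rule sum.cong[OF refl])
    fix k
    have "rot n u A k l = (\<Sum>j<n. (\<Sum>i<n. cnj (u k i) * A i j) * u l j)" for l
      unfolding rot_def sum_distrib_right by (rule sum.swap)
    moreover have "rot n u B l k = (\<Sum>i<n. cnj (u l i) * (\<Sum>b<n. B i b * u k b))" for l
      unfolding rot_def sum_distrib_left by (simp only: mult.assoc)
    ultimately show "(\<Sum>l<n. rot n u A k l * rot n u B l k) = (\<Sum>j<n. (\<Sum>i<n. cnj (u k i) * A i j) * (\<Sum>b<n. B j b * u k b))"
      by (simp only: onb_parseval[OF u])
  qed
  also have "\<dots> = (\<Sum>j<n. \<Sum>k<n. (\<Sum>i<n. cnj (u k i) * A i j) * (\<Sum>b<n. B j b * u k b))"
    by (rule sum.swap)
  also have "\<dots> = (\<Sum>j<n. \<Sum>i<n. A i j * B j i)"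
  proof (rule sum.cong[OF refl])
    fix j
    show "(\<Sum>k<n. (\<Sum>i<n. cnj (u k i) * A i j) * (\<Sum>b<n. B j b * u k b)) = (\<Sum>i<n. A i j * B j i)"
      using onb_parseval[OF u, of "\<lambda>b. B j b" "\<lambda>i. A i j"] by (simp only: mult.commute)
  qed
  also have "\<dots> = (\<Sum>i<n. \<Sum>j<n. A i j * B j i)" by (rule sum.swap)
  finally show ?thesis unfolding trp_def by (simp only:)
qed

lemma rot_cong:
  assumes "\<And>i j. i < n \<Longrightarrow> j < n \<Longrightarrow> A i j = B i j"
  shows "rot n u A k l = rot n u B k l"
  unfolding rot_def using assms by (intro sum.cong refl) simp

lemma rot_sp:
  assumes u: "onb n u" and kl: "k < n" "l < n"
  shows "rot n u (sp n a u) k l = (if k = l then a k else 0)"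
proof -
  have "rot n u (sp n a u) k l = (\<Sum>i<n. cnj (u k i) * (\<Sum>j<n. sp n a u i j * u l j))"
    unfolding rot_def by (simp only: sum_distrib_left mult.assoc)
  also have "\<dots> = a l * (\<Sum>i<n. cnj (u k i) * u l i)"
    unfolding sp_apply[OF u kl(2)] by (simp only: sum_distrib_left mult.left_commute)
  finally show ?thesis unfolding onbD[OF u kl] by simp
qed

lemma rot_idf:
  assumes u: "onb n u" and kl: "k < n" "l < n"
  shows "rot n u idf k l = idf k l"
proof -
  have "rot n u idf k l = rot n u (sp n (\<lambda>k. 1) u) k l"
    by (rule rot_cong) (simp add: sp_one[OF u])
  then show ?thesis using rot_sp[OF u kl] by simp
qed

lemma rot_add: "rot n u (\<lambda>i j. A i j + B i j) k l = rot n u A k l + rot n u B k l"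
  unfolding rot_def by (simp add: algebra_simps sum.distrib)

lemma rot_diff: "rot n u (\<lambda>i j. A i j - B i j) k l = rot n u A k l - rot n u B k l"
  unfolding rot_def by (simp add: algebra_simps sum_subtractf)

lemma rot_scale: "rot n u (\<lambda>i j. c * A i j) k l = c * rot n u A k l"
  unfolding rot_def by (simp only: sum_distrib_left mult_ac)

lemma rot_sum: "finite I \<Longrightarrow> rot n u (\<lambda>i j. \<Sum>x\<in>I. A x i j) k l = (\<Sum>x\<in>I. rot n u (A x) k l)"
proof (induction I rule: finite_induct)
  case empty
  then show ?case by (simp add: rot_def)
next
  case (insert x I)
  then show ?case by (simp add: rot_add)
qed

text \<open>In an eigenbasis of \<open>\<sigma>\<close> this is \<open>hashing_bound_diag\<close>:
  positivity, the identity and the trace pairing are all invariant under the unitary change of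
  basis.\<close>

lemma hashing_bound:
  fixes F :: "('x::finite \<Rightarrow> 's::finite) set" and \<rho> :: "'x \<Rightarrow> nat \<Rightarrow> nat \<Rightarrow> complex"
    and U :: "('x \<Rightarrow> 's) \<Rightarrow> 's \<Rightarrow> nat \<Rightarrow> nat \<Rightarrow> complex"
  assumes F: "two_universal F"
    and rho: "\<And>x. psdf n (\<rho> x)" "\<And>x. psdf n (\<lambda>i j. complex_of_real c * \<sigma> i j - \<rho> x i j)"
    and sigma: "psdf n \<sigma>" "trp n idf \<sigma> = 1" and c: "0 \<le> c"
    and tr: "(\<Sum>x\<in>UNIV. trp n idf (\<rho> x)) \<le> 1"
    and U: "\<And>f s. psdf n (\<lambda>i j. idf i j + U f s i j)" "\<And>f s. psdf n (\<lambda>i j. idf i j - U f s i j)"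
  shows "(\<Sum>f\<in>F. \<Sum>s\<in>UNIV. trp n (U f s) (\<lambda>i j. \<Sum>x\<in>UNIV. complex_of_real ((if f x = s then 1 else 0) - 1 / real CARD('s)) * \<rho> x i j))
    \<le> real (card F) * sqrt (real CARD('s) * c)"
proof -
  obtain u \<mu> where u: "onb n u" and \<mu>: "\<And>k. k < n \<Longrightarrow> 0 \<le> \<mu> k"
    and sig: "\<And>i j. i < n \<Longrightarrow> j < n \<Longrightarrow> \<sigma> i j = sp n (\<lambda>k. complex_of_real (\<mu> k)) u i j"
    using psdf_eigenbasis[OF sigma(1)] by blast
  let ?r = "rot n u"
  have rs: "?r \<sigma> k l = (if k = l then complex_of_real (\<mu> k) else 0)" if "k < n" "l < n" for k l
    using rot_sp[OF u that] rot_cong[of n \<sigma> "sp n (\<lambda>k. complex_of_real (\<mu> k)) u" u k l] sig by simp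
  have trace: "trp n idf (?r A) = trp n idf A" for A
    unfolding trp_rot[OF u, symmetric, of idf A] by (rule trp_cong) (simp_all add: rot_idf[OF u])
  have \<mu>1: "(\<Sum>i<n. \<mu> i) = 1"
    using trace[of \<sigma>] sigma(2) unfolding trp_idf Re_sum by (simp add: rs)
  have "(\<Sum>f\<in>F. \<Sum>s\<in>UNIV. trp n (?r (U f s)) (\<lambda>i j. \<Sum>x\<in>UNIV. complex_of_real ((if f x = s then 1 else 0) - 1 / real CARD('s)) * ?r (\<rho> x) i j))
    \<le> real (card F) * sqrt (real CARD('s) * c)"
  proof (rule hashing_bound_diag[OF F _ _ \<mu> \<mu>1 c])
    fix x
    show "psdf n (?r (\<rho> x))" by (rule psdf_rot[OF rho(1)])
    have "psdf n (?r (\<lambda>i j. complex_of_real c * \<sigma> i j - \<rho> x i j))" by (rule psdf_rot[OF rho(2)])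
    then show "psdf n (\<lambda>i j. (if i = j then complex_of_real (c * \<mu> i) else 0) - ?r (\<rho> x) i j)"
      by (rule iffD1[OF psdf_cong, rotated]) (auto simp: rot_diff rot_scale rs)
  next
    fix f s
    have "psdf n (?r (\<lambda>i j. idf i j + U f s i j))" by (rule psdf_rot[OF U(1)])
    then show "psdf n (\<lambda>i j. idf i j + ?r (U f s) i j)"
      by (rule iffD1[OF psdf_cong, rotated]) (simp only: rot_add rot_idf[OF u])
    have "psdf n (?r (\<lambda>i j. idf i j - U f s i j))" by (rule psdf_rot[OF U(2)])
    then show "psdf n (\<lambda>i j. idf i j - ?r (U f s) i j)"
      by (rule iffD1[OF psdf_cong, rotated]) (simp only: rot_diff rot_idf[OF u])
  next
    show "(\<Sum>x\<in>UNIV. trp n idf (?r (\<rho> x))) \<le> 1" unfolding trace by (rule tr)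
  qed
  also have "(\<Sum>f\<in>F. \<Sum>s\<in>UNIV. trp n (?r (U f s)) (\<lambda>i j. \<Sum>x\<in>UNIV. complex_of_real ((if f x = s then 1 else 0) - 1 / real CARD('s)) * ?r (\<rho> x) i j)) =
    (\<Sum>f\<in>F. \<Sum>s\<in>UNIV. trp n (?r (U f s)) (?r (\<lambda>i j. \<Sum>x\<in>UNIV. complex_of_real ((if f x = s then 1 else 0) - 1 / real CARD('s)) * \<rho> x i j)))"
    by (intro sum.cong refl trp_cong) (simp_all only: rot_sum[OF finite] rot_scale)
  finally show ?thesis unfolding trp_rot[OF u] .
qed

section \<open>Block structure of classical-quantum states\<close>

lemma bij_betw_basis_idx: "bij_betw (basis_idx :: 'a::finite \<Rightarrow> nat) UNIV {0..<CARD('a)}"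
  unfolding basis_idx_def
  by (rule someI_ex[of "\<lambda>g. bij_betw g UNIV {0..<CARD('a)}"]) (rule ex_bij_betw_finite_nat[OF finite])

text \<open>The position of \<open>|x> \<otimes> |i>\<close> in the index convention of
  \<open>kron\<close>. Of \<open>basis_idx\<close>, an arbitrary choice, only bijectivity is known,
  so block arguments are phrased through \<open>ix\<close>.\<close>

definition ix :: "nat \<Rightarrow> 'a::finite \<Rightarrow> nat \<Rightarrow> nat" where
  "ix d x i = basis_idx x * d + i"

lemma basis_idx_less: "basis_idx (x :: 'a::finite) < CARD('a)"
  using bij_betw_apply[OF bij_betw_basis_idx, of x] by simp

lemma basis_idx_eq_iff [simp]: "basis_idx x = basis_idx y \<longleftrightarrow> x = (y :: 'a::finite)"
  using bij_betw_imp_inj_on[OF bij_betw_basis_idx[where 'a = 'a]] by (simp add: inj_eq)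

lemma ix_less:
  assumes "i < d"
  shows "ix d (x :: 'a::finite) i < CARD('a) * d"
proof -
  have "ix d x i < (basis_idx x + 1) * d" using assms by (simp add: ix_def)
  also have "\<dots> \<le> CARD('a) * d" using basis_idx_less[of x] by (intro mult_le_mono1) simp
  finally show ?thesis .
qed

lemma ix_div [simp]: "i < d \<Longrightarrow> ix d x i div d = basis_idx x"
  and ix_mod [simp]: "i < d \<Longrightarrow> ix d x i mod d = i"
  by (simp_all add: ix_def)

lemma ix_eq_iff: "i < d \<Longrightarrow> j < d \<Longrightarrow> ix d x i = ix d y j \<longleftrightarrow> x = y \<and> i = j"
  by (metis basis_idx_eq_iff ix_div ix_mod)

lemma ix_cases:
  assumes "k < CARD('a::finite) * d"
  obtains x :: "'a::finite" and i where "i < d" "k = ix d x i"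
proof -
  have d: "0 < d" using assms by (cases d) auto
  have "k div d \<in> {0..<CARD('a)}" using assms by (simp add: less_mult_imp_div_less)
  then obtain x :: 'a where "k div d = basis_idx x"
    using bij_betw_imp_surj_on[OF bij_betw_basis_idx[where 'a = 'a]] by (metis imageE)
  then have "k = ix d x (k mod d)" unfolding ix_def by (metis div_mult_mod_eq)
  then show thesis using that d by (meson mod_less_divisor)
qed

lemma sum_ix: "(\<Sum>k<CARD('a::finite) * d. g k) = (\<Sum>x\<in>(UNIV :: 'a set). \<Sum>i<d. g (ix d x i))"
proof -
  have "(\<Sum>k<CARD('a) * d. g k) = (\<Sum>m<CARD('a). sum g {m * d..<m * d + d})"
    by (rule sum.nat_group[symmetric])
  also have "\<dots> = (\<Sum>m<CARD('a). \<Sum>i<d. g (m * d + i))"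
  proof (rule sum.cong[OF refl])
    fix m
    show "sum g {m * d..<m * d + d} = (\<Sum>i<d. g (m * d + i))"
      using sum.shift_bounds_nat_ivl[of g 0 "m * d" d] by (simp add: atLeast0LessThan add.commute)
  qed
  also have "\<dots> = (\<Sum>x\<in>(UNIV :: 'a set). \<Sum>i<d. g (basis_idx x * d + i))"
    unfolding atLeast0LessThan[symmetric] by (rule sum.reindex_bij_betw[OF bij_betw_basis_idx, symmetric])
  finally show ?thesis by (simp add: ix_def)
qed

lemma cq_state_index:
  fixes A :: "'a::finite \<Rightarrow> complex mat"
  assumes "i < d" "j < d" and A: "\<And>x. A x \<in> carrier_mat d d"
  shows "cq_state d A $$ (ix d x i, ix d y j) = (if x = y then A x $$ (i,j) else 0)"
proof -
  have "kron (proj_cls z) (A z) $$ (ix d x i, ix d y j) = (if z = x then (if x = y then A x $$ (i,j) else 0) else 0)" for z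
    using assms(1,2) A[of z] ix_less[OF assms(1), of x] ix_less[OF assms(2), of y]
    by (auto simp: kron_def proj_cls_def basis_idx_less)
  then show ?thesis
    using ix_less[OF assms(1), of x] ix_less[OF assms(2), of y] by (simp add: cq_state_def msum_def)
qed

lemma kron_one_index:
  fixes x y :: "'a::finite"
  assumes "i < d" "j < d" "\<sigma> \<in> carrier_mat d d"
  shows "kron (c \<cdot>\<^sub>m 1\<^sub>m CARD('a)) \<sigma> $$ (ix d x i, ix d y j) = (if x = y then c * \<sigma> $$ (i,j) else 0)"
  using assms ix_less[OF assms(1), of x] ix_less[OF assms(2), of y]
  by (auto simp: kron_def basis_idx_less)

lemma kron_one_carrier: "\<sigma> \<in> carrier_mat d d \<Longrightarrow> kron (c \<cdot>\<^sub>m 1\<^sub>m N) \<sigma> \<in> carrier_mat (N * d) (N * d)"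
  by (simp add: kron_def)

text \<open>Keeping only the columns of block \<open>x\<close> in a Gram factor of the whole gives a
  Gram factor of the block.\<close>

lemma psdf_block:
  fixes x :: "'a::finite"
  assumes "psdf (CARD('a) * d) M"
  shows "psdf d (\<lambda>i j. M (ix d x i) (ix d x j))"
proof -
  let ?N = "CARD('a) * d"
  obtain R where R: "\<And>i j. i < ?N \<Longrightarrow> j < ?N \<Longrightarrow> M i j = (\<Sum>m<?N. cnj (R m i) * R m j)"
    using psdf_gram[OF assms] by blast
  show ?thesis
    by (rule psdf_gramI[where I = "{..<?N}" and R = "\<lambda>m i. R m (ix d x i)"]) (rule R; rule ix_less)
qed

text \<open>The block-diagonal matrix with blocks \<open>P x\<close>. At most one summand is
  nonzero; the sum merely looks up the \<open>x\<close> with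
  \<open>basis_idx x = k div d\<close>.\<close>

definition bdiag :: "nat \<Rightarrow> ('a::finite \<Rightarrow> nat \<Rightarrow> nat \<Rightarrow> complex) \<Rightarrow> nat \<Rightarrow> nat \<Rightarrow> complex" where
  "bdiag d P k l = (\<Sum>x\<in>UNIV. if k div d = basis_idx x \<and> l div d = basis_idx x then P x (k mod d) (l mod d) else 0)"

lemma bdiag_index:
  assumes "i < d" "j < d"
  shows "bdiag d P (ix d x i) (ix d y j) = (if x = y then P x i j else 0)"
proof -
  have "bdiag d P (ix d x i) (ix d y j) = (\<Sum>z\<in>UNIV. if z = x then (if x = y then P x i j else 0) else 0)"
    unfolding bdiag_def using assms by (intro sum.cong refl) auto
  then show ?thesis by simp
qed

lemma psdf_block_diagonal:
  fixes P :: "'a::finite \<Rightarrow> nat \<Rightarrow> nat \<Rightarrow> complex"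
  assumes P: "\<And>x. psdf d (P x)"
    and M: "\<And>x y i j. i < d \<Longrightarrow> j < d \<Longrightarrow> M (ix d x i) (ix d y j) = (if x = y then P x i j else 0)"
  shows "psdf (CARD('a) * d) M"
proof -
  have "qf (CARD('a) * d) M v = (\<Sum>x\<in>UNIV. qf d (P x) (\<lambda>i. v (ix d x i)))" for v
  proof -
    have "qf (CARD('a) * d) M v = (\<Sum>x\<in>(UNIV :: 'a set). \<Sum>i<d. \<Sum>y\<in>(UNIV :: 'a set). \<Sum>j<d. cnj (v (ix d x i)) * M (ix d x i) (ix d y j) * v (ix d y j))"
      unfolding qf_def sum_ix ..
    also have "\<dots> = (\<Sum>x\<in>UNIV. \<Sum>i<d. \<Sum>y\<in>UNIV. if y = x then \<Sum>j<d. cnj (v (ix d x i)) * P x i j * v (ix d x j) else 0)"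
      by (intro sum.cong refl) (auto simp: M intro!: sum.cong sum.neutral)
    finally show ?thesis unfolding qf_def by simp
  qed
  then show ?thesis using psdfD[OF P] unfolding psdf_def by (simp add: sum_nonneg)
qed

text \<open>Here \<open>B\<close> is arbitrary: against a block-diagonal matrix its off-diagonal
  blocks do not contribute. Thus neither the smoothing state nor the sign matrix has to be classical
  on the first factor.\<close>

lemma trp_block_diagonal:
  fixes P :: "'a::finite \<Rightarrow> nat \<Rightarrow> nat \<Rightarrow> complex"
  assumes M: "\<And>x y i j. i < d \<Longrightarrow> j < d \<Longrightarrow> M (ix d x i) (ix d y j) = (if x = y then P x i j else 0)"
  shows "trp (CARD('a) * d) M B = (\<Sum>x\<in>UNIV. trp d (P x) (\<lambda>i j. B (ix d x i) (ix d x j)))"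
proof -
  have "(\<Sum>k<CARD('a) * d. \<Sum>l<CARD('a) * d. M k l * B l k) =
      (\<Sum>x\<in>(UNIV :: 'a set). \<Sum>i<d. \<Sum>y\<in>(UNIV :: 'a set). \<Sum>j<d. M (ix d x i) (ix d y j) * B (ix d y j) (ix d x i))"
    unfolding sum_ix ..
  also have "\<dots> = (\<Sum>x\<in>UNIV. \<Sum>i<d. \<Sum>y\<in>UNIV. if y = x then \<Sum>j<d. P x i j * B (ix d x j) (ix d x i) else 0)"
    by (intro sum.cong refl) (auto simp: M intro!: sum.cong sum.neutral)
  finally have "(\<Sum>k<CARD('a) * d. \<Sum>l<CARD('a) * d. M k l * B l k) =
      (\<Sum>x\<in>UNIV. \<Sum>i<d. \<Sum>j<d. P x i j * B (ix d x j) (ix d x i))" by simp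
  then show ?thesis unfolding trp_def by (simp only: Re_sum)
qed

lemma msum_index: "i < n \<Longrightarrow> j < n \<Longrightarrow> msum n I A $$ (i,j) = (\<Sum>k\<in>I. A k $$ (i,j))"
  by (simp add: msum_def)

lemma msum_carrier: "msum n I A \<in> carrier_mat n n"
  by (simp add: msum_def)

lemma mtrace_psd:
  assumes "psd n A"
  shows "mtrace A = of_real (trp n idf (\<lambda>i j. A $$ (i,j)))"
proof -
  have A: "A \<in> carrier_mat n n" "psdf n (\<lambda>i j. A $$ (i,j))" using assms by (auto simp: psd_iff_psdf)
  have "Im (\<Sum>i<n. A $$ (i,i)) = 0"
    unfolding Im_sum using psdf_diag(1)[OF A(2)] by (intro sum.neutral) auto
  then show ?thesis using A(1) unfolding trp_idf by (simp add: mtrace_def complex_eq_iff)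
qed

lemma trp_idf_state:
  assumes "is_state n A"
  shows "trp n idf (\<lambda>i j. A $$ (i,j)) = 1"
proof -
  have "complex_of_real (trp n idf (\<lambda>i j. A $$ (i,j))) = of_real 1"
    using assms mtrace_psd[of n A] unfolding is_state_def of_real_1 by argo
  then show ?thesis by (simp only: of_real_eq_iff)
qed

section \<open>Distance from uniform after hashing with one function\<close>

lemma bdd_below_trace_norm:
  "bdd_below ((\<lambda>\<sigma>. trace_norm (\<rho> - kron (c \<cdot>\<^sub>m 1\<^sub>m N) \<sigma>) / 2) ` {\<sigma>. is_state d \<sigma>})"
proof (rule bdd_belowI2[where m = 0])
  fix \<sigma> assume "\<sigma> \<in> {\<sigma>. is_state d \<sigma>}"
  then have "\<sigma> \<in> carrier_mat d d" by (auto simp: is_state_def psd_carrier)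
  then have "\<rho> - kron (c \<cdot>\<^sub>m 1\<^sub>m N) \<sigma> \<in> carrier_mat (N * d) (N * d)"
    by (intro minus_carrier_mat kron_one_carrier)
  then show "0 \<le> trace_norm (\<rho> - kron (c \<cdot>\<^sub>m 1\<^sub>m N) \<sigma>) / 2"
    using trace_norm_nonneg by simp
qed

text \<open>The blocks \<open>S\<close> of the sign matrix depend on \<open>f\<close>, so they stay
  existential; \<open>hashing_bound\<close> accepts any matrices between \<open>-1\<close> and
  \<open>1\<close>. Everything except the pairing with \<open>B\<close>, the deviation of the hashed
  \<open>\<rho>'\<close> from uniform, is absorbed into \<open>\<epsilon>\<close>.\<close>

lemma dist_unif_hash_le:
  fixes f :: "'x::finite \<Rightarrow> 's::finite" and \<rho>E :: "'x \<Rightarrow> complex mat"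
  defines "\<kappa> \<equiv> 1 / real CARD('s)"
  assumes rho: "\<And>x. psd d (\<rho>E x)" "is_state (CARD('x) * d) (cq_state d \<rho>E)"
    and rho': "is_subnormalized (CARD('x) * d) \<rho>'"
    and dist: "purified_distance (CARD('x) * d) (cq_state d \<rho>E) \<rho>' \<le> \<epsilon>"
    and sigma: "is_state d \<sigma>"
  defines "B \<equiv> \<lambda>s i j. \<Sum>x\<in>UNIV. complex_of_real ((if f x = s then 1 else 0) - \<kappa>) * \<rho>' $$ (ix d x i, ix d x j)"
  shows "\<exists>S. (\<forall>s. psdf d (\<lambda>i j. idf i j + S s i j)) \<and> (\<forall>s. psdf d (\<lambda>i j. idf i j - S s i j)) \<and>
    dist_unif CARD('s) d (cq_state d (\<lambda>s. msum d {x. f x = s} \<rho>E)) \<le> \<epsilon> + 1/2 * (\<Sum>s\<in>UNIV. trp d (S s) (B s))"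
proof -
  let ?N = "CARD('x) * d" let ?M = "CARD('s) * d"
  let ?e = "\<lambda>x i j. \<rho>E x $$ (i,j)" let ?\<sigma> = "\<lambda>i j. \<sigma> $$ (i,j)"
  define r where "r x i j = \<rho>' $$ (ix d x i, ix d x j)" for x :: 'x and i j
  have e: "psdf d (?e x)" "\<rho>E x \<in> carrier_mat d d" for x using rho(1) by (auto simp: psd_iff_psdf)
  have sig: "psdf d ?\<sigma>" "\<sigma> \<in> carrier_mat d d" using sigma by (auto simp: psd_iff_psdf is_state_def)
  have sig1: "trp d idf ?\<sigma> = 1" by (rule trp_idf_state[OF sigma])
  have psd': "psd ?N \<rho>'" using rho' by (simp add: is_subnormalized_def)
  then have psdf': "psdf ?N (\<lambda>i j. \<rho>' $$ (i,j))" by (simp add: psd_iff_psdf)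
  have r: "psdf d (r x)" for x unfolding r_def by (rule psdf_block[OF psdf'])
  define t where "t = (\<Sum>x\<in>UNIV. trp d idf (r x))"
  have idix: "idf (ix d x i) (ix d y j) = (if x = y then idf i j else 0)" if "i < d" "j < d" for x y :: 'x and i j
    using that by (simp add: ix_eq_iff)
  have "t = trp ?N idf (\<lambda>i j. \<rho>' $$ (i,j))"
    unfolding t_def r_def by (rule trp_block_diagonal[OF idix, symmetric])
  then have t1: "t \<le> 1" using rho' mtrace_psd[OF psd'] by (simp add: is_subnormalized_def)

  have cq: "cq_state d \<rho>E $$ (ix d x i, ix d y j) = (if x = y then ?e x i j else 0)" if "i < d" "j < d" for x y i j
    by (rule cq_state_index[OF that e(2)])
  have cqs: "psd ?N (cq_state d \<rho>E)" "mtrace (cq_state d \<rho>E) = 1" using rho(2) by (auto simp: is_state_def)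
  have e1: "(\<Sum>x\<in>UNIV. trp d idf (?e x)) = 1"
  proof -
    have "trp ?N idf (\<lambda>i j. cq_state d \<rho>E $$ (i,j)) = (\<Sum>x\<in>(UNIV :: 'x set). trp d idf (\<lambda>i j. cq_state d \<rho>E $$ (ix d x i, ix d x j)))"
      by (rule trp_block_diagonal[OF idix])
    also have "\<dots> = (\<Sum>x\<in>UNIV. trp d idf (?e x))"
      by (intro sum.cong refl trp_cong) (simp_all add: cq)
    finally show ?thesis unfolding trp_idf_state[OF rho(2)] by (rule sym)
  qed

  text \<open>\<open>\<tau> \<ge> \<rho>'_E\<close> has unit trace: this is where the deficit \<open>1 - t\<close> of the trace distance is absorbed.\<close>

  define \<tau> where "\<tau> i j = (\<Sum>x\<in>UNIV. r x i j) + complex_of_real (1 - t) * ?\<sigma> i j" for i j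
  define \<tau>m where "\<tau>m = mat d d (\<lambda>(i,j). \<tau> i j)"
  have \<tau>: "psdf d \<tau>"
    unfolding \<tau>_def using t1 by (intro psdf_add psdf_sum psdf_scale_const r sig) auto
  have \<tau>m: "\<tau>m \<in> carrier_mat d d" "\<And>i j. i < d \<Longrightarrow> j < d \<Longrightarrow> \<tau>m $$ (i,j) = \<tau> i j" by (auto simp: \<tau>m_def)
  have psd\<tau>: "psd d \<tau>m" using \<tau> \<tau>m psdf_cong[of d "\<lambda>i j. \<tau>m $$ (i,j)" \<tau>] by (simp add: psd_iff_psdf)
  have "trp d idf \<tau> = t + (1 - t) * 1"
    unfolding \<tau>_def trp_add_right trp_scale_right trp_sum_right[OF finite] sig1 t_def ..
  moreover have "trp d idf (\<lambda>i j. \<tau>m $$ (i,j)) = trp d idf \<tau>" by (intro trp_cong refl \<tau>m)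
  ultimately have st: "is_state d \<tau>m" using psd\<tau> mtrace_psd[OF psd\<tau>] by (simp add: is_state_def)
  define A where "A = cq_state d (\<lambda>s. msum d {x. f x = s} \<rho>E) - kron (complex_of_real \<kappa> \<cdot>\<^sub>m 1\<^sub>m CARD('s)) \<tau>m"
  define a where "a s i j = (\<Sum>x\<in>{x. f x = s}. ?e x i j) - complex_of_real \<kappa> * \<tau> i j" for s i j
  have K: "kron (complex_of_real \<kappa> \<cdot>\<^sub>m 1\<^sub>m CARD('s)) \<tau>m \<in> carrier_mat ?M ?M" by (rule kron_one_carrier[OF \<tau>m(1)])
  have A: "A \<in> carrier_mat ?M ?M" unfolding A_def by (rule minus_carrier_mat[OF K])
  have Aix: "A $$ (ix d s i, ix d s' j) = (if s = s' then a s i j else 0)" if ij: "i < d" "j < d" for s s' :: 's and i j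
  proof -
    have "A $$ (ix d s i, ix d s' j) = cq_state d (\<lambda>s. msum d {x. f x = s} \<rho>E) $$ (ix d s i, ix d s' j) -
        kron (complex_of_real \<kappa> \<cdot>\<^sub>m 1\<^sub>m CARD('s)) \<tau>m $$ (ix d s i, ix d s' j)"
      unfolding A_def using K ix_less[OF ij(1), of s] ix_less[OF ij(2), of s'] by (intro index_minus_mat) auto
    then show ?thesis
      unfolding cq_state_index[OF ij msum_carrier] kron_one_index[OF ij \<tau>m(1)]
      using ij by (simp add: msum_index \<tau>m a_def)
  qed
  have aherm: "a s i j = cnj (a s j i)" if "i < d" "j < d" for s i j
    unfolding a_def complex_cnj_diff cnj_sum complex_cnj_mult complex_cnj_complex_of_real
    by (simp only: psdf_hermitian[OF e(1) that, symmetric] psdf_hermitian[OF \<tau> that, symmetric])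
  have "A $$ (k,l) = cnj (A $$ (l,k))" if kl: "k < ?M" "l < ?M" for k l
  proof -
    obtain s i where k: "i < d" "k = ix d (s :: 's) i" by (rule ix_cases[OF kl(1)])
    obtain s' j where l: "j < d" "l = ix d (s' :: 's) j" by (rule ix_cases[OF kl(2)])
    show ?thesis
    proof (cases "s = s'")
      case True
      show ?thesis unfolding k(2) l(2) Aix[OF k(1) l(1)] Aix[OF l(1) k(1)] True
        by (simp only: simp_thms if_True) (rule aherm[OF k(1) l(1)])
    next
      case False
      then show ?thesis unfolding k(2) l(2) Aix[OF k(1) l(1)] Aix[OF l(1) k(1)] by simp
    qed
  qed
  from trace_norm_sign[OF A this] obtain S0 where S0: "psdf ?M (\<lambda>i j. idf i j + S0 i j)" "psdf ?M (\<lambda>i j. idf i j - S0 i j)"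
    and tn: "trace_norm A = trp ?M S0 (\<lambda>i j. A $$ (i,j))" by blast
  define S where "S s i j = S0 (ix d s i) (ix d s j)" for s :: 's and i j
  have idix': "idf (ix d s i) (ix d s j) = idf i j" if "i < d" "j < d" for s :: 's and i j
    using that by (simp add: ix_eq_iff)
  have S: "psdf d (\<lambda>i j. idf i j + S s i j)" "psdf d (\<lambda>i j. idf i j - S s i j)" for s
    using psdf_block[OF S0(1), of s] psdf_block[OF S0(2), of s]
      psdf_cong[of d "\<lambda>i j. idf (ix d s i) (ix d s j) + S0 (ix d s i) (ix d s j)" "\<lambda>i j. idf i j + S s i j"]
      psdf_cong[of d "\<lambda>i j. idf (ix d s i) (ix d s j) - S0 (ix d s i) (ix d s j)" "\<lambda>i j. idf i j - S s i j"]
    unfolding S_def by (simp_all only: idix')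
  have "trace_norm A = trp ?M (\<lambda>i j. A $$ (i,j)) S0"
    unfolding tn by (rule trp_commute)
  also have "\<dots> = (\<Sum>s\<in>UNIV. trp d (a s) (S s))"
    unfolding S_def by (rule trp_block_diagonal[OF Aix])
  also have "\<dots> = (\<Sum>s\<in>UNIV. trp d (S s) (a s))"
    by (rule sum.cong[OF refl], rule trp_commute)
  also have "\<dots> = (\<Sum>s\<in>UNIV. (\<Sum>x | f x = s. trp d (S s) (?e x)) - \<kappa> * ((\<Sum>x\<in>UNIV. trp d (S s) (r x)) + (1 - t) * trp d (S s) ?\<sigma>))"
    unfolding a_def \<tau>_def trp_diff_right trp_scale_right trp_add_right trp_sum_right[OF finite] ..
  \<comment> \<open>Since \<open>S s \<ge> -1\<close> and \<open>\<sigma>\<close> has trace one, the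
    last pairing is at least \<open>-1\<close>. Each \<open>s\<close> costs
    \<open>\<kappa> * (1 - t)\<close>, which adds up to \<open>1 - t\<close> over the whole
    range.\<close>
  also have "\<dots> \<le> (\<Sum>s\<in>UNIV. (\<Sum>x | f x = s. trp d (S s) (?e x)) - \<kappa> * (\<Sum>x\<in>UNIV. trp d (S s) (r x)) + \<kappa> * (1 - t))"
  proof (rule sum_mono)
    fix s
    have "0 \<le> trp d (\<lambda>i j. idf i j + S s i j) ?\<sigma>" by (rule trp_nonneg[OF S(1) sig(1)])
    then have "- 1 \<le> trp d (S s) ?\<sigma>" unfolding trp_add_left sig1 by simp
    then have "\<kappa> * (1 - t) * (- 1) \<le> \<kappa> * (1 - t) * trp d (S s) ?\<sigma>"
      using t1 by (intro mult_left_mono) (auto simp: \<kappa>_def)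
    then show "(\<Sum>x | f x = s. trp d (S s) (?e x)) - \<kappa> * ((\<Sum>x\<in>UNIV. trp d (S s) (r x)) + (1 - t) * trp d (S s) ?\<sigma>)
      \<le> (\<Sum>x | f x = s. trp d (S s) (?e x)) - \<kappa> * (\<Sum>x\<in>UNIV. trp d (S s) (r x)) + \<kappa> * (1 - t)"
      by (simp add: algebra_simps)
  qed
  also have "\<dots> = (\<Sum>s\<in>UNIV. \<Sum>x | f x = s. trp d (S s) (?e x)) - (\<Sum>s\<in>UNIV. \<kappa> * (\<Sum>x\<in>UNIV. trp d (S s) (r x))) + (1 - t)"
    by (simp add: sum.distrib sum_subtractf \<kappa>_def)
  \<comment> \<open>The sum of the pairings of \<open>S (f x)\<close> with \<open>r x\<close> is
    added and subtracted, and sums over the fibres of \<open>f\<close> become sums over all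
    \<open>x\<close>.\<close>
  also have "\<dots> = (\<Sum>s\<in>UNIV. trp d (S s) (B s)) + ((\<Sum>x\<in>UNIV. trp d (S (f x)) (?e x)) - (\<Sum>x\<in>UNIV. trp d (S (f x)) (r x))) + (1 - t)"
  proof -
    have grp: "(\<Sum>s\<in>UNIV. \<Sum>x | f x = s. h s x) = (\<Sum>x\<in>UNIV. h (f x) x)" for h :: "'s \<Rightarrow> 'x \<Rightarrow> real"
    proof -
      have "(\<Sum>s\<in>UNIV. \<Sum>x | f x = s. h s x) = (\<Sum>s\<in>UNIV. \<Sum>x | f x = s. h (f x) x)"
        by (intro sum.cong refl) auto
      then show ?thesis using sum.group[of "UNIV :: 'x set" "UNIV :: 's set" f "\<lambda>x. h (f x) x"] by simp
    qed
    have "trp d (S s) (B s) = (\<Sum>x | f x = s. trp d (S s) (r x)) - \<kappa> * (\<Sum>x\<in>UNIV. trp d (S s) (r x))" for s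
    proof -
      have "trp d (S s) (B s) = (\<Sum>x\<in>UNIV. ((if f x = s then 1 else 0) - \<kappa>) * trp d (S s) (r x))"
        unfolding B_def r_def[symmetric] trp_sum_right[OF finite] trp_scale_right ..
      also have "\<dots> = (\<Sum>x\<in>UNIV. if f x = s then trp d (S s) (r x) else 0) - \<kappa> * (\<Sum>x\<in>UNIV. trp d (S s) (r x))"
        unfolding sum_distrib_left sum_subtractf[symmetric] by (intro sum.cong refl) (simp add: algebra_simps)
      finally show ?thesis by (simp add: sum.If_cases)
    qed
    then show ?thesis by (simp add: sum_subtractf grp)
  qed
  finally have tnle: "trace_norm A \<le> (\<Sum>s\<in>UNIV. trp d (S s) (B s)) + ((\<Sum>x\<in>UNIV. trp d (S (f x)) (?e x)) - (\<Sum>x\<in>UNIV. trp d (S (f x)) (r x))) + (1 - t)" .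

  \<comment> \<open>The test pulled back along \<open>f\<close>. Its identity part contributes
    \<open>(1 - t) / 2\<close>, so the bound by the purified distance covers the deficit term of
    \<open>tnle\<close> together with the smoothing difference.\<close>
  define Q where "Q x i j = complex_of_real (1/2) * (idf i j + S (f x) i j)" for x i j
  have Q: "psdf d (Q x)" for x unfolding Q_def by (rule psdf_scale_const[OF S(1)]) simp
  have Q': "psdf d (\<lambda>i j. idf i j - Q x i j)" for x
  proof -
    have "psdf d (\<lambda>i j. complex_of_real (1/2) * (idf i j - S (f x) i j))" by (rule psdf_scale_const[OF S(2)]) simp
    then show ?thesis by (rule iffD1[OF psdf_cong, rotated]) (simp add: Q_def field_simps)
  qed
  have "trp ?N (bdiag d Q) (\<lambda>i j. cq_state d \<rho>E $$ (i,j)) - trp ?N (bdiag d Q) (\<lambda>i j. \<rho>' $$ (i,j))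
      \<le> purified_distance ?N (cq_state d \<rho>E) \<rho>'"
  proof (rule purified_distance_ge[OF cqs rho'])
    show "psdf ?N (bdiag d Q)" by (rule psdf_block_diagonal[OF Q bdiag_index])
    show "psdf ?N (\<lambda>i j. idf i j - bdiag d Q i j)"
    proof (rule psdf_block_diagonal[OF Q'])
      fix x y :: 'x and i j assume ij: "i < d" "j < d"
      show "idf (ix d x i) (ix d y j) - bdiag d Q (ix d x i) (ix d y j) = (if x = y then idf i j - Q x i j else 0)"
        unfolding idix[OF ij] bdiag_index[OF ij] by simp
    qed
  qed
  also have "trp ?N (bdiag d Q) (\<lambda>i j. cq_state d \<rho>E $$ (i,j)) = (\<Sum>x\<in>UNIV. trp d (Q x) (?e x))"
    by (rule trans[OF trp_block_diagonal[OF bdiag_index]], assumption+)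
      (intro sum.cong refl trp_cong, simp_all add: cq)
  also have "trp ?N (bdiag d Q) (\<lambda>i j. \<rho>' $$ (i,j)) = (\<Sum>x\<in>UNIV. trp d (Q x) (r x))"
    unfolding r_def by (rule trp_block_diagonal[OF bdiag_index])
  also have "(\<Sum>x\<in>UNIV. trp d (Q x) (?e x)) = 1/2 * (1 + (\<Sum>x\<in>UNIV. trp d (S (f x)) (?e x)))"
    unfolding Q_def trp_scale_left trp_add_left sum_distrib_left[symmetric] sum.distrib e1 ..
  also have "(\<Sum>x\<in>UNIV. trp d (Q x) (r x)) = 1/2 * (t + (\<Sum>x\<in>UNIV. trp d (S (f x)) (r x)))"
    unfolding Q_def trp_scale_left trp_add_left sum_distrib_left[symmetric] sum.distrib t_def ..
  finally have "trace_norm A / 2 \<le> \<epsilon> + 1/2 * (\<Sum>s\<in>UNIV. trp d (S s) (B s))"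
    using tnle dist by (simp add: field_simps)
  moreover have "dist_unif CARD('s) d (cq_state d (\<lambda>s. msum d {x. f x = s} \<rho>E)) \<le> trace_norm A / 2"
    unfolding dist_unif_def A_def \<kappa>_def using st by (intro cINF_lower[OF bdd_below_trace_norm]) simp
  ultimately show ?thesis using S by (intro exI[of _ S]) auto
qed

text \<open>The matrices supplied for each \<open>f\<close> by \<open>dist_unif_hash_le\<close> are
  collected by choice and passed to \<open>hashing_bound\<close>, which controls the unweighted sum
  over \<open>F\<close>. There the weights enter only through \<open>P f \<le> b\<close>, while
  \<open>\<epsilon>\<close> is multiplied by the total weight one.\<close>

lemma sum_dist_unif_le:
  fixes F :: "('x::finite \<Rightarrow> 's::finite) set" and P :: "('x \<Rightarrow> 's) \<Rightarrow> real" and \<rho>E :: "'x \<Rightarrow> complex mat"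
  assumes F: "two_universal F"
    and P: "\<And>f. f \<in> F \<Longrightarrow> 0 \<le> P f" "(\<Sum>f\<in>F. P f) = 1" "\<And>f. f \<in> F \<Longrightarrow> P f \<le> b"
    and rho: "\<And>x. psd d (\<rho>E x)" "is_state (CARD('x) * d) (cq_state d \<rho>E)"
    and rho': "is_subnormalized (CARD('x) * d) \<rho>'"
    and dist: "purified_distance (CARD('x) * d) (cq_state d \<rho>E) \<rho>' \<le> \<epsilon>"
    and sigma: "is_state d \<sigma>" and c: "0 \<le> c"
    and le: "mle (CARD('x) * d) \<rho>' (kron (complex_of_real c \<cdot>\<^sub>m 1\<^sub>m CARD('x)) \<sigma>)"
  shows "(\<Sum>f\<in>F. P f * dist_unif CARD('s) d (cq_state d (\<lambda>s. msum d {x. f x = s} \<rho>E)))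
    \<le> 1/2 * b * real (card F) * sqrt (real CARD('s) * c) + \<epsilon>"
proof -
  let ?N = "CARD('x) * d"
  define r where "r x i j = \<rho>' $$ (ix d x i, ix d x j)" for x :: 'x and i j
  define B where "B f s i j = (\<Sum>x\<in>UNIV. complex_of_real ((if f x = s then 1 else 0) - 1 / real CARD('s)) * r x i j)"
    for f :: "'x \<Rightarrow> 's" and s i j
  define D where "D f = dist_unif CARD('s) d (cq_state d (\<lambda>s. msum d {x. f x = s} \<rho>E))" for f :: "'x \<Rightarrow> 's"
  have "\<exists>S. (\<forall>s. psdf d (\<lambda>i j. idf i j + S s i j)) \<and> (\<forall>s. psdf d (\<lambda>i j. idf i j - S s i j)) \<and>
      D f \<le> \<epsilon> + 1/2 * (\<Sum>s\<in>UNIV. trp d (S s) (B f s))" for f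
    unfolding D_def B_def r_def by (rule dist_unif_hash_le[OF rho rho' dist sigma])
  then have "\<exists>S. \<forall>f. (\<forall>s. psdf d (\<lambda>i j. idf i j + S f s i j)) \<and> (\<forall>s. psdf d (\<lambda>i j. idf i j - S f s i j)) \<and>
      D f \<le> \<epsilon> + 1/2 * (\<Sum>s\<in>UNIV. trp d (S f s) (B f s))"
    by (intro choice allI)
  then obtain S where S: "\<And>f s. psdf d (\<lambda>i j. idf i j + S f s i j)" "\<And>f s. psdf d (\<lambda>i j. idf i j - S f s i j)"
    and DS: "\<And>f. D f \<le> \<epsilon> + 1/2 * (\<Sum>s\<in>UNIV. trp d (S f s) (B f s))"
    by blast
  define X where "X f = (\<Sum>s\<in>UNIV. trp d (S f s) (B f s))" for f
  \<comment> \<open>Replacing \<open>P f\<close> by \<open>b\<close> is monotone only on nonnegative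
    terms, and the sign of \<open>X f\<close> is not known. Taking \<open>U f = 0\<close> when it is
    negative respects the bounds on \<open>U\<close> and turns \<open>X f\<close> into
    \<open>max 0 (X f)\<close>.\<close>
  define U where "U f s i j = (if 0 \<le> X f then S f s i j else 0)" for f s i j
  have idf0: "psdf d idf"
  proof (rule psdf_gramI[where I = "{..<d}" and R = idf])
    fix i j assume ij: "i < d" "j < d"
    have "(\<Sum>m<d. cnj (idf m i) * idf m j) = (\<Sum>m<d. if m = i then idf i j else 0)"
      by (intro sum.cong refl) simp
    then show "idf i j = (\<Sum>m<d. cnj (idf m i) * idf m j)" using ij by (simp add: sum.delta)
  qed
  have U: "psdf d (\<lambda>i j. idf i j + U f s i j)" "psdf d (\<lambda>i j. idf i j - U f s i j)" for f s
    unfolding U_def using S[of f s] idf0 by (cases "0 \<le> X f"; simp)+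
  have XU: "(\<Sum>s\<in>UNIV. trp d (U f s) (B f s)) = max 0 (X f)" for f
  proof (cases "0 \<le> X f")
    case True
    then have "U f s = S f s" for s by (simp add: U_def fun_eq_iff)
    then show ?thesis using True by (simp add: X_def)
  next
    case False
    then have "trp d (U f s) (B f s) = 0" for s by (simp add: U_def trp_def)
    then show ?thesis using False by simp
  qed
  have psd': "psd ?N \<rho>'" using rho' by (simp add: is_subnormalized_def)
  then have psdf': "\<rho>' \<in> carrier_mat ?N ?N" "psdf ?N (\<lambda>i j. \<rho>' $$ (i,j))" by (simp_all add: psd_iff_psdf)
  have sig: "psdf d (\<lambda>i j. \<sigma> $$ (i,j))" "\<sigma> \<in> carrier_mat d d" and psds: "psd d \<sigma>"
    using sigma by (auto simp: psd_iff_psdf is_state_def)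
  have hash: "(\<Sum>f\<in>F. \<Sum>s\<in>UNIV. trp d (U f s) (B f s)) \<le> real (card F) * sqrt (real CARD('s) * c)"
    unfolding B_def
  proof (rule hashing_bound[OF F _ _ sig(1) _ c _ U])
    show "psdf d (r x)" for x unfolding r_def by (rule psdf_block[OF psdf'(2)])
    show "psdf d (\<lambda>i j. complex_of_real c * \<sigma> $$ (i,j) - r x i j)" for x
    proof -
      let ?K = "kron (complex_of_real c \<cdot>\<^sub>m 1\<^sub>m CARD('x)) \<sigma>"
      have K: "?K \<in> carrier_mat ?N ?N" by (rule kron_one_carrier[OF sig(2)])
      have "psdf ?N (\<lambda>i j. (?K - \<rho>') $$ (i,j))" using le by (simp add: mle_def psd_iff_psdf)
      then have "psdf d (\<lambda>i j. (?K - \<rho>') $$ (ix d x i, ix d x j))" by (rule psdf_block)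
      then show ?thesis
      proof (rule iffD1[OF psdf_cong, rotated])
        fix i j assume ij: "i < d" "j < d"
        have "(?K - \<rho>') $$ (ix d x i, ix d x j) = ?K $$ (ix d x i, ix d x j) - \<rho>' $$ (ix d x i, ix d x j)"
          using psdf'(1) ix_less[OF ij(1), of x] ix_less[OF ij(2), of x] by (intro index_minus_mat) auto
        then show "(?K - \<rho>') $$ (ix d x i, ix d x j) = complex_of_real c * \<sigma> $$ (i,j) - r x i j"
          unfolding kron_one_index[OF ij sig(2)] r_def by simp
      qed
    qed
    show "trp d idf (\<lambda>i j. \<sigma> $$ (i,j)) = 1"
      by (rule trp_idf_state[OF sigma])
    have "trp ?N (\<lambda>i j. \<rho>' $$ (i,j)) idf = (\<Sum>x\<in>UNIV. trp d (r x) idf)"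
      unfolding trp_commute[of _ _ idf] trp_idf sum_ix r_def Re_sum ..
    then have "(\<Sum>x\<in>UNIV. trp d idf (r x)) = trp ?N idf (\<lambda>i j. \<rho>' $$ (i,j))"
      unfolding trp_commute[of _ _ idf] by simp
    then show "(\<Sum>x\<in>UNIV. trp d idf (r x)) \<le> 1"
      using rho' mtrace_psd[OF psd'] by (simp add: is_subnormalized_def)
  qed
  have F0: "F \<noteq> {}" using F by (simp add: two_universal_def)
  then have b0: "0 \<le> b" using P(1,3) by (meson all_not_in_conv order_trans)
  have "(\<Sum>f\<in>F. P f * D f) \<le> (\<Sum>f\<in>F. \<epsilon> * P f + b * (1/2 * max 0 (X f)))"
  proof (rule sum_mono)
    fix f assume f: "f \<in> F"
    have "P f * D f \<le> P f * (\<epsilon> + 1/2 * max 0 (X f))"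
      using DS[of f] P(1)[OF f] unfolding X_def by (intro mult_left_mono) auto
    also have "\<dots> \<le> \<epsilon> * P f + b * (1/2 * max 0 (X f))"
      using mult_right_mono[OF P(3)[OF f], of "1/2 * max 0 (X f)"] by (simp add: algebra_simps)
    finally show "P f * D f \<le> \<epsilon> * P f + b * (1/2 * max 0 (X f))" .
  qed
  also have "\<dots> = \<epsilon> + 1/2 * b * (\<Sum>f\<in>F. max 0 (X f))"
    unfolding sum.distrib sum_distrib_left[symmetric] P(2) by simp
  also have "\<dots> \<le> \<epsilon> + 1/2 * b * (real (card F) * sqrt (real CARD('s) * c))"
    using hash b0 unfolding XU by (intro add_left_mono mult_left_mono) auto
  finally show ?thesis unfolding D_def by (simp add: mult_ac)
qed

section \<open>Passage to extended real entropies\<close>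

lemma exp2e_nonneg: "0 \<le> exp2e t"
  by (cases t) (auto simp: exp2e_def)

text \<open>The supremum \<open>H\<close> need not be attained, so the hypothesis supplies some
  \<open>lam\<close> above each \<open>u < H\<close>. For \<open>L > 0\<close>, let \<open>u\<close>
  be the threshold beyond which the bound on \<open>L\<close> fails; then \<open>H \<le> u\<close>,
  which is the claim for finite \<open>H\<close> and excludes \<open>H = \<infinity>\<close>. For
  \<open>H = -\<infinity>\<close> the right side is infinite. The case \<open>L \<le> 0\<close> is
  separate because of the logarithm.\<close>

lemma le_mult_exp2e:
  fixes H :: ereal and C L :: real
  assumes C: "0 < C" and bound: "\<And>u. H \<le> u \<or> (\<exists>lam. ereal lam > u \<and> L \<le> C * 2 powr (- (lam - l) / 2))"
  shows "ereal L \<le> ereal C * exp2e (- (H - ereal l) / 2)"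
proof (cases "L \<le> 0")
  case True
  then have "ereal L \<le> 0" by simp
  also have "\<dots> \<le> ereal C * exp2e (- (H - ereal l) / 2)" using C exp2e_nonneg by simp
  finally show ?thesis .
next
  case False
  \<comment> \<open>The solution in \<open>lam\<close> of
    \<open>L = C * 2 powr (- (lam - l) / 2)\<close>.\<close>
  define u where "u = l - 2 * log 2 (L / C)"
  have lu: "lam \<le> u" if "L \<le> C * 2 powr (- (lam - l) / 2)" for lam
  proof -
    have "L / C \<le> 2 powr (- (lam - l) / 2)" using that C by (simp add: field_simps)
    then have "log 2 (L / C) \<le> - (lam - l) / 2"
      using False C by (subst log_le_iff) auto
    then show ?thesis by (simp add: u_def field_simps)
  qed
  have Hu: "H \<le> ereal u"
    using bound[of "ereal u"] lu by (metis ereal_less_eq(3) linorder_not_less)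
  show ?thesis
  proof (cases H)
    case (real h)
    then have "log 2 (L / C) \<le> - (h - l) / 2" using Hu by (simp add: u_def field_simps)
    then have "L / C \<le> 2 powr (- (h - l) / 2)" using False C by (subst (asm) log_le_iff) auto
    then have "L \<le> C * 2 powr (- (h - l) / 2)" using C by (simp add: field_simps)
    moreover have "- (H - ereal l) / 2 = ereal (- (h - l) / 2)" using real by simp
    ultimately show ?thesis by (simp add: exp2e_def)
  next
    case PInf
    then show ?thesis using Hu by simp
  next
    case MInf
    then show ?thesis using C by (simp add: exp2e_def)
  qed
qed

theorem theorem1:
  fixes F :: "('x::finite \<Rightarrow> 's::finite) set"
    and P :: "('x \<Rightarrow> 's) \<Rightarrow> real"
    and \<rho>E :: "'x \<Rightarrow> complex mat"
    and d l \<alpha> :: nat and \<beta> \<epsilon> :: real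
  assumes "CARD('s) = 2 ^ l"
    and "two_universal F"
    and "card F = 2 ^ \<alpha>"
    and "\<forall>f\<in>F. P f \<ge> 0" and "(\<Sum>f\<in>F. P f) = 1"
    and "\<forall>f\<in>F. P f \<le> 2 powr (- \<beta>)"
    and "\<forall>x. psd d (\<rho>E x)"
    and "is_state (CARD('x) * d) (cq_state d \<rho>E)"
    and "\<epsilon> \<ge> 0"
  shows "ereal (\<Sum>f\<in>F. P f * dist_unif CARD('s) d (cq_state d (\<lambda>s. msum d {x. f x = s} \<rho>E)))
           \<le> ereal (1/2 * 2 powr (real \<alpha> - \<beta>))
               * exp2e (- (hmin_smooth CARD('x) d \<epsilon> (cq_state d \<rho>E) - ereal (real l)) / 2)
             + ereal \<epsilon>"
proof -
  define L where "L = (\<Sum>f\<in>F. P f * dist_unif CARD('s) d (cq_state d (\<lambda>s. msum d {x. f x = s} \<rho>E)))"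
  let ?C = "1/2 * 2 powr (real \<alpha> - \<beta>)" let ?H = "hmin_smooth CARD('x) d \<epsilon> (cq_state d \<rho>E)"
  \<comment> \<open>With \<open>\<epsilon>\<close> on the left only the product remains on the
    right, as \<open>le_mult_exp2e\<close> requires; it admits a negative
    \<open>L - \<epsilon>\<close>.\<close>
  have "ereal (L - \<epsilon>) \<le> ereal ?C * exp2e (- (?H - ereal (real l)) / 2)"
  proof (rule le_mult_exp2e)
    fix u :: ereal
    show "?H \<le> u \<or> (\<exists>lam. ereal lam > u \<and> L - \<epsilon> \<le> ?C * 2 powr (- (lam - real l) / 2))"
    proof (cases "?H \<le> u")
      case False
      \<comment> \<open>All three nested suprema are unfolded at once: exceeding \<open>u\<close>
        yields a smoothing state, a reference state and an admissible \<open>lam\<close> above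
        \<open>u\<close>.\<close>
      then obtain \<rho>' \<sigma> lam where rho': "is_subnormalized (CARD('x) * d) \<rho>'"
        "purified_distance (CARD('x) * d) (cq_state d \<rho>E) \<rho>' \<le> \<epsilon>" "is_state d \<sigma>"
        and le: "mle (CARD('x) * d) \<rho>' (kron (complex_of_real (2 powr (- lam)) \<cdot>\<^sub>m 1\<^sub>m CARD('x)) \<sigma>)"
        and lam: "ereal lam > u"
        by (auto simp: hmin_smooth_def hmin_def not_le less_Sup_iff)
      have "L \<le> 1/2 * 2 powr (- \<beta>) * real (card F) * sqrt (real CARD('s) * 2 powr (- lam)) + \<epsilon>"
        unfolding L_def
        by (rule sum_dist_unif_le[OF assms(2) _ assms(5) _ _ assms(8) rho' _ le]) (use assms in auto)
      \<comment> \<open>Here \<open>|F| = 2 powr \<alpha>\<close> joins the bound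
        \<open>2 powr (- \<beta>)\<close> on the seed, and the square root of \<open>|S| c\<close>
        with \<open>|S| = 2 powr l\<close> supplies the half in the exponent.\<close>
      also have "1/2 * 2 powr (- \<beta>) * real (card F) * sqrt (real CARD('s) * 2 powr (- lam)) = ?C * 2 powr (- (lam - real l) / 2)"
      proof -
        have "real CARD('s) * 2 powr (- lam) = 2 powr (real l - lam)"
          using assms(1) by (simp add: powr_diff powr_minus powr_realpow field_simps)
        then have "sqrt (real CARD('s) * 2 powr (- lam)) = 2 powr (- (lam - real l) / 2)"
          by (simp add: powr_half_sqrt[symmetric] powr_powr)
        moreover have "2 powr (- \<beta>) * real (card F) = 2 powr (real \<alpha> - \<beta>)"
          using assms(3) by (simp add: powr_diff powr_minus powr_realpow field_simps)
        ultimately show ?thesis by simp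
      qed
      finally show ?thesis using lam by auto
    qed simp
  qed simp
  then have "ereal (L - \<epsilon>) + ereal \<epsilon> \<le> ereal ?C * exp2e (- (?H - ereal (real l)) / 2) + ereal \<epsilon>"
    by (rule add_right_mono)
  then show ?thesis unfolding L_def by simp
qed

end
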